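(* Let $\phi$, $(\rho^0,u^0)$, $A$, $X$, $L(m)$ be as in the context (in particular, $A$ is convex in a neighborhood of every point of $\partial\Sigma_-$). Assume that $\phi$ is heavy-tailed, i.e. $\int_1^\infty\phi(r)\,dr=\infty$, and suppose that $m',m''\in(-\frac12,\frac12]$ satisfy $L(m')=L(m'')$ and $m'<m''$. Then $$X(m'',t)-X(m',t)\le D^0e^{-\underline{\phi}\,t},\qquad\forall\,t\ge0,$$ where $D^0=\mathrm{diam}\,\mathrm{supp}\,\rho^0$ and $\underline\phi>0$ is the uniform communication lower bound described in the context. Consequently, $L(m')=L(m'')$ is an infinite-time cluster.
   Context: Kernel: $\phi:\mathbb{R}\to\mathbb{R}$ is nonnegative, even, locally integrable, and radially nonincreasing (nonincreasing on $(0,\infty)$; it may be unbounded at $0$). $\Phi(x)=\int_0^x\phi(r)\,dr$. Data: $\rho^0$ is a compactly supported Borel probability measure on $\mathbb{R}$ and $u^0\in L^\infty(d\rho^0)$. Set $M^0(x)=-\frac12+\rho^0((-\infty,x])$, $X^0(m)=\inf\{x: M^0(x)\ge m\}$ for $m\in(-\frac12,\frac12]$, $\psi^0=u^0+\Phi*\rho^0$, and define the flux $A:[-\frac12,\frac12]\to\mathbb{R}$, $A(m)=\int_{-1/2}^m\psi^0(X^0(\widetilde m))\,d\widetilde m$ (a Lipschitz function). Entropy solution: $M=M(x,t)$ denotes the unique entropy solution of $\partial_tM+\partial_x(A(M))=(\Phi*\partial_xM)\,\partial_xM$ with $M(\cdot,0)=M^0$. That is: for each $t$, $M(x,t)=-\frac12+\rho(t)((-\infty,x])$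 for a probability measure $\rho(t)$ on $\mathbb{R}$, with supports bounded locally uniformly in $t$; $t\mapsto M(\cdot,t)-M^0$ is continuous into $L^1(\mathbb{R})$ and vanishes at $t=0$; and for every $\alpha\in[-\frac12,\frac12]$, $\partial_t|M-\alpha|+\partial_x\big(\mathrm{sgn}(M-\alpha)(A(M)-A(\alpha))\big)\le(\Phi*\partial_xM)\,\partial_x|M-\alpha|$ in the sense of distributions on $\mathbb{R}\times(0,\infty)$. Put $X(m,t)=\inf\{x: M(x,t)\ge m\}$ for $m\in(-\frac12,\frac12]$. Lower bound $\underline\phi$: it is known that when $\phi$ is heavy-tailed there is a time-independent constant $\overline D>0$ with $\mathrm{diam}\,\mathrm{supp}\,\rho(t)\le\overline D$ for all $t\ge0$; set $\underline\phi=\phi(\overline D)>0$, so that $\phi(x-y)\ge\underline\phi>0$ for all $x,y\in\mathrm{supp}\,\rho(t)$ and all $t\ge0$. Infinite-time clusters: there is an infinite-time cluster at $m$ if there is $\widetilde m<m$ (in $(-\frac12,\frac12]$) with $X(m,t)-X(\widetilde m,t)\to0$ as $t\to\infty$; the infinite-time cluster at $m$ is then the largest interval $I$ of the form $(a,b]$ or $(a,b)$ containing $m$ such that $\mathrm{diam}\,X(I,t)\to0$ as $t\to\infty$. Regions: $A^{**}$ is the lower convex envelope of $A$ on $[-\frac12,\frac12]$. "Linear" means affine. $\Sigma_+$ is the set of $m\in(-\frac12,\frac12]$ such that $A^{**}$ is not linear on any interval of the form $(m',m]$. $\Sigma_-=\{m\in(-\frac12,\frac12):A(m)>A^{**}(m)\}$.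 For $m\notin\Sigma_+$, $L(m)$ is the largest half-open interval $(a,b]$ containing $m$ on which $A^{**}$ is linear; for $m\in\Sigma_+$, $L(m)=\{m\}$. Standing assumption: $A$ is convex in a neighborhood (relative to $[-\frac12,\frac12]$) of every point of the boundary $\partial\Sigma_-$. *)

theory Defs
  imports "HOL-Probability.Probability"
begin

section \<open>The kernel and the data\<close>

text \<open>The value of the kernel at the origin is irrelevant: a kernel that blows up at 0 is
  represented by a function with an arbitrary value there.\<close>

definition communication_kernel :: "(real \<Rightarrow> real) \<Rightarrow> bool" where
  "communication_kernel \<phi> \<longleftrightarrow>
     (\<forall>x. 0 \<le> \<phi> x) \<and> (\<forall>x. \<phi> (- x) = \<phi> x) \<and>
     (\<forall>a b. set_integrable lborel {a..b} \<phi>) \<and>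
     antimono_on {0<..} \<phi>"

definition heavy_tailed :: "(real \<Rightarrow> real) \<Rightarrow> bool" where
  "heavy_tailed \<phi> \<longleftrightarrow> (\<integral>\<^sup>+ r. ennreal (\<phi> r) * indicator {1..} r \<partial>lborel) = \<infinity>"

definition potential :: "(real \<Rightarrow> real) \<Rightarrow> real \<Rightarrow> real" where
  "potential \<phi> x = (LBINT r=ereal 0..ereal x. \<phi> r)"

definition potential_conv :: "(real \<Rightarrow> real) \<Rightarrow> real measure \<Rightarrow> real \<Rightarrow> real" where
  "potential_conv \<phi> \<mu> x = (\<integral>y. potential \<phi> (x - y) \<partial>\<mu>)"

definition msupport :: "real measure \<Rightarrow> real set" where
  "msupport \<mu> = {x. \<forall>\<epsilon>>0. emeasure \<mu> (ball x \<epsilon>) \<noteq> 0}"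

definition centered_cdf :: "real measure \<Rightarrow> real \<Rightarrow> real" where
  "centered_cdf \<mu> x = - 1/2 + cdf \<mu> x"

definition gen_inverse :: "(real \<Rightarrow> real) \<Rightarrow> real \<Rightarrow> real" where
  "gen_inverse F m = Inf {x. m \<le> F x}"

definition flux :: "(real \<Rightarrow> real) \<Rightarrow> real measure \<Rightarrow> (real \<Rightarrow> real) \<Rightarrow> real \<Rightarrow> real" where
  "flux \<phi> \<rho>0 u0 m =
     (let X0 = gen_inverse (centered_cdf \<rho>0);
          \<psi>0 = (\<lambda>x. u0 x + potential_conv \<phi> \<rho>0 x)
      in LBINT s:{- 1/2..m}. \<psi>0 (X0 s))"


section \<open>Entropy solutions\<close>

definition partial_x :: "(real \<times> real \<Rightarrow> real) \<Rightarrow> real \<times> real \<Rightarrow> real" where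
  "partial_x f p = frechet_derivative f (at p) (1, 0)"

definition partial_t :: "(real \<times> real \<Rightarrow> real) \<Rightarrow> real \<times> real \<Rightarrow> real" where
  "partial_t f p = frechet_derivative f (at p) (0, 1)"

primrec C_k :: "nat \<Rightarrow> (real \<times> real \<Rightarrow> real) \<Rightarrow> bool" where
  "C_k 0 f \<longleftrightarrow> continuous_on UNIV f"
| "C_k (Suc k) f \<longleftrightarrow> (\<forall>p. f differentiable (at p)) \<and> C_k k (partial_x f) \<and> C_k k (partial_t f)"

text \<open>Nonnegative smooth functions of (x, t) with compact support in the open half plane t > 0.\<close>

definition nonneg_test_function :: "(real \<times> real \<Rightarrow> real) \<Rightarrow> bool" where
  "nonneg_test_function \<zeta> \<longleftrightarrow>
     (\<forall>p. 0 \<le> \<zeta> p) \<and> (\<forall>k. C_k k \<zeta>) \<and>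
     compact (closure {p. \<zeta> p \<noteq> 0}) \<and> closure {p. \<zeta> p \<noteq> 0} \<subseteq> UNIV \<times> {0<..}"

text \<open>For nondecreasing right-continuous F, the distributional derivative of |F - \<alpha>| is a signed
  measure. Since |F - \<alpha>| = max F \<alpha> - min F \<alpha>, it is the difference of the Lebesgue-Stieltjes
  measures of the two nondecreasing functions max F \<alpha> and min F \<alpha>; the following is the
  integral of f against it.\<close>

definition integral_d_abs :: "(real \<Rightarrow> real) \<Rightarrow> real \<Rightarrow> (real \<Rightarrow> real) \<Rightarrow> real" where
  "integral_d_abs F \<alpha> f =
     (\<integral>x. f x \<partial>interval_measure (\<lambda>x. max (F x) \<alpha>)) -
     (\<integral>x. f x \<partial>interval_measure (\<lambda>x. min (F x) \<alpha>))"

text \<open>The inequality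
  d/dt |M - \<alpha>| + d/dx (sgn(M - \<alpha>) (A(M) - A(\<alpha>))) \<le> (\<Phi> * d/dx M) d/dx |M - \<alpha>|
  tested against nonnegative \<zeta>, with d/dx M = \<rho> t.\<close>

definition entropy_inequality ::
  "(real \<Rightarrow> real) \<Rightarrow> (real \<Rightarrow> real) \<Rightarrow> (real \<Rightarrow> real measure) \<Rightarrow> (real \<Rightarrow> real \<Rightarrow> real) \<Rightarrow> real \<Rightarrow> bool"
  where
  "entropy_inequality \<phi> A \<rho> M \<alpha> \<longleftrightarrow>
     (\<forall>\<zeta>. nonneg_test_function \<zeta> \<longrightarrow>
        0 \<le> (LBINT t:{0<..}. LBINT x.
                \<bar>M x t - \<alpha>\<bar> * partial_t \<zeta> (x, t) +
                sgn (M x t - \<alpha>) * (A (M x t) - A \<alpha>) * partial_x \<zeta> (x, t)) +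
            (LBINT t:{0<..}.
                integral_d_abs (\<lambda>x. M x t) \<alpha> (\<lambda>x. \<zeta> (x, t) * potential_conv \<phi> (\<rho> t) x)))"

definition entropy_solution ::
  "(real \<Rightarrow> real) \<Rightarrow> (real \<Rightarrow> real) \<Rightarrow> (real \<Rightarrow> real) \<Rightarrow>
   (real \<Rightarrow> real measure) \<Rightarrow> (real \<Rightarrow> real \<Rightarrow> real) \<Rightarrow> bool"
  where
  "entropy_solution \<phi> A M0 \<rho> M \<longleftrightarrow>
     (\<forall>t\<ge>0. real_distribution (\<rho> t) \<and> (\<forall>x. M x t = centered_cdf (\<rho> t) x)) \<and>
     (\<forall>T. \<exists>R. \<forall>t\<in>{0..T}. msupport (\<rho> t) \<subseteq> {-R..R}) \<and>
     (\<forall>t\<ge>0. integrable lborel (\<lambda>x. M x t - M0 x)) \<and>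
     (\<forall>s\<ge>0. ((\<lambda>t. LBINT x. \<bar>(M x t - M0 x) - (M x s - M0 x)\<bar>) \<longlongrightarrow> 0) (at s within {0..})) \<and>
     (\<forall>x. M x 0 = M0 x) \<and>
     (\<forall>\<alpha>\<in>{- 1/2..1/2}. entropy_inequality \<phi> A \<rho> M \<alpha>)"


section \<open>Regions determined by the flux\<close>

definition convex_envelope :: "(real \<Rightarrow> real) \<Rightarrow> real \<Rightarrow> real" where
  "convex_envelope A m =
     Sup {g m | g. convex_on {- 1/2..1/2} g \<and> (\<forall>y\<in>{- 1/2..1/2}. g y \<le> A y)}"

definition affine_function_on :: "real set \<Rightarrow> (real \<Rightarrow> real) \<Rightarrow> bool" where
  "affine_function_on S f \<longleftrightarrow> (\<exists>c d. \<forall>y\<in>S. f y = c * y + d)"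

definition Sigma_plus :: "(real \<Rightarrow> real) \<Rightarrow> real set" where
  "Sigma_plus A =
     {m \<in> {- 1/2<..1/2}. \<forall>m'. - 1/2 \<le> m' \<and> m' < m \<longrightarrow>
        \<not> affine_function_on {m'<..m} (convex_envelope A)}"

definition Sigma_minus :: "(real \<Rightarrow> real) \<Rightarrow> real set" where
  "Sigma_minus A = {m \<in> {- 1/2<..<1/2}. convex_envelope A m < A m}"

definition linear_region :: "(real \<Rightarrow> real) \<Rightarrow> real \<Rightarrow> real set" where
  "linear_region A m =
     (if m \<in> Sigma_plus A then {m}
      else (GREATEST I. \<exists>a b. - 1/2 \<le> a \<and> b \<le> 1/2 \<and> I = {a<..b} \<and> m \<in> I \<and>
                          affine_function_on I (convex_envelope A)))"


section \<open>Infinite-time clusters\<close>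

definition collapsing_interval :: "(real \<Rightarrow> real \<Rightarrow> real) \<Rightarrow> real \<Rightarrow> real set \<Rightarrow> bool" where
  "collapsing_interval X m I \<longleftrightarrow>
     (\<exists>a b. I = {a<..b} \<or> I = {a<..<b}) \<and> I \<subseteq> {- 1/2<..1/2} \<and> m \<in> I \<and>
     ((\<lambda>t. diameter ((\<lambda>s. X s t) ` I)) \<longlongrightarrow> 0) at_top"

definition infinite_time_cluster_at :: "(real \<Rightarrow> real \<Rightarrow> real) \<Rightarrow> real \<Rightarrow> real set \<Rightarrow> bool" where
  "infinite_time_cluster_at X m I \<longleftrightarrow>
     (\<exists>m1\<in>{- 1/2<..1/2}. m1 < m \<and> ((\<lambda>t. X m t - X m1 t) \<longlongrightarrow> 0) at_top) \<and>
     collapsing_interval X m I \<and> (\<forall>J. collapsing_interval X m J \<longrightarrow> J \<subseteq> I)"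


definition uniform_diameter_bound :: "(real \<Rightarrow> real measure) \<Rightarrow> real \<Rightarrow> bool" where
  "uniform_diameter_bound \<rho> D \<longleftrightarrow> 0 < D \<and> (\<forall>t\<ge>0. diameter (msupport (\<rho> t)) \<le> D)"

end

theory Submission
  imports Defs
begin

text \<open>
  Write \<open>X(m, t)\<close> for the quantile function of \<open>\<rho>(t)\<close> and \<open>\<psi>\<close> for the derivative of the flux \<open>A\<close>.
  In quantile variables the entropy inequality for the level \<open>\<alpha>\<close> says that for every
  nondecreasing \<open>G\<close> the integral of \<open>G(X)\<close> over the labels above \<open>\<alpha>\<close> grows at least at the rate given
  by the formal characteristics \<open>X' = \<psi> - (\<Phi> * \<rho>)(X)\<close>, and over the labels below \<open>\<alpha>\<close> at most at that
  rate. Choosing for \<open>G\<close> a function that vanishes behind a moving point turns this into barriers.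
  If a line of slope \<open>c\<close> touches \<open>A\<close> at \<open>b\<close> and lies below \<open>A\<close> on the left of \<open>b\<close>, then \<open>X(b, t)\<close> moves with velocity at
  most \<open>c - (\<Phi> * \<rho>)(X)\<close>; if it touches at \<open>a\<close> and lies below \<open>A\<close> on the right of \<open>a\<close>, then \<open>X(a+, t)\<close> moves with velocity at
  least \<open>c - (\<Phi> * \<rho>)(X)\<close>.

  With slopes bounded by the Lipschitz constant of \<open>A\<close>, and \<open>\<Phi>\<close> subadditive and unbounded, this bounds the
  diameter. On a maximal interval where the envelope is affine, \<open>c\<close> is the same at both ends, and
  monotonicity of \<open>\<Phi>\<close> gives the exponential decay. Beyond such an interval there are contact
  points with strictly larger (on the left: smaller) slope, found by minimizing \<open>A(x) - c'x\<close>; a gap that tended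
  to zero would then grow at a positive rate, so the cluster cannot be larger.
\<close>

section \<open>Smooth test functions\<close>

text \<open>Quantiles need not be continuous in time. Continuity of \<open>M\<close> in L1 only
  makes \<open>X b\<close> lower and \<open>Xu a\<close> upper semicontinuous, which is what upper
  bounds for \<open>X b t - Xu a t\<close> need in order to survive limits. This is why the right
  end of a label interval is followed by the left-continuous quantile and the left end by its right
  limit, and why every differential inequality appears as a bound on short forward increments with
  an arbitrary error.

  The density \<open>\<psi>\<close> is only bounded and measurable, so a line below \<open>A\<close>
  cannot be compared with it pointwise. The line acts through integrals of
  \<open>\<psi> m - c\<close> over label intervals, which are increments of \<open>A\<close> minus
  those of the line; a monotone weight is built from such intervals by its superlevel sets.

  Test functions have compact support, whereas the weight should be monotone. The weight is
  therefore a wide bump of which the quantiles only ever see the increasing half. The velocity is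
  frozen at the starting point of a barrier, and joint continuity of the convolution makes the error
  small for a short time.\<close>

primrec k_smooth :: "nat \<Rightarrow> (real \<Rightarrow> real) \<Rightarrow> bool" where
  "k_smooth 0 f \<longleftrightarrow> continuous_on UNIV f"
| "k_smooth (Suc k) f \<longleftrightarrow> (\<exists>f'. (\<forall>x. (f has_real_derivative f' x) (at x)) \<and> k_smooth k f')"

definition smooth :: "(real \<Rightarrow> real) \<Rightarrow> bool" where
  "smooth f \<longleftrightarrow> (\<forall>k. k_smooth k f)"

lemma k_smooth_SucD: "k_smooth (Suc k) f \<Longrightarrow> k_smooth k f"
proof (induction k arbitrary: f)
  case 0
  then show ?case
    by (auto simp: continuous_on_eq_continuous_at intro: DERIV_isCont)
next
  case (Suc k)
  then show ?case by (metis k_smooth.simps(2))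
qed

lemma k_smooth_add: "k_smooth k f \<Longrightarrow> k_smooth k g \<Longrightarrow> k_smooth k (\<lambda>x. f x + g x)"
proof (induction k arbitrary: f g)
  case 0
  then show ?case by (auto intro!: continuous_intros)
next
  case (Suc k)
  then obtain f' g' where "\<forall>x. (f has_real_derivative f' x) (at x)" "k_smooth k f'"
    "\<forall>x. (g has_real_derivative g' x) (at x)" "k_smooth k g'" by auto
  then show ?case using Suc.IH[of f' g']
    by (auto intro!: exI[of _ "\<lambda>x. f' x + g' x"] derivative_intros)
qed

lemma k_smooth_const: "k_smooth k (\<lambda>x. c)"
  by (induction k arbitrary: c) (auto intro!: exI[of _ "\<lambda>x. 0"])

lemma k_smooth_mult: "k_smooth k f \<Longrightarrow> k_smooth k g \<Longrightarrow> k_smooth k (\<lambda>x. f x * g x)"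
proof (induction k arbitrary: f g)
  case 0
  then show ?case by (auto intro!: continuous_intros)
next
  case (Suc k)
  then obtain f' g' where *: "\<forall>x. (f has_real_derivative f' x) (at x)" "k_smooth k f'"
    "\<forall>x. (g has_real_derivative g' x) (at x)" "k_smooth k g'" by auto
  moreover have "k_smooth k f" "k_smooth k g" using Suc.prems k_smooth_SucD by blast+
  ultimately have "k_smooth k (\<lambda>x. f' x * g x + g' x * f x)"
    by (intro k_smooth_add Suc.IH)
  then show ?case using * by (auto intro!: exI[of _ "\<lambda>x. f' x * g x + g' x * f x"] DERIV_mult)
qed

lemma k_smooth_affine: "k_smooth k f \<Longrightarrow> k_smooth k (\<lambda>x. f (a * x + b))"
proof (induction k arbitrary: f)
  case 0
  then show ?case by (auto intro!: continuous_intros continuous_on_compose2[of UNIV f])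
next
  case (Suc k)
  then obtain f' where f': "\<forall>x. (f has_real_derivative f' x) (at x)" "k_smooth k f'" by auto
  have "k_smooth k (\<lambda>x. f' (a * x + b) * a)"
    using k_smooth_mult[OF Suc.IH[OF f'(2)] k_smooth_const] .
  moreover have "((\<lambda>x. f (a * x + b)) has_real_derivative f' (a * x + b) * a) (at x)" for x
    by (rule DERIV_chain2[where g="\<lambda>x. a * x + b"]) (use f' in \<open>auto intro!: derivative_eq_intros\<close>)
  ultimately show ?case unfolding k_smooth.simps by (intro exI conjI allI)
qed

lemma smooth_mult: "smooth f \<Longrightarrow> smooth g \<Longrightarrow> smooth (\<lambda>x. f x * g x)"
  by (simp add: smooth_def k_smooth_mult)

lemma smooth_affine: "smooth f \<Longrightarrow> smooth (\<lambda>x. f (a * x + b))"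
  by (simp add: smooth_def k_smooth_affine)

lemma smooth_diff: "smooth f \<Longrightarrow> smooth g \<Longrightarrow> smooth (\<lambda>x. f x - g x)"
  using k_smooth_add[of _ f "\<lambda>x. (-1) * g x"] k_smooth_mult[OF k_smooth_const, of _ g "-1"]
  by (simp add: smooth_def)

lemma smooth_derivative:
  assumes "smooth f" "\<And>x. (f has_real_derivative f' x) (at x)"
  shows "smooth f'"
  unfolding smooth_def
proof
  fix k
  have "k_smooth (Suc k) f" using assms(1) by (simp only: smooth_def)
  then obtain g where "\<forall>x. (f has_real_derivative g x) (at x)" "k_smooth k g" by auto
  moreover from this have "g = f'" using assms(2) DERIV_unique by (intro ext) blast
  ultimately show "k_smooth k f'" by simp
qed

lemma smooth_antiderivative:
  assumes "smooth f'" "\<And>x. (f has_real_derivative f' x) (at x)"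
  shows "smooth f"
  unfolding smooth_def
proof
  fix k
  have "k_smooth (Suc k) f" using assms by (auto simp: smooth_def)
  then show "k_smooth k f" by (rule k_smooth_SucD)
qed

lemma smooth_has_derivative:
  assumes "smooth f"
  obtains f' where "\<And>x. (f has_real_derivative f' x) (at x)" "smooth f'"
proof -
  have "k_smooth 1 f" using assms smooth_def by blast
  then obtain g where g: "\<And>x. (f has_real_derivative g x) (at x)" by auto
  with smooth_derivative[OF assms] that show thesis by blast
qed

lemma smooth_continuous: "smooth f \<Longrightarrow> continuous_on S f"
  using continuous_on_subset unfolding smooth_def by (metis k_smooth.simps(1) subset_UNIV)

section \<open>Flat functions and compactly supported bumps\<close>

definition flat_exp :: "nat \<Rightarrow> real \<Rightarrow> real" where
  "flat_exp n x = (if x > 0 then (1 / x) ^ n * exp (- (1 / x)) else 0)"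

lemma flat_exp_tendsto_0: "(flat_exp n \<longlongrightarrow> 0) (at 0)"
proof -
  have "((\<lambda>y::real. y ^ n / exp y) \<longlongrightarrow> 0) at_top" by (rule tendsto_power_div_exp_0)
  then have "((\<lambda>x::real. inverse x ^ n / exp (inverse x)) \<longlongrightarrow> 0) (at_right 0)"
    by (rule filterlim_compose) (rule filterlim_inverse_at_top_right)
  then have "(flat_exp n \<longlongrightarrow> 0) (at_right 0)"
    by (rule Lim_transform_eventually)
      (auto simp: flat_exp_def eventually_at_right_field exp_minus divide_simps intro!: exI[of _ 1])
  moreover have "(flat_exp n \<longlongrightarrow> 0) (at_left 0)"
    by (rule Lim_transform_eventually[of "\<lambda>_. 0"])
      (auto simp: flat_exp_def eventually_at_left_field intro!: exI[of _ "-1"])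
  ultimately show ?thesis using filterlim_split_at by blast
qed

text \<open>Differentiation stays inside the span of this family, so smoothness of exp (-1/x),
  extended by zero, follows by an induction over the order that treats all \<open>n\<close> at
  once.\<close>

lemma flat_exp_derivative:
  "(flat_exp n has_real_derivative (flat_exp (n + 2) x - real n * flat_exp (n + 1) x)) (at x)"
proof -
  consider "x > 0" | "x = 0" | "x < 0" by linarith
  then show ?thesis
  proof cases
    case 1
    have inv: "((\<lambda>x. 1 / x) has_real_derivative (- ((1 / x) ^ 2))) (at x)"
      using 1 by (auto intro!: derivative_eq_intros simp: power2_eq_square divide_simps)
    have pow: "real n * (1 / x) ^ (n - 1) * (- ((1 / x) ^ 2)) = - real n * (1 / x) ^ (n + 1)"
      by (cases n) (simp_all add: power2_eq_square divide_simps algebra_simps)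
    have "((\<lambda>x. (1 / x) ^ n * exp (- (1 / x))) has_real_derivative
        (real n * (1 / x) ^ (n - 1) * (- ((1 / x) ^ 2))) * exp (- (1 / x)) +
        exp (- (1 / x)) * (- (- ((1 / x) ^ 2))) * (1 / x) ^ n) (at x)"
    proof (rule DERIV_mult)
      show "((\<lambda>x. (1 / x) ^ n) has_real_derivative (real n * (1 / x) ^ (n - 1) * (- ((1 / x) ^ 2)))) (at x)"
        using DERIV_power[OF inv, of n] by (simp add: mult_ac)
      show "((\<lambda>x. exp (- (1 / x))) has_real_derivative (exp (- (1 / x)) * (- (- ((1 / x) ^ 2))))) (at x)"
        by (intro DERIV_fun_exp DERIV_minus inv)
    qed
    then have "((\<lambda>x. (1 / x) ^ n * exp (- (1 / x))) has_real_derivative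
        (flat_exp (n + 2) x - real n * flat_exp (n + 1) x)) (at x)"
      unfolding pow using 1 by (simp add: flat_exp_def power_add power2_eq_square algebra_simps)
    then show ?thesis
    proof (rule DERIV_cong_ev[OF refl _ refl, THEN iffD1, rotated])
      show "eventually (\<lambda>y. (1 / y) ^ n * exp (- (1 / y)) = flat_exp n y) (nhds x)"
      using eventually_nhds_in_open[of "{0<..}" x] 1 by (auto elim!: eventually_mono simp: flat_exp_def)
    qed
  next
    case 2
    \<comment> \<open>Dividing by \<open>h\<close> raises the power of 1/h by one, so the difference
      quotient at 0 is itself a member of the family.\<close>
    have "(\<lambda>h. (flat_exp n (0 + h) - flat_exp n 0) / h) = flat_exp (n + 1)"
      by (auto simp: flat_exp_def fun_eq_iff)
    then have "(flat_exp n has_real_derivative 0) (at 0)"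
      unfolding DERIV_def using flat_exp_tendsto_0[of "n + 1"] by simp
    then show ?thesis using 2 by (simp add: flat_exp_def)
  next
    case 3
    have "((\<lambda>x. 0) has_real_derivative (flat_exp (n + 2) x - real n * flat_exp (n + 1) x)) (at x)"
      using 3 by (simp add: flat_exp_def)
    then show ?thesis
    proof (rule DERIV_cong_ev[OF refl _ refl, THEN iffD1, rotated])
      show "eventually (\<lambda>y. 0 = flat_exp n y) (nhds x)"
      using eventually_nhds_in_open[of "{..<0}" x] 3 by (auto elim!: eventually_mono simp: flat_exp_def)
    qed
  qed
qed

lemma smooth_flat_exp: "smooth (flat_exp n)"
  unfolding smooth_def
proof
  fix k show "k_smooth k (flat_exp n)"
  proof (induction k arbitrary: n)
    case 0
    have "isCont (flat_exp n) x" for x using flat_exp_derivative by (rule DERIV_isCont)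
    then show ?case by (simp add: continuous_on_eq_continuous_at)
  next
    case (Suc k)
    have "k_smooth k (\<lambda>x. flat_exp (n + 2) x + (- real n) * flat_exp (n + 1) x)"
      by (intro k_smooth_add k_smooth_mult k_smooth_const Suc)
    moreover have "(flat_exp n has_real_derivative
        (flat_exp (n + 2) x + (- real n) * flat_exp (n + 1) x)) (at x)" for x
      using flat_exp_derivative[of n x] by simp
    ultimately show ?case unfolding k_smooth.simps by (intro exI conjI allI)
  qed
qed

text \<open>Supported in [0, 2S] and symmetric about \<open>S\<close>. A weight that increases from
  zero cannot have compact support; this one increases up to \<open>S\<close>, and the barrier
  argument chooses \<open>S\<close> so large that all its arguments stay below it.\<close>

definition bump :: "real \<Rightarrow> real \<Rightarrow> real" where
  "bump S z = flat_exp 0 z * flat_exp 0 (2 * S - z)"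

lemma smooth_bump: "smooth (bump S)"
proof -
  have "smooth (\<lambda>z. flat_exp 0 ((-1) * z + 2 * S))" by (intro smooth_affine smooth_flat_exp)
  then show ?thesis unfolding bump_def[abs_def]
    by (intro smooth_mult smooth_flat_exp) (simp add: algebra_simps)
qed

lemma bump_nonneg: "0 \<le> bump S z"
  by (simp add: bump_def flat_exp_def)

lemma bump_eq_0: "z \<le> 0 \<or> 2 * S \<le> z \<Longrightarrow> bump S z = 0"
  by (auto simp: bump_def flat_exp_def)

lemma bump_pos: "0 < z \<Longrightarrow> z < 2 * S \<Longrightarrow> 0 < bump S z"
  by (simp add: bump_def flat_exp_def)

lemma bump_mono:
  assumes "y \<le> z" "z \<le> S" shows "bump S y \<le> bump S z"
proof (cases "0 < y")
  case True
  \<comment> \<open>This compares the exponents -1/z - 1/(2S - z). Both differences have numerator z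
    - y up to sign, so it remains to compare y z with (2S - z)(2S - y), which exceeds it by 2S(2S -
    y - z).\<close>
  have "1 / z - 1 / y \<le> 1 / (2 * S - y) - 1 / (2 * S - z)"
  proof -
    have "y * z \<le> (2 * S - z) * (2 * S - y)" 
    proof -
      have "y * z \<le> (2 * S - z) * z" using assms True by (intro mult_right_mono) auto
      also have "\<dots> \<le> (2 * S - z) * (2 * S - y)" using assms True by (intro mult_left_mono) auto
      finally show ?thesis .
    qed
    then have "(z - y) / ((2 * S - z) * (2 * S - y)) \<le> (z - y) / (y * z)"
      using assms True by (intro divide_left_mono) (auto intro!: mult_pos_pos)
    moreover have "1 / y - 1 / z = (z - y) / (y * z)"
      using assms True by (simp add: field_simps)
    moreover have "1 / (2 * S - z) - 1 / (2 * S - y) = (z - y) / ((2 * S - z) * (2 * S - y))"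
      using assms True by (simp add: field_simps)
    ultimately show ?thesis by linarith
  qed
  then show ?thesis using assms True
    by (simp add: bump_def flat_exp_def flip: exp_add)
next
  case False
  then show ?thesis by (simp add: bump_eq_0 bump_nonneg)
qed

section \<open>Smoothness of functions of position and time\<close>

lemma C_k_SucD: "C_k (Suc k) f \<Longrightarrow> C_k k f"
proof (induction k arbitrary: f)
  case 0
  then show ?case
    by (auto simp: continuous_on_eq_continuous_at intro: differentiable_imp_continuous_within)
next
  case (Suc k)
  then show ?case by (metis C_k.simps(2))
qed

lemma partial_add:
  assumes "f differentiable (at p)" "g differentiable (at p)"
  shows "partial_x (\<lambda>p. f p + g p) p = partial_x f p + partial_x g p"
    and "partial_t (\<lambda>p. f p + g p) p = partial_t f p + partial_t g p"
  using frechet_derivative_at[OF has_derivative_add[OF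
      assms[unfolded frechet_derivative_works]]]
  by (auto simp: partial_x_def partial_t_def fun_eq_iff dest: sym)

lemma C_k_add: "C_k k f \<Longrightarrow> C_k k g \<Longrightarrow> C_k k (\<lambda>p. f p + g p)"
proof (induction k arbitrary: f g)
  case 0
  then show ?case by (auto intro!: continuous_intros)
next
  case (Suc k)
  then have "partial_x (\<lambda>p. f p + g p) = (\<lambda>p. partial_x f p + partial_x g p)"
    "partial_t (\<lambda>p. f p + g p) = (\<lambda>p. partial_t f p + partial_t g p)"
    by (auto simp: fun_eq_iff partial_add)
  with Suc show ?case by (auto intro!: differentiable_add)
qed

lemma partial_mult:
  assumes "f differentiable (at p)" "g differentiable (at p)"
  shows "partial_x (\<lambda>p. f p * g p) p = f p * partial_x g p + partial_x f p * g p"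
    and "partial_t (\<lambda>p. f p * g p) p = f p * partial_t g p + partial_t f p * g p"
  using frechet_derivative_at[OF has_derivative_mult[OF
      assms[unfolded frechet_derivative_works]]]
  by (auto simp: partial_x_def partial_t_def fun_eq_iff dest: sym)

lemma C_k_mult: "C_k k f \<Longrightarrow> C_k k g \<Longrightarrow> C_k k (\<lambda>p. f p * g p)"
proof (induction k arbitrary: f g)
  case 0
  then show ?case by (auto intro!: continuous_intros)
next
  case (Suc k)
  then have "partial_x (\<lambda>p. f p * g p) = (\<lambda>p. f p * partial_x g p + partial_x f p * g p)"
    "partial_t (\<lambda>p. f p * g p) = (\<lambda>p. f p * partial_t g p + partial_t f p * g p)"
    by (auto simp: fun_eq_iff partial_mult)
  moreover have "C_k k f" "C_k k g" using Suc.prems C_k_SucD by blast+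
  ultimately show ?case using Suc by (auto intro!: differentiable_mult C_k_add)
qed

lemma has_derivative_ridge:
  assumes "\<And>x. (f has_real_derivative f' x) (at x)"
  shows "((\<lambda>p::real \<times> real. f (a * fst p + b * snd p + c)) has_derivative
    (\<lambda>h. f' (a * fst p + b * snd p + c) * (a * fst h + b * snd h))) (at p)"
proof -
  have "((\<lambda>p::real \<times> real. a * fst p + b * snd p + c) has_derivative (\<lambda>h. a * fst h + b * snd h)) (at p)"
    by (auto intro!: derivative_eq_intros)
  from has_derivative_compose[OF this assms[of "a * fst p + b * snd p + c", unfolded has_field_derivative_def]]
  show ?thesis by simp
qed

lemma partial_ridge:
  assumes "\<And>x. (f has_real_derivative f' x) (at x)"
  shows "partial_x (\<lambda>p. f (a * fst p + b * snd p + c)) = (\<lambda>p. f' (a * fst p + b * snd p + c) * a)"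
    and "partial_t (\<lambda>p. f (a * fst p + b * snd p + c)) = (\<lambda>p. f' (a * fst p + b * snd p + c) * b)"
  using frechet_derivative_at[OF has_derivative_ridge[of f f', OF assms], symmetric]
  by (auto simp: partial_x_def partial_t_def fun_eq_iff)

lemma C_k_const: "C_k k (\<lambda>p. c)"
proof (induction k arbitrary: c)
  case (Suc k)
  have "partial_x (\<lambda>p. c) = (\<lambda>p. 0)" "partial_t (\<lambda>p. c) = (\<lambda>p. 0)"
    by (auto simp: partial_x_def partial_t_def)
  with Suc show ?case by simp
qed simp

text \<open>A test function is a product of two such ridge functions, one of time alone and one of x
  - v t - w, so its joint smoothness follows from this and \<open>C_k_mult\<close>.\<close>

lemma C_k_ridge:
  "k_smooth k f \<Longrightarrow> C_k k (\<lambda>p. f (a * fst p + b * snd p + c))"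
proof (induction k arbitrary: f)
  case 0
  then show ?case by (auto intro!: continuous_intros continuous_on_compose2[of UNIV f])
next
  case (Suc k)
  then obtain f' where f': "\<And>x. (f has_real_derivative f' x) (at x)" "k_smooth k f'" by auto
  have "C_k k (\<lambda>p. f' (a * fst p + b * snd p + c) * d)" for d
    by (intro C_k_mult Suc.IH f' C_k_const)
  moreover have "(\<lambda>p. f (a * fst p + b * snd p + c)) differentiable at p" for p
    using has_derivative_ridge[of f f', OF f'(1)] unfolding differentiable_def by blast
  ultimately show ?case by (simp add: partial_ridge[OF f'(1)])
qed

text \<open>Test functions transported with constant speed \<open>v\<close>, so that barriers may move.\<close>

lemma test_function_product:
  fixes v w :: real
  assumes \<eta>: "smooth \<eta>" "\<And>t. 0 \<le> \<eta> t" "\<And>t. \<eta> t \<noteq> 0 \<Longrightarrow> t \<in> {t0..t1}" "0 < t0"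
    and \<theta>: "smooth \<theta>" "\<And>z. 0 \<le> \<theta> z" "\<And>z. \<theta> z \<noteq> 0 \<Longrightarrow> \<bar>z\<bar> \<le> S"
    and "\<And>x. (\<eta> has_real_derivative \<eta>' x) (at x)" "\<And>x. (\<theta> has_real_derivative \<theta>' x) (at x)"
  defines "\<zeta> \<equiv> (\<lambda>p. \<eta> (snd p) * \<theta> (fst p - v * snd p - w))"
  shows "nonneg_test_function \<zeta>"
    and "partial_x \<zeta> (x, t) = \<eta> t * \<theta>' (x - v * t - w)"
    and "partial_t \<zeta> (x, t) = \<eta>' t * \<theta> (x - v * t - w) - v * \<eta> t * \<theta>' (x - v * t - w)"
proof -
  define f where "f = (\<lambda>p::real\<times>real. \<eta> (0 * fst p + 1 * snd p + 0))"
  define g where "g = (\<lambda>p::real\<times>real. \<theta> (1 * fst p + (-v) * snd p + (-w)))"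
  have \<zeta>: "\<zeta> = (\<lambda>p. f p * g p)" by (simp add: \<zeta>_def f_def g_def)
  have C: "C_k k f" "C_k k g" for k
    unfolding f_def g_def by (intro C_k_ridge \<eta>[unfolded smooth_def, rule_format] \<theta>[unfolded smooth_def, rule_format])+
  have d: "f differentiable (at p)" "g differentiable (at p)" for p
    using C[of "Suc 0"] unfolding C_k.simps by blast+
  show "partial_x \<zeta> (x, t) = \<eta> t * \<theta>' (x - v * t - w)"
    unfolding \<zeta> partial_mult[OF d]
    unfolding f_def g_def partial_ridge[of \<eta> \<eta>', OF assms(8)] partial_ridge[of \<theta> \<theta>', OF assms(9)]
    by (simp add: algebra_simps)
  show "partial_t \<zeta> (x, t) = \<eta>' t * \<theta> (x - v * t - w) - v * \<eta> t * \<theta>' (x - v * t - w)"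
    unfolding \<zeta> partial_mult[OF d]
    unfolding f_def g_def partial_ridge[of \<eta> \<eta>', OF assms(8)] partial_ridge[of \<theta> \<theta>', OF assms(9)]
    by (simp add: algebra_simps)
  define R where "R = S + \<bar>v\<bar> * (\<bar>t0\<bar> + \<bar>t1\<bar>) + \<bar>w\<bar>"
  have sub: "{p. \<zeta> p \<noteq> 0} \<subseteq> {-R..R} \<times> {t0..t1}"
  proof (safe)
    fix x t assume "\<zeta> (x, t) \<noteq> 0"
    then have t: "t \<in> {t0..t1}" and x: "\<bar>x - v * t - w\<bar> \<le> S" using \<eta>(3) \<theta>(3) by (auto simp: \<zeta>_def)
    show "t \<in> {t0..t1}" by fact
    have "\<bar>v * t\<bar> \<le> \<bar>v\<bar> * (\<bar>t0\<bar> + \<bar>t1\<bar>)" using t by (auto simp: abs_mult intro!: mult_left_mono)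
    then show "x \<in> {-R..R}" using x by (auto simp: R_def)
  qed
  have cl: "closure {p. \<zeta> p \<noteq> 0} \<subseteq> {-R..R} \<times> {t0..t1}"
    by (intro closure_minimal sub closed_Times) auto
  show "nonneg_test_function \<zeta>"
    unfolding nonneg_test_function_def
  proof (intro conjI allI)
    show "0 \<le> \<zeta> p" for p using \<eta>(2) \<theta>(2) by (simp add: \<zeta>_def)
    show "C_k k \<zeta>" for k unfolding \<zeta> by (intro C_k_mult C)
    have "compact ({-R..R} \<times> {t0..t1})" by (intro compact_Times) auto
    with cl show "compact (closure {p. \<zeta> p \<noteq> 0})"
      by (metis compact_closure bounded_subset compact_imp_bounded closure_subset bounded_closure)
    show "closure {p. \<zeta> p \<noteq> 0} \<subseteq> UNIV \<times> {0<..}" using cl \<open>0 < t0\<close> by force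
  qed
qed

lemma continuous_antiderivative:
  fixes f :: "real \<Rightarrow> real"
  assumes "continuous_on UNIV f"
  obtains F where "\<And>x. (F has_real_derivative f x) (at x)"
proof -
  have "isCont f x" for x using assms by (simp add: continuous_on_eq_continuous_at)
  then have "\<exists>F. \<forall>x::real. -\<infinity> < ereal x \<longrightarrow> ereal x < \<infinity> \<longrightarrow> (F has_vector_derivative f x) (at x)"
    by (intro einterval_antiderivative) auto
  with that show thesis by (auto simp: has_real_derivative_iff_has_vector_derivative)
qed

text \<open>A smooth substitute for the indicator function of \<open>[t0, t1]\<close>.\<close>

lemma time_cutoff:
  assumes "0 < \<epsilon>" "t0 + 2 * \<epsilon> \<le> t1"
  obtains \<eta> where "smooth \<eta>" "\<And>t. 0 \<le> \<eta> t" "\<And>t. \<eta> t \<noteq> 0 \<Longrightarrow> t \<in> {t0<..<t1}"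
    "\<And>t. (\<eta> has_real_derivative bump \<epsilon> (t - t0) - bump \<epsilon> (t - (t1 - 2 * \<epsilon>))) (at t)"
proof -
  obtain \<Xi> where \<Xi>: "\<And>x. (\<Xi> has_real_derivative bump \<epsilon> x) (at x)"
    using continuous_antiderivative[OF smooth_continuous[OF smooth_bump]] by blast
  have mono: "\<Xi> x \<le> \<Xi> y" if "x \<le> y" for x y
    using that by (rule DERIV_nonneg_imp_nondecreasing) (use \<Xi> bump_nonneg in blast)
  have cont: "continuous_on S \<Xi>" for S
    using \<Xi> by (intro continuous_at_imp_continuous_on ballI DERIV_isCont)
  have flat: "(\<Xi> has_real_derivative 0) (at x)" if "x \<le> 0 \<or> 2 * \<epsilon> \<le> x" for x
    using \<Xi>[of x] bump_eq_0[OF that] by simp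
  have le0: "\<Xi> x = \<Xi> 0" if "x \<le> 0" for x
  proof (cases "x < 0")
    case True
    show ?thesis by (rule DERIV_isconst_end[OF True cont, symmetric]) (auto intro: flat)
  qed (use that in auto)
  have ge1: "\<Xi> x = \<Xi> (2 * \<epsilon>)" if "2 * \<epsilon> \<le> x" for x
  proof (cases "2 * \<epsilon> < x")
    case True
    show ?thesis by (rule DERIV_isconst_end[OF True cont]) (auto intro: flat)
  qed (use that in auto)
  have s: "smooth \<Xi>" using smooth_antiderivative[OF smooth_bump \<Xi>] .
  \<comment> \<open>\<open>\<Xi>\<close> climbs over [0, 2 \<epsilon>] and is constant elsewhere, so
    the difference of its two shifts rises from \<open>t0\<close> on, stays level and is back at
    zero at \<open>t1\<close>.\<close>
  define \<eta> where "\<eta> = (\<lambda>t. \<Xi> (t - t0) - \<Xi> (t - (t1 - 2 * \<epsilon>)))"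
  show thesis
  proof
    show "smooth \<eta>" unfolding \<eta>_def
      using smooth_affine[OF s, of 1 "-t0"] smooth_affine[OF s, of 1 "-(t1 - 2 * \<epsilon>)"]
      by (intro smooth_diff) (simp_all add: algebra_simps)
    show "0 \<le> \<eta> t" for t unfolding \<eta>_def using mono[of "t - (t1 - 2 * \<epsilon>)" "t - t0"] assms by simp
    show "t \<in> {t0<..<t1}" if "\<eta> t \<noteq> 0" for t
    proof (rule ccontr)
      assume "t \<notin> {t0<..<t1}"
      then consider "t \<le> t0" | "t1 \<le> t" by force
      then have "\<eta> t = 0"
      proof cases
        case 1
        then show ?thesis unfolding \<eta>_def using le0[of "t - t0"] le0[of "t - (t1 - 2 * \<epsilon>)"] assms by simp
      next
        case 2
        then show ?thesis unfolding \<eta>_def using ge1[of "t - t0"] ge1[of "t - (t1 - 2 * \<epsilon>)"] assms by simp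
      qed
      with that show False by simp
    qed
    show "(\<eta> has_real_derivative bump \<epsilon> (t - t0) - bump \<epsilon> (t - (t1 - 2 * \<epsilon>))) (at t)" for t
    proof -
      have "((\<lambda>t. \<Xi> (t - a)) has_real_derivative bump \<epsilon> (t - a)) (at t)" for a
        using DERIV_chain2[OF \<Xi> DERIV_diff[OF DERIV_ident DERIV_const], of a t] by simp
      then show ?thesis unfolding \<eta>_def by (intro DERIV_diff)
    qed
  qed
qed

section \<open>Quantile functions\<close>

text \<open>The interval of mass labels has length one, so the quantile function is a random
  variable on a probability space. The end -1/2 is left out because there the infimum in
  \<open>gen_inverse\<close> is taken over the whole line.\<close>

definition labels :: "real measure" where
  "labels = restrict_space lborel {- 1/2<..1/2}"

lemma space_labels [simp]: "space labels = {- 1/2<..1/2}"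
  by (simp add: labels_def space_restrict_space)

lemma measurable_labelsI: "f \<in> measurable borel N \<Longrightarrow> f \<in> measurable labels N"
  unfolding labels_def by (rule measurable_restrict_space1) (simp cong: measurable_cong_sets)

interpretation labels: prob_space labels
  by (auto simp: labels_def emeasure_restrict_space space_restrict_space intro!: prob_spaceI)

lemma integral_labels: "integral\<^sup>L labels f = (LBINT m:{- 1/2<..1/2}. f m)"
  for f :: "real \<Rightarrow> real"
  unfolding labels_def set_lebesgue_integral_def by (subst integral_restrict_space) auto

lemma emeasure_labels: "S \<subseteq> {- 1/2<..1/2} \<Longrightarrow> emeasure labels S = emeasure lborel S"
  by (simp add: labels_def emeasure_restrict_space)

lemma AE_labels_iff: "(AE m in labels. P m) \<longleftrightarrow> (AE m in lborel. m \<in> {- 1/2<..1/2} \<longrightarrow> P m)"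
  unfolding labels_def by (rule AE_restrict_space_iff) simp

lemma (in prob_space) integrable_bounded:
  fixes f :: "'a \<Rightarrow> real"
  assumes "f \<in> borel_measurable M" "\<And>x. x \<in> space M \<Longrightarrow> \<bar>f x\<bar> \<le> B"
  shows "integrable M f"
proof (rule integrable_const_bound[where B=B])
  show "AE x in M. norm (f x) \<le> B" by (rule AE_I2) (simp add: assms(2))
qed (rule assms(1))

lemma (in prob_space) integral_abs_bound:
  fixes f :: "'a \<Rightarrow> real"
  assumes "f \<in> borel_measurable M" "\<And>x. x \<in> space M \<Longrightarrow> \<bar>f x\<bar> \<le> B"
  shows "\<bar>integral\<^sup>L M f\<bar> \<le> B"
proof -
  have "integrable M f" using assms by (rule integrable_bounded)
  then have "\<bar>integral\<^sup>L M f\<bar> \<le> (\<integral>x. \<bar>f x\<bar> \<partial>M)"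
    using integral_norm_bound[of M f] by simp
  also have "\<dots> \<le> B"
    using assms(2) \<open>integrable M f\<close> by (intro integral_le_const integrable_abs AE_I2)
  finally show ?thesis .
qed

abbreviation quantile :: "real measure \<Rightarrow> real \<Rightarrow> real" where
  "quantile \<mu> \<equiv> gen_inverse (centered_cdf \<mu>)"

text \<open>The right limit of the quantile function at \<open>a\<close>.\<close>

definition upper_quantile :: "real measure \<Rightarrow> real \<Rightarrow> real" where
  "upper_quantile \<mu> a = Inf {x. a < centered_cdf \<mu> x}"

text \<open>The complement of the support is a union of open null balls, and by the Lindelof
  property countably many of them suffice.\<close>

lemma (in real_distribution) AE_in_msupport: "AE x in M. x \<in> msupport M"
proof -
  define F where "F = {ball x e | x e. 0 < e \<and> emeasure M (ball x e) = 0}"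
  obtain F' where F': "F' \<subseteq> F" "countable F'" "\<Union>F' = \<Union>F"
    by (rule Lindelof[of F]) (auto simp: F_def)
  have "AE x in M. x \<notin> B" if "B \<in> F'" for B
  proof (rule AE_not_in)
    show "B \<in> null_sets M" using that F' by (auto simp: F_def null_sets_def)
  qed
  then have "AE x in M. \<forall>B\<in>F'. x \<notin> B" using F'(2) by (simp add: AE_ball_countable)
  then show ?thesis
  proof eventually_elim
    case (elim x)
    then have "x \<notin> \<Union>F" using F'(3) by auto
    show ?case unfolding msupport_def
    proof (safe)
      fix e :: real assume "0 < e" "emeasure M (ball x e) = 0"
      then have "ball x e \<in> F" "x \<in> ball x e" by (auto simp: F_def)
      with \<open>x \<notin> \<Union>F\<close> show False by blast
    qed
  qed
qed

text \<open>The bound \<open>R\<close> makes the sets behind the quantiles nonempty and bounded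
  below, so that the infima are genuine, and it makes continuous functions of the quantiles
  bounded.\<close>

locale bounded_distribution = real_distribution \<mu> for \<mu> +
  fixes R :: real
  assumes msupport_sub: "msupport \<mu> \<subseteq> {-R..R}"
begin

lemma AE_bounded: "AE x in \<mu>. x \<in> {-R..R}"
  using AE_in_msupport by eventually_elim (use msupport_sub in auto)

lemma ccdf_mono: "x \<le> y \<Longrightarrow> centered_cdf \<mu> x \<le> centered_cdf \<mu> y"
  by (simp add: centered_cdf_def cdf_nondecreasing)

lemma ccdf_bounds: "- 1/2 \<le> centered_cdf \<mu> x" "centered_cdf \<mu> x \<le> 1/2"
  by (simp_all add: centered_cdf_def cdf_nonneg cdf_bounded_prob)

lemma ccdf_left: "x < - R \<Longrightarrow> centered_cdf \<mu> x = - 1/2"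
proof -
  assume "x < - R"
  then have "measure \<mu> {..x} = measure \<mu> {}"
    using AE_bounded by (intro finite_measure_eq_AE) auto
  then show ?thesis by (simp add: centered_cdf_def cdf_def)
qed

lemma ccdf_right: "R \<le> x \<Longrightarrow> centered_cdf \<mu> x = 1/2"
proof -
  assume "R \<le> x"
  then have "measure \<mu> {..x} = 1"
    using AE_bounded by (subst prob_eq_1) auto
  then show ?thesis by (simp add: centered_cdf_def cdf_def)
qed

lemma measurable_ccdf [measurable]: "centered_cdf \<mu> \<in> borel_measurable borel"
  by (rule borel_measurable_mono) (auto simp: mono_def intro: ccdf_mono)

lemma ccdf_right_cont: "continuous (at_right x) (centered_cdf \<mu>)"
  unfolding centered_cdf_def[abs_def] by (intro continuous_intros cdf_is_right_cont)

text \<open>The Galois connection between quantile and distribution function. Its nontrivial half is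
  that the infimum is attained, which is right continuity.\<close>

lemma quantile_le_iff:
  assumes "m \<in> {- 1/2<..1/2}"
  shows "quantile \<mu> m \<le> x \<longleftrightarrow> m \<le> centered_cdf \<mu> x"
proof -
  define S where "S = {x. m \<le> centered_cdf \<mu> x}"
  have "R \<in> S" using assms ccdf_right[of R] by (auto simp: S_def)
  have "bdd_below S"
  proof (rule bdd_belowI)
    show "- R \<le> y" if "y \<in> S" for y
      using that ccdf_left[of y] assms by (force simp: S_def)
  qed
  have q: "quantile \<mu> m = Inf S" by (simp add: gen_inverse_def S_def)
  have *: "m \<le> centered_cdf \<mu> y" if "Inf S < y" for y
  proof -
    have "S \<noteq> {}" using \<open>R \<in> S\<close> by blast
    from cInf_lessD[OF this that] obtain z where "z \<in> S" "z < y" by (elim bexE)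
    then show ?thesis using ccdf_mono[of z y] by (simp add: S_def)
  qed
  have "m \<le> centered_cdf \<mu> (Inf S)"
  proof (rule tendsto_lowerbound)
    show "(centered_cdf \<mu> \<longlongrightarrow> centered_cdf \<mu> (Inf S)) (at_right (Inf S))"
      using ccdf_right_cont by (simp add: continuous_within)
    show "\<forall>\<^sub>F y in at_right (Inf S). m \<le> centered_cdf \<mu> y"
      using * by (auto simp: eventually_at_right_field intro: exI[of _ "Inf S + 1"])
  qed simp
  then show ?thesis
    using cInf_lower[OF _ \<open>bdd_below S\<close>, of x] ccdf_mono[of "Inf S" x] by (auto simp: q S_def)
qed

lemma less_quantile_iff:
  "m \<in> {- 1/2<..1/2} \<Longrightarrow> x < quantile \<mu> m \<longleftrightarrow> centered_cdf \<mu> x < m"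
  using quantile_le_iff[of m x] by linarith

lemma quantile_bounds:
  assumes "m \<in> {- 1/2<..1/2}"
  shows "- R \<le> quantile \<mu> m" "quantile \<mu> m \<le> R"
proof -
  show "quantile \<mu> m \<le> R" using quantile_le_iff[OF assms, of R] ccdf_right[of R] assms by simp
  show "- R \<le> quantile \<mu> m"
  proof (rule ccontr)
    assume "\<not> ?thesis"
    then obtain y where "quantile \<mu> m < y" "y < - R" using dense by (metis not_le)
    then show False using quantile_le_iff[OF assms, of y] ccdf_left[of y] assms by simp
  qed
qed

lemma quantile_mono:
  "m \<in> {- 1/2<..1/2} \<Longrightarrow> m' \<in> {- 1/2<..1/2} \<Longrightarrow> m \<le> m' \<Longrightarrow> quantile \<mu> m \<le> quantile \<mu> m'"
  using quantile_le_iff[of m "quantile \<mu> m'"] quantile_le_iff[of m' "quantile \<mu> m'"] by auto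

text \<open>The infimum over a strict superlevel set need not be attained. Instead of an equivalence
  as in \<open>quantile_le_iff\<close> there are two implications, this one and
  \<open>upper_quantile_le\<close>, which differ in strictness.\<close>

lemma upper_quantile_less:
  assumes "a \<in> {- 1/2..<1/2}" "upper_quantile \<mu> a < x" shows "a < centered_cdf \<mu> x"
proof -
  have "a < centered_cdf \<mu> R" using assms ccdf_right[of R] by simp
  then have "{x. a < centered_cdf \<mu> x} \<noteq> {}" by blast
  from cInf_lessD[OF this assms(2)[unfolded upper_quantile_def]]
  obtain y where "a < centered_cdf \<mu> y" "y < x" by (elim bexE CollectE)
  then show ?thesis using ccdf_mono[of y x] by simp
qed

lemma upper_quantile_le:
  assumes "a \<in> {- 1/2..<1/2}" "a < centered_cdf \<mu> x" shows "upper_quantile \<mu> a \<le> x"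
  unfolding upper_quantile_def
proof (rule cInf_lower)
  show "bdd_below {x. a < centered_cdf \<mu> x}"
  proof (rule bdd_belowI)
    show "- R \<le> y" if "y \<in> {x. a < centered_cdf \<mu> x}" for y
      using that ccdf_left[of y] assms by force
  qed
qed (use assms in simp)

lemma upper_quantile_le_quantile:
  assumes "a \<in> {- 1/2..<1/2}" "m \<in> {- 1/2<..1/2}" "a < m"
  shows "upper_quantile \<mu> a \<le> quantile \<mu> m"
  using upper_quantile_le[OF assms(1), of "quantile \<mu> m"] quantile_le_iff[OF assms(2), of "quantile \<mu> m"] assms(3)
  by simp

lemma quantile_le_upper_quantile:
  assumes "a \<in> {- 1/2..<1/2}" "m \<in> {- 1/2<..1/2}" "m \<le> a"
  shows "quantile \<mu> m \<le> upper_quantile \<mu> a"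
proof (rule ccontr)
  assume "\<not> ?thesis"
  then obtain y where "upper_quantile \<mu> a < y" "y < quantile \<mu> m" using dense by (metis not_le)
  then show False
    using upper_quantile_less[OF assms(1), of y] less_quantile_iff[OF assms(2), of y] assms(3) by simp
qed

text \<open>Barriers hold for almost every label only. The labels between \<open>a\<close> and the
  value of the distribution function at \<open>x\<close> form an interval of positive length,
  through which such bounds pass to the end \<open>a\<close>; \<open>quantile_approx\<close> does
  the same at \<open>b\<close>.\<close>

lemma upper_quantile_approx:
  assumes "a \<in> {- 1/2..<1/2}" "upper_quantile \<mu> a < x"
  obtains m where "a < m" "m \<le> 1/2" "\<And>m'. m' \<in> {a<..m} \<Longrightarrow> quantile \<mu> m' \<le> x"
proof
  show "a < centered_cdf \<mu> x" using upper_quantile_less[OF assms] .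
  show "centered_cdf \<mu> x \<le> 1/2" by (rule ccdf_bounds)
  show "quantile \<mu> m' \<le> x" if "m' \<in> {a<..centered_cdf \<mu> x}" for m'
    using that assms ccdf_bounds(2)[of x] by (subst quantile_le_iff) auto
qed

lemma quantile_approx:
  assumes "b \<in> {- 1/2<..1/2}" "x < quantile \<mu> b"
  obtains m where "m < b" "- 1/2 \<le> m" "\<And>m'. m' \<in> {m<..b} \<Longrightarrow> x < quantile \<mu> m'"
proof
  show "centered_cdf \<mu> x < b" using less_quantile_iff assms by simp
  show "- 1/2 \<le> centered_cdf \<mu> x" by (rule ccdf_bounds)
  show "x < quantile \<mu> m'" if "m' \<in> {centered_cdf \<mu> x<..b}" for m'
    using that assms ccdf_bounds(1)[of x] by (subst less_quantile_iff) auto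
qed

lemma emeasure_Ioc_pos:
  assumes "centered_cdf \<mu> x < centered_cdf \<mu> y"
  shows "0 < emeasure \<mu> {x<..y}"
proof -
  have "x \<le> y" using assms ccdf_mono[of y x] by linarith
  then show ?thesis using assms by (simp add: emeasure_Ioc centered_cdf_def)
qed

lemma quantile_in_msupport: 
  assumes "m \<in> {- 1/2<..1/2}" shows "quantile \<mu> m \<in> msupport \<mu>"
  unfolding msupport_def
proof (safe)
  fix e :: real assume e: "0 < e" "emeasure \<mu> (ball (quantile \<mu> m) e) = 0"
  let ?x = "quantile \<mu> m - e / 2"
  have "centered_cdf \<mu> ?x < centered_cdf \<mu> (quantile \<mu> m)"
    using less_quantile_iff[OF assms, of ?x] quantile_le_iff[OF assms, of "quantile \<mu> m"] e by simp
  then have "0 < emeasure \<mu> {?x<..quantile \<mu> m}" by (rule emeasure_Ioc_pos)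
  also have "\<dots> \<le> emeasure \<mu> (ball (quantile \<mu> m) e)"
    using e by (intro emeasure_mono) (auto simp: dist_real_def)
  finally show False using e by simp
qed

lemma upper_quantile_in_msupport: 
  assumes "a \<in> {- 1/2..<1/2}" shows "upper_quantile \<mu> a \<in> msupport \<mu>"
  unfolding msupport_def
proof (safe)
  fix e :: real assume e: "0 < e" "emeasure \<mu> (ball (upper_quantile \<mu> a) e) = 0"
  let ?x = "upper_quantile \<mu> a - e / 2" and ?y = "upper_quantile \<mu> a + e / 2"
  have "centered_cdf \<mu> ?x \<le> a"
    using upper_quantile_le[OF assms, of ?x] e by force
  also have "a < centered_cdf \<mu> ?y" using e by (intro upper_quantile_less[OF assms]) auto
  finally have "0 < emeasure \<mu> {?x<..?y}" by (rule emeasure_Ioc_pos)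
  also have "\<dots> \<le> emeasure \<mu> (ball (upper_quantile \<mu> a) e)"
    using e by (intro emeasure_mono) (auto simp: dist_real_def)
  finally show False using e by simp
qed

section \<open>The quantile function as a random variable\<close>

lemma measurable_quantile_Ioc:
  assumes "{l<..r} \<subseteq> {- 1/2<..1/2}"
  shows "quantile \<mu> \<in> borel_measurable (restrict_space lborel {l<..r})"
proof -
  have "mono_on {l<..r} (quantile \<mu>)" using assms by (auto intro!: mono_onI quantile_mono)
  then have "quantile \<mu> \<in> borel_measurable (restrict_space borel {l<..r})"
    by (rule borel_measurable_mono_on_fnc)
  moreover have "sets (restrict_space lborel {l<..r}) = sets (restrict_space borel {l<..r})"
    by (simp add: sets_restrict_space)
  ultimately show ?thesis using measurable_cong_sets by blast
qed

lemma measurable_quantile [measurable]: "quantile \<mu> \<in> borel_measurable labels"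
  unfolding labels_def by (rule measurable_quantile_Ioc) simp

text \<open>Inverse transform sampling: the labels whose quantile is at most \<open>x\<close> form
  the interval from -1/2 to \<open>centered_cdf \<mu> x\<close>, of length
  \<open>cdf \<mu> x\<close>.\<close>

lemma distr_quantile: "distr labels borel (quantile \<mu>) = \<mu>"
proof (intro cdf_unique ext)
  show "real_distribution (distr labels borel (quantile \<mu>))" by (rule labels.real_distribution_distr[OF measurable_quantile])
  show "real_distribution \<mu>" by unfold_locales
  fix x
  have "cdf (distr labels borel (quantile \<mu>)) x = measure labels {m \<in> {- 1/2<..1/2}. quantile \<mu> m \<le> x}"
    by (subst cdf_def, subst measure_distr) (auto intro!: arg_cong[where f="measure labels"])
  also have "{m \<in> {- 1/2<..1/2}. quantile \<mu> m \<le> x} = {- 1/2<..centered_cdf \<mu> x}"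
    using quantile_le_iff ccdf_bounds[of x] by auto
  also have "measure labels \<dots> = measure lborel {- 1/2<..centered_cdf \<mu> x}"
    using ccdf_bounds[of x] unfolding measure_def by (subst emeasure_labels) auto
  also have "\<dots> = cdf \<mu> x" using ccdf_bounds[of x] by (simp add: centered_cdf_def)
  finally show "cdf (distr labels borel (quantile \<mu>)) x = cdf \<mu> x" .
qed

lemma integral_quantile:
  fixes f :: "real \<Rightarrow> real"
  assumes "f \<in> borel_measurable borel"
  shows "(\<integral>x. f x \<partial>\<mu>) = (\<integral>m. f (quantile \<mu> m) \<partial>labels)"
  using integral_distr[OF measurable_quantile assms] unfolding distr_quantile .

lemma AE_quantile:
  assumes "AE x in \<mu>. P x" shows "AE m in labels. P (quantile \<mu> m)"
proof (rule AE_distrD[OF measurable_quantile])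
  show "AE x in distr labels borel (quantile \<mu>). P x" unfolding distr_quantile by (rule assms)
qed

text \<open>The two Stieltjes measures in \<open>integral_d_abs\<close> are the cases
  [\<alpha>, 1/2] and [-1/2, \<alpha>]. Both sides of the equation give a half-open interval (x, y]
  the mass F y - F x, and this determines them.\<close>

lemma interval_measure_clamp:
  assumes "- 1/2 \<le> l" "l \<le> r" "r \<le> 1/2"
    and F: "\<And>x. F x = max l (min r (centered_cdf \<mu> x))"
  shows "interval_measure F = distr (restrict_space lborel {l<..r}) borel (quantile \<mu>)" (is "_ = ?N")
proof (rule measure_eqI_generator_eq[where \<Omega>=UNIV])
  have sub: "{l<..r} \<subseteq> {- 1/2<..1/2}" using assms by auto
  note measurable_quantile_Ioc[OF sub, measurable]
  have Fmono: "F x \<le> F y" if "x \<le> y" for x y using ccdf_mono[OF that] by (auto simp: F)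
  have Fcont: "continuous (at_right x) F" for x
    unfolding F[abs_def] by (intro continuous_intros ccdf_right_cont)
  fix X assume "X \<in> range (\<lambda>(a, b). {a<..b::real})"
  then obtain a b where X: "X = {a<..b}" by auto
  show eq: "emeasure (interval_measure F) X = emeasure ?N X"
  proof (cases "a \<le> b")
    case True
    have "emeasure ?N X = emeasure (restrict_space lborel {l<..r}) {m \<in> {l<..r}. a < quantile \<mu> m \<and> quantile \<mu> m \<le> b}"
      by (subst emeasure_distr) (auto simp: X space_restrict_space intro!: arg_cong2[where f=emeasure])
    also have "{m \<in> {l<..r}. a < quantile \<mu> m \<and> quantile \<mu> m \<le> b} = {F a<..F b}"
      using assms(1-3) ccdf_mono[OF True]
      by (auto simp: less_quantile_iff quantile_le_iff F split: if_splits simp: max_def min_def)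
    also have "emeasure (restrict_space lborel {l<..r}) {F a<..F b} = emeasure lborel {F a<..F b}"
      using assms(1-3) by (intro emeasure_restrict_space) (auto simp: F)
    also have "\<dots> = F b - F a" using Fmono[OF True] by simp
    also have "\<dots> = emeasure (interval_measure F) X"
      unfolding X by (subst emeasure_interval_measure_Ioc) (auto intro: True Fmono Fcont)
    finally show ?thesis by simp
  qed (simp add: X)
next
  have Fmono: "F x \<le> F y" if "x \<le> y" for x y using ccdf_mono[OF that] by (auto simp: F)
  have Fcont: "continuous (at_right x) F" for x
    unfolding F[abs_def] by (intro continuous_intros ccdf_right_cont)
  show "emeasure (interval_measure F) {- real i<..real i} \<noteq> \<infinity>" for i
    by (subst emeasure_interval_measure_Ioc) (auto intro: Fmono Fcont)
  show "(\<Union>i. {- real (i::nat)<..real i}) = UNIV" by (rule UN_Ioc_eq_UNIV)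
qed (auto simp: borel_sigma_sets_Ioc Int_stable_def)

text \<open>In the label variable the derivative of |F - \<alpha>| becomes a plain sign: labels
  above \<alpha> come from the maximum, those below from the minimum.\<close>

lemma integral_d_abs_quantile:
  fixes f :: "real \<Rightarrow> real"
  assumes [measurable]: "f \<in> borel_measurable borel" and f: "\<And>x. \<bar>f x\<bar> \<le> B" and \<alpha>: "\<alpha> \<in> {- 1/2..1/2}"
  shows "integral_d_abs (centered_cdf \<mu>) \<alpha> f =
    (\<integral>m. (if \<alpha> < m then 1 else - 1) * f (quantile \<mu> m) \<partial>labels)"
proof -
  have *: "(\<integral>x. f x \<partial>interval_measure F) = (\<integral>m. indicator {l<..r} m * f (quantile \<mu> m) \<partial>labels)"
    if lr: "- 1/2 \<le> l" "l \<le> r" "r \<le> 1/2" and F: "\<And>x. F x = max l (min r (centered_cdf \<mu> x))" for l r F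
  proof -
    have sub: "{l<..r} \<subseteq> {- 1/2<..1/2}" using lr by auto
    note m = measurable_quantile_Ioc[OF sub]
    have "(\<integral>x. f x \<partial>interval_measure F) = (\<integral>m. f (quantile \<mu> m) \<partial>restrict_space lborel {l<..r})"
      unfolding interval_measure_clamp[OF lr F] by (rule integral_distr[OF m]) measurable
    also have "\<dots> = (LBINT m:{l<..r}. f (quantile \<mu> m))"
      unfolding set_lebesgue_integral_def by (subst integral_restrict_space) auto
    also have "\<dots> = (\<integral>m. indicator {l<..r} m * f (quantile \<mu> m) \<partial>labels)"
      unfolding integral_labels set_lebesgue_integral_def using sub
      by (intro Bochner_Integration.integral_cong) (auto simp: indicator_def)
    finally show ?thesis .
  qed
  have F: "max (centered_cdf \<mu> x) \<alpha> = max \<alpha> (min (1/2) (centered_cdf \<mu> x))"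
    "min (centered_cdf \<mu> x) \<alpha> = max (- 1/2) (min \<alpha> (centered_cdf \<mu> x))" for x
    using \<alpha> ccdf_bounds[of x] by (auto simp: max_def min_def)
  have "integral_d_abs (centered_cdf \<mu>) \<alpha> f =
      (\<integral>m. indicator {\<alpha><..1/2} m * f (quantile \<mu> m) \<partial>labels) - (\<integral>m. indicator {- 1/2<..\<alpha>} m * f (quantile \<mu> m) \<partial>labels)"
    unfolding integral_d_abs_def using \<alpha> by (intro arg_cong2[where f="(-)"] * F) auto
  also have "\<dots> = (\<integral>m. indicator {\<alpha><..1/2} m * f (quantile \<mu> m) - indicator {- 1/2<..\<alpha>} m * f (quantile \<mu> m) \<partial>labels)"
  proof (intro Bochner_Integration.integral_diff[symmetric])
    have "(\<lambda>m. f (quantile \<mu> m)) \<in> borel_measurable labels"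
      using measurable_compose[OF measurable_quantile assms(1)] .
    then have m: "(\<lambda>m. indicator {l<..r} m * f (quantile \<mu> m)) \<in> borel_measurable labels" for l r
      by (intro borel_measurable_times[OF measurable_labelsI]) auto
    have b: "\<bar>indicator {l<..r} m * f (quantile \<mu> m)\<bar> \<le> B" for l r m
      using f[of "quantile \<mu> m"] by (auto simp: indicator_def)
    show "integrable labels (\<lambda>m. indicator {\<alpha><..1/2} m * f (quantile \<mu> m))"
      "integrable labels (\<lambda>m. indicator {- 1/2<..\<alpha>} m * f (quantile \<mu> m))"
      by (rule labels.integrable_bounded[where B=B, OF m b])+
  qed
  also have "\<dots> = (\<integral>m. (if \<alpha> < m then 1 else - 1) * f (quantile \<mu> m) \<partial>labels)"
    by (intro Bochner_Integration.integral_cong) (auto simp: indicator_def)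
  finally show ?thesis .
qed

end

section \<open>The interaction potential\<close>

locale kernel =
  fixes \<phi> :: "real \<Rightarrow> real"
  assumes kernel: "communication_kernel \<phi>"
begin

lemma nonneg: "0 \<le> \<phi> x"
  and even: "\<phi> (- x) = \<phi> x"
  and integrable_Icc: "set_integrable lborel {a..b} \<phi>"
  and antimono: "0 < x \<Longrightarrow> x \<le> y \<Longrightarrow> \<phi> y \<le> \<phi> x"
  using kernel by (auto simp: communication_kernel_def monotone_on_def)

lemma interval_integrable: "interval_lebesgue_integrable lborel (ereal a) (ereal b) \<phi>"
  using integrable_Icc by (auto simp: interval_lebesgue_integrable_def intro: set_integrable_subset[OF integrable_Icc[of "min a b" "max a b"]])

lemma potential_diff:
  assumes "u \<le> v"
  shows "potential \<phi> v - potential \<phi> u = (LBINT r:{u..v}. \<phi> r)"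
proof -
  have "(LBINT r=ereal 0..ereal u. \<phi> r) + (LBINT r=ereal u..ereal v. \<phi> r) = (LBINT r=ereal 0..ereal v. \<phi> r)"
  proof (rule interval_integral_sum)
    have "min (ereal 0) (min (ereal u) (ereal v)) = ereal (min 0 (min u v))"
      "max (ereal 0) (max (ereal u) (ereal v)) = ereal (max 0 (max u v))" by (simp_all add: min_def max_def)
    then show "interval_lebesgue_integrable lborel (min (ereal 0) (min (ereal u) (ereal v)))
      (max (ereal 0) (max (ereal u) (ereal v))) \<phi>" using interval_integrable by metis
  qed
  then show ?thesis using interval_integral_Icc[OF assms, of \<phi>] by (simp add: potential_def)
qed

lemma potential_0 [simp]: "potential \<phi> 0 = 0"
  by (simp add: potential_def)

lemma potential_mono: "u \<le> v \<Longrightarrow> potential \<phi> u \<le> potential \<phi> v"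
proof -
  assume "u \<le> v"
  moreover have "0 \<le> (LBINT r:{u..v}. \<phi> r)"
    unfolding set_lebesgue_integral_def by (intro Bochner_Integration.integral_nonneg) (simp add: nonneg)
  ultimately show ?thesis using potential_diff by fastforce
qed

lemma potential_minus: "potential \<phi> (- x) = - potential \<phi> x"
proof -
  have *: "(LBINT r:{- x..0}. \<phi> r) = (LBINT r:{0..x}. \<phi> r)" if "0 \<le> x" for x
  proof -
    have "(LBINT r:{- x..0}. \<phi> r) = (LBINT r. indicator {- x..0} (0 + (- 1) * r) * \<phi> (0 + (- 1) * r))"
      unfolding set_lebesgue_integral_def
      using lborel_integral_real_affine[of "- 1" "\<lambda>r. indicator {- x..0} r * \<phi> r" 0] by simp
    also have "\<dots> = (LBINT r:{0..x}. \<phi> r)"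
      unfolding set_lebesgue_integral_def
      by (intro Bochner_Integration.integral_cong) (auto simp: even indicator_def)
    finally show ?thesis .
  qed
  show ?thesis
  proof (cases "0 \<le> x")
    case True
    then show ?thesis using potential_diff[of "-x" 0] potential_diff[of 0 x] * by simp
  next
    case False
    then show ?thesis using potential_diff[of 0 "-x"] potential_diff[of x 0] *[of "-x"] by simp
  qed
qed

lemma potential_nonneg: "0 \<le> x \<Longrightarrow> 0 \<le> potential \<phi> x"
  using potential_mono[of 0 x] by simp

lemma continuous_potential: "continuous_on UNIV (potential \<phi>)"
proof -
  have "continuous_on {-N<..<N} (potential \<phi>)" for N
  proof (cases "0 < N")
    case True
    have "\<phi> integrable_on {-N..N}"
      using integrable_Icc by (rule set_borel_integral_eq_integral)
    then have "continuous_on {-N..N} (\<lambda>x. integral {-N..x} \<phi>)"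
      by (rule indefinite_integral_continuous_1)
    then have "continuous_on {-N..N} (\<lambda>x. integral {-N..x} \<phi> + potential \<phi> (-N))"
      by (intro continuous_intros)
    moreover have "potential \<phi> x = integral {-N..x} \<phi> + potential \<phi> (-N)" if "x \<in> {-N..N}" for x
      using potential_diff[of "-N" x] that set_borel_integral_eq_integral(2)[OF integrable_Icc] by simp
    ultimately have "continuous_on {-N..N} (potential \<phi>)"
      by (rule continuous_on_eq[OF _ sym])
    then show ?thesis by (rule continuous_on_subset) auto
  qed simp
  then have "continuous_on (\<Union>N\<in>UNIV. {-N<..<N::real}) (potential \<phi>)"
    by (intro continuous_on_open_UN) auto
  moreover have "(\<Union>N\<in>UNIV. {-N<..<N::real}) = UNIV"
  proof -
    have "x \<in> (\<Union>N\<in>UNIV. {-N<..<N})" for x :: real by (rule UN_I[of "\<bar>x\<bar> + 1"]) auto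
    then show ?thesis by blast
  qed
  ultimately show ?thesis by simp
qed

text \<open>The origin of the decay rate: on [-D, D] the kernel is at least \<open>\<phi> D\<close>
  by evenness and monotonicity, except perhaps at 0, where its value is arbitrary.\<close>

lemma potential_diff_ge:
  assumes "0 < D" "- D \<le> u" "u \<le> v" "v \<le> D"
  shows "\<phi> D * (v - u) \<le> potential \<phi> v - potential \<phi> u"
proof -
  have "(LBINT r:{u..v}. \<phi> D) \<le> (LBINT r:{u..v}. \<phi> r)"
    unfolding set_lebesgue_integral_def
  proof (intro integral_mono_AE)
    show "integrable lborel (\<lambda>r. indicat_real {u..v} r *\<^sub>R \<phi> D)"
      by (intro integrable_scaleR_left) (simp add: integrable_indicator_iff emeasure_lborel_Icc_eq)
    show "integrable lborel (\<lambda>r. indicat_real {u..v} r *\<^sub>R \<phi> r)"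
      using integrable_Icc by (simp add: set_integrable_def)
    have "\<phi> D \<le> \<phi> r" if "r \<noteq> 0" "r \<in> {u..v}" for r
      using that assms antimono[of "\<bar>r\<bar>" D] even[of r] by (cases "0 \<le> r") auto
    note le = this
    have "AE r in lborel. r \<noteq> (0::real)" by (rule AE_lborel_singleton)
    then show "AE r in lborel. indicat_real {u..v} r *\<^sub>R \<phi> D \<le> indicat_real {u..v} r *\<^sub>R \<phi> r"
    proof eventually_elim
      case (elim r)
      then show ?case using le[of r] by (auto simp: indicator_def)
    qed
  qed
  moreover have "(LBINT r:{u..v}. \<phi> D) = \<phi> D * (v - u)"
    unfolding set_lebesgue_integral_def using assms by simp
  ultimately show ?thesis using assms by (simp add: potential_diff)
qed

text \<open>Moving the interval [0, u] to the right by \<open>v\<close> can only decrease the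
  integral of a nonincreasing kernel.\<close>

lemma potential_subadditive:
  assumes "0 \<le> u" "0 \<le> v"
  shows "potential \<phi> (u + v) \<le> potential \<phi> u + potential \<phi> v"
proof -
  have "(LBINT r:{v..u + v}. \<phi> r) = (LBINT r. indicator {v..u + v} (v + 1 * r) * \<phi> (v + 1 * r))"
    unfolding set_lebesgue_integral_def
    using lborel_integral_real_affine[of 1 "\<lambda>r. indicator {v..u + v} r * \<phi> r" v] by simp
  also have "\<dots> \<le> (LBINT r. indicator {0..u} r * \<phi> r)"
  proof (rule integral_mono_AE)
    have "integrable lborel (\<lambda>r. indicator {v..u + v} r * \<phi> r)"
      using integrable_Icc[of v "u + v"] by (simp add: set_integrable_def)
    from lborel_integrable_real_affine[OF this, of 1 v]
    show "integrable lborel (\<lambda>r. indicator {v..u + v} (v + 1 * r) * \<phi> (v + 1 * r))" by simp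
    show "integrable lborel (\<lambda>r. indicator {0..u} r * \<phi> r)"
      using integrable_Icc[of 0 u] by (simp add: set_integrable_def)
    have "AE r in lborel. r \<noteq> (0::real)" by (rule AE_lborel_singleton)
    then show "AE r in lborel. indicator {v..u + v} (v + 1 * r) * \<phi> (v + 1 * r) \<le> indicator {0..u} r * \<phi> r"
    proof eventually_elim
      case (elim r)
      then show ?case using assms antimono[of r "v + r"] by (auto simp: indicator_def)
    qed
  qed
  also have "\<dots> = potential \<phi> u" using potential_diff[of 0 u] assms by (simp add: set_lebesgue_integral_def)
  finally show ?thesis using potential_diff[of v "u + v"] assms by simp
qed

text \<open>Once the kernel vanishes it stays zero, so the tail integral would reduce to one over a
  bounded interval and be finite.\<close>

lemma heavy_tailed_pos:
  assumes "heavy_tailed \<phi>" "0 < D" shows "0 < \<phi> D"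
proof (rule ccontr)
  assume "\<not> ?thesis"
  then have "\<phi> D = 0" using nonneg[of D] by simp
  then have 0: "\<phi> r = 0" if "D \<le> r" for r using antimono[OF assms(2) that] nonneg[of r] by simp
  have "(\<integral>\<^sup>+ r. ennreal (\<phi> r) * indicator {1..} r \<partial>lborel) \<le> (\<integral>\<^sup>+ r. ennreal (\<phi> r) * indicator {1..max 1 D} r \<partial>lborel)"
    by (intro nn_integral_mono) (use 0 in \<open>auto simp: indicator_def\<close>)
  also have "\<dots> = (\<integral>\<^sup>+ r. ennreal (indicator {1..max 1 D} r * \<phi> r) \<partial>lborel)"
    by (intro nn_integral_cong) (auto simp: indicator_def)
  also have "\<dots> = ennreal (LBINT r. indicator {1..max 1 D} r * \<phi> r)"
    using integrable_Icc[of 1 "max 1 D"] by (intro nn_integral_eq_integral) (auto simp: set_integrable_def nonneg)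
  finally show False using assms(1) by (simp add: heavy_tailed_def top_unique)
qed

text \<open>Monotone convergence along [1, n]. The prescribed lower bound \<open>R0\<close> lets the
  same radius also dominate the initial diameter.\<close>

lemma heavy_tailed_unbounded:
  assumes "heavy_tailed \<phi>"
  shows "\<exists>R\<ge>R0. K < potential \<phi> R"
proof -
  define f where "f = (\<lambda>(n::nat) r. ennreal (\<phi> r) * indicator {1..real n} r)"
  have f: "(\<integral>\<^sup>+ r. f n r \<partial>lborel) \<le> ennreal (potential \<phi> (real n))" for n
  proof (cases "1 \<le> real n")
    case True
    have "(\<integral>\<^sup>+ r. f n r \<partial>lborel) = (\<integral>\<^sup>+ r. ennreal (indicator {1..real n} r * \<phi> r) \<partial>lborel)"
      unfolding f_def by (intro nn_integral_cong) (auto simp: indicator_def)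
    also have "\<dots> = ennreal (LBINT r. indicator {1..real n} r * \<phi> r)"
      using integrable_Icc[of 1 "real n"] by (intro nn_integral_eq_integral) (auto simp: set_integrable_def nonneg)
    also have "(LBINT r. indicator {1..real n} r * \<phi> r) = potential \<phi> (real n) - potential \<phi> 1"
      using potential_diff[OF True] by (simp add: set_lebesgue_integral_def)
    also have "\<dots> \<le> potential \<phi> (real n)" using potential_nonneg[of 1] by simp
    finally show ?thesis by (simp add: ennreal_leI)
  next
    case False
    then show ?thesis by (simp add: f_def)
  qed
  have meas: "f n \<in> borel_measurable lborel" for n
  proof -
    have "(\<lambda>r. ennreal (indicator {1..real n} r * \<phi> r)) \<in> borel_measurable lborel"
      using integrable_Icc[of 1 "real n"] unfolding set_integrable_def by (intro measurable_compose[OF _ measurable_ennreal]) auto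
    also have "(\<lambda>r. ennreal (indicator {1..real n} r * \<phi> r)) = f n" by (auto simp: f_def indicator_def)
    finally show ?thesis .
  qed
  have "(\<integral>\<^sup>+ r. (SUP n. f n r) \<partial>lborel) = (SUP n. (\<integral>\<^sup>+ r. f n r \<partial>lborel))"
    by (intro nn_integral_monotone_convergence_SUP meas) (auto simp: f_def incseq_def le_fun_def indicator_def)
  moreover have "(SUP n. f n r) = ennreal (\<phi> r) * indicator {1..} r" for r
  proof (rule antisym)
    show "(SUP n. f n r) \<le> ennreal (\<phi> r) * indicator {1..} r"
      by (intro SUP_least) (auto simp: f_def indicator_def)
    obtain n where "r \<le> real n" using real_arch_simple by blast
    then have "ennreal (\<phi> r) * indicator {1..} r = f n r" by (auto simp: f_def indicator_def)
    then show "ennreal (\<phi> r) * indicator {1..} r \<le> (SUP n. f n r)" by (metis SUP_upper UNIV_I)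
  qed
  ultimately have top: "(SUP n. (\<integral>\<^sup>+ r. f n r \<partial>lborel)) = \<infinity>"
    using assms by (simp add: heavy_tailed_def)
  obtain n where n: "ennreal \<bar>K\<bar> < (\<integral>\<^sup>+ r. f n r \<partial>lborel)"
  proof -
    have "ennreal \<bar>K\<bar> < (SUP n. (\<integral>\<^sup>+ r. f n r \<partial>lborel))" unfolding top by simp
    then show thesis using that by (auto simp: less_SUP_iff)
  qed
  also note f[of n]
  finally have "\<bar>K\<bar> < potential \<phi> (real n)" by (simp add: ennreal_less_iff)
  also have "\<dots> \<le> potential \<phi> (max R0 (real n))" by (intro potential_mono) simp
  finally show ?thesis by (intro exI[of _ "max R0 (real n)"]) auto
qed

end


lemma (in kernel) potential_quantile:
  assumes "bounded_distribution \<mu> R"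
  shows potential_conv_quantile: "potential_conv \<phi> \<mu> x = (\<integral>m. potential \<phi> (x - quantile \<mu> m) \<partial>labels)"
    and potential_quantile_measurable: "(\<lambda>m. potential \<phi> (x - quantile \<mu> m)) \<in> borel_measurable labels"
    and potential_quantile_bound: "m \<in> {- 1/2<..1/2} \<Longrightarrow> \<bar>potential \<phi> (x - quantile \<mu> m)\<bar> \<le> potential \<phi> (\<bar>x\<bar> + \<bar>R\<bar>)"
    and integrable_potential_quantile: "integrable labels (\<lambda>m. potential \<phi> (x - quantile \<mu> m))"
    and mono_potential_conv: "mono (potential_conv \<phi> \<mu>)"
proof -
  interpret bounded_distribution \<mu> R by fact
  have meas: "(\<lambda>y. potential \<phi> (x - y)) \<in> borel_measurable borel" for x
    by (intro borel_measurable_continuous_onI continuous_on_compose2[OF continuous_potential] continuous_intros) auto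
  show eq: "potential_conv \<phi> \<mu> x = (\<integral>m. potential \<phi> (x - quantile \<mu> m) \<partial>labels)" for x
    unfolding potential_conv_def by (rule integral_quantile[OF meas])
  show qm: "(\<lambda>m. potential \<phi> (x - quantile \<mu> m)) \<in> borel_measurable labels" for x
    by (rule measurable_compose[OF measurable_quantile meas])
  show bound: "\<bar>potential \<phi> (x - quantile \<mu> m)\<bar> \<le> potential \<phi> (\<bar>x\<bar> + \<bar>R\<bar>)" if "m \<in> {- 1/2<..1/2}" for x m
  proof -
    note b = quantile_bounds[OF that]
    have "potential \<phi> (x - quantile \<mu> m) \<le> potential \<phi> (\<bar>x\<bar> + \<bar>R\<bar>)" using b by (intro potential_mono) linarith
    moreover have "potential \<phi> (- (x - quantile \<mu> m)) \<le> potential \<phi> (\<bar>x\<bar> + \<bar>R\<bar>)" using b by (intro potential_mono) linarith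
    ultimately show ?thesis unfolding potential_minus by linarith
  qed
  show int: "integrable labels (\<lambda>m. potential \<phi> (x - quantile \<mu> m))" for x
    by (rule labels.integrable_bounded[OF qm bound]) simp
  show "mono (potential_conv \<phi> \<mu>)"
    unfolding eq[abs_def] by (intro monoI integral_mono int potential_mono) simp
qed


section \<open>Curves of compactly supported distributions\<close>

text \<open>What follows from bounded supports and continuity in L1 alone; the entropy inequality is
  added in \<open>flow\<close>.\<close>

locale curve = kernel +
  fixes \<rho> :: "real \<Rightarrow> real measure"
  assumes dist: "0 \<le> t \<Longrightarrow> real_distribution (\<rho> t)"
    and bounded: "\<exists>R. \<forall>t\<in>{0..T}. msupport (\<rho> t) \<subseteq> {-R..R}"
    and L1_continuous: "0 \<le> s \<Longrightarrow>
      ((\<lambda>t. LBINT x. \<bar>centered_cdf (\<rho> t) x - centered_cdf (\<rho> s) x\<bar>) \<longlongrightarrow> 0) (at s within {0..})"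
begin

abbreviation X where "X m t \<equiv> quantile (\<rho> t) m"
abbreviation Xu where "Xu a t \<equiv> upper_quantile (\<rho> t) a"
abbreviation Mc where "Mc x t \<equiv> centered_cdf (\<rho> t) x"

lemma obtain_bound:
  obtains R where "0 < R" "\<And>t. t \<in> {0..T} \<Longrightarrow> bounded_distribution (\<rho> t) R"
proof -
  obtain R where R: "\<forall>t\<in>{0..T}. msupport (\<rho> t) \<subseteq> {-R..R}" using bounded by blast
  show thesis
  proof
    show "0 < max R 1" by simp
    fix t assume t: "t \<in> {0..T}"
    interpret real_distribution "\<rho> t" using t dist by simp
    show "bounded_distribution (\<rho> t) (max R 1)"
      by unfold_locales (use R t in fastforce)
  qed
qed

lemma bounded_dist: "0 \<le> t \<Longrightarrow> \<exists>R. bounded_distribution (\<rho> t) R"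
  using obtain_bound[of t] by (metis atLeastAtMost_iff order_refl)

lemma L1_lower:
  assumes "0 \<le> s" "0 \<le> t" "l \<le> r" "0 \<le> \<delta>"
    and "\<And>x. x \<in> {l..<r} \<Longrightarrow> \<delta> \<le> \<bar>Mc x t - Mc x s\<bar>"
  shows "\<delta> * (r - l) \<le> (LBINT x. \<bar>Mc x t - Mc x s\<bar>)"
proof -
  obtain R where R: "0 < R" "\<And>t'. t' \<in> {0..max s t} \<Longrightarrow> bounded_distribution (\<rho> t') R"
    using obtain_bound[of "max s t"] by blast
  interpret s: bounded_distribution "\<rho> s" R using R assms by simp
  interpret t: bounded_distribution "\<rho> t" R using R assms by simp
  have "integrable lborel (\<lambda>x. \<bar>Mc x t - Mc x s\<bar>)"
  proof (rule Bochner_Integration.integrable_bound[of _ "\<lambda>x. indicator {-R..R} x * 1"])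
    show "AE x in lborel. norm \<bar>Mc x t - Mc x s\<bar> \<le> norm (indicator {- R..R} x * 1 :: real)"
    proof (rule AE_I2)
      fix x
      show "norm \<bar>Mc x t - Mc x s\<bar> \<le> norm (indicator {- R..R} x * 1 :: real)"
      proof (cases "x \<in> {-R..R}")
        case True
        then show ?thesis using s.ccdf_bounds[of x] t.ccdf_bounds[of x] by simp
      next
        case False
        then show ?thesis using s.ccdf_left[of x] t.ccdf_left[of x] s.ccdf_right[of x] t.ccdf_right[of x] by force
      qed
    qed
  qed (auto simp: integrable_indicator_iff emeasure_lborel_Icc_eq)
  moreover have "integrable lborel (\<lambda>x. indicator {l..<r} x * \<delta>)"
    using assms(3) by (intro integrable_mult_left) (simp add: integrable_indicator_iff)
  ultimately have "(LBINT x. indicator {l..<r} x * \<delta>) \<le> (LBINT x. \<bar>Mc x t - Mc x s\<bar>)"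
    using assms(4,5) by (intro integral_mono) (auto simp: indicator_def)
  then show ?thesis using assms by (simp add: mult.commute)
qed

lemma eventually_nonneg_time: "\<forall>\<^sub>F t in at s within {0..}. 0 \<le> (t::real)"
  by (simp add: eventually_at_filter)

text \<open>If X b t fell to \<open>y\<close> or below, then between \<open>y\<close> and a slightly
  larger \<open>y'\<close> still below X b s the two distribution functions would differ by a fixed
  amount, against L1 continuity. From above there is no such control: across a gap of the support an
  arbitrarily small mass moves \<open>X b\<close> from one side to the other.\<close>

lemma quantile_lsc:
  assumes "0 \<le> s" "b \<in> {- 1/2<..1/2}" "y < X b s"
  shows "\<forall>\<^sub>F t in at s within {0..}. y < X b t"
proof -
  obtain R where "bounded_distribution (\<rho> s) R" using bounded_dist assms by blast
  then interpret s: bounded_distribution "\<rho> s" R .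
  obtain y' where y': "y < y'" "y' < X b s" using dense assms(3) by blast
  define \<delta> where "\<delta> = b - Mc y' s"
  have \<delta>: "0 < \<delta>" using s.less_quantile_iff[OF assms(2)] y' by (simp add: \<delta>_def)
  have "\<forall>\<^sub>F t in at s within {0..}. (LBINT x. \<bar>Mc x t - Mc x s\<bar>) < \<delta> * (y' - y)"
    using L1_continuous[OF assms(1)] \<delta> y' by (intro order_tendstoD(2)) auto
  then show ?thesis using eventually_nonneg_time
  proof eventually_elim
    case (elim t)
    then obtain R' where "bounded_distribution (\<rho> t) R'" using bounded_dist by blast
    then interpret t: bounded_distribution "\<rho> t" R' .
    show ?case
    proof (rule ccontr)
      assume n: "\<not> y < X b t"
      have "\<delta> \<le> \<bar>Mc x t - Mc x s\<bar>" if "x \<in> {y..<y'}" for x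
      proof -
        have "b \<le> Mc x t" using t.quantile_le_iff[OF assms(2), of x] that n by simp
        moreover have "Mc x s \<le> Mc y' s" using s.ccdf_mono that by simp
        ultimately show ?thesis by (simp add: \<delta>_def)
      qed
      then have "\<delta> * (y' - y) \<le> (LBINT x. \<bar>Mc x t - Mc x s\<bar>)"
        using assms(1) elim \<delta> y' by (intro L1_lower) auto
      with elim show False by simp
    qed
  qed
qed

lemma upper_quantile_usc:
  assumes "0 \<le> s" "a \<in> {- 1/2..<1/2}" "Xu a s < y"
  shows "\<forall>\<^sub>F t in at s within {0..}. Xu a t < y"
proof -
  obtain R where "bounded_distribution (\<rho> s) R" using bounded_dist assms by blast
  then interpret s: bounded_distribution "\<rho> s" R .
  obtain y' where y': "Xu a s < y'" "y' < y" using dense assms(3) by blast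
  define \<delta> where "\<delta> = Mc y' s - a"
  have \<delta>: "0 < \<delta>" using s.upper_quantile_less[OF assms(2)] y' by (simp add: \<delta>_def)
  have "\<forall>\<^sub>F t in at s within {0..}. (LBINT x. \<bar>Mc x t - Mc x s\<bar>) < \<delta> * (y - y')"
    using L1_continuous[OF assms(1)] \<delta> y' by (intro order_tendstoD(2)) auto
  then show ?thesis using eventually_nonneg_time
  proof eventually_elim
    case (elim t)
    then obtain R' where "bounded_distribution (\<rho> t) R'" using bounded_dist by blast
    then interpret t: bounded_distribution "\<rho> t" R' .
    show ?case
    proof (rule ccontr)
      assume n: "\<not> Xu a t < y"
      have "\<delta> \<le> \<bar>Mc x t - Mc x s\<bar>" if "x \<in> {y'..<y}" for x
      proof -
        have "Mc x t \<le> a" using t.upper_quantile_le[OF assms(2), of x] that n by force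
        moreover have "Mc y' s \<le> Mc x s" using s.ccdf_mono that by simp
        ultimately show ?thesis by (simp add: \<delta>_def)
      qed
      then have "\<delta> * (y - y') \<le> (LBINT x. \<bar>Mc x t - Mc x s\<bar>)"
        using assms(1) elim \<delta> y' by (intro L1_lower) auto
      with elim show False by simp
    qed
  qed
qed

text \<open>The quantile jumps at countably many labels only, because the jump intervals of
  different labels are disjoint and each contains a rational. At all other labels the two
  semicontinuities combine to continuity in time.\<close>

lemma AE_quantile_eq:
  assumes "0 \<le> s" shows "AE m in labels. m < 1/2 \<and> Xu m s = X m s"
proof -
  obtain R where "bounded_distribution (\<rho> s) R" using bounded_dist assms by blast
  then interpret s: bounded_distribution "\<rho> s" R .
  define B where "B = {m \<in> {- 1/2<..<1/2}. X m s < Xu m s}"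
  have "\<exists>q::rat. X m s < of_rat q \<and> of_rat q < Xu m s" if "m \<in> B" for m
    using that of_rat_dense[of "X m s" "Xu m s"] by (auto simp: B_def)
  then obtain q :: "real \<Rightarrow> rat" where q: "\<And>m. m \<in> B \<Longrightarrow> X m s < of_rat (q m) \<and> of_rat (q m) < Xu m s"
    by metis
  have less: "(of_rat (q m) :: real) < of_rat (q m')" if "m \<in> B" "m' \<in> B" "m < m'" for m m'
    using q[OF that(1)] q[OF that(2)] s.upper_quantile_le_quantile[of m m'] that by (force simp: B_def)
  have "inj_on q B"
    by (intro inj_onI) (metis less linorder_neqE_linordered_idom order_less_irrefl)
  then have "countable B" by (rule countableI') 
  then have "countable (insert (1/2) B)" by simp
  then have "AE m in lborel. m \<notin> insert (1/2) B"
    by (intro AE_not_in countable_imp_null_set_lborel)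
  then show ?thesis unfolding AE_labels_iff
  proof eventually_elim
    case (elim m)
    show ?case
    proof
      assume m: "m \<in> {- 1/2<..1/2}"
      with elim have "m < 1/2" by auto
      moreover have "X m s \<le> Xu m s" using m \<open>m < 1/2\<close> by (intro s.quantile_le_upper_quantile) auto
      ultimately show "m < 1/2 \<and> Xu m s = X m s" using elim m by (auto simp: B_def)
    qed
  qed
qed

lemma quantile_tendsto:
  assumes "0 \<le> s" "m \<in> {- 1/2<..<1/2}" "Xu m s = X m s"
  shows "((\<lambda>t. X m t) \<longlongrightarrow> X m s) (at s within {0..})"
proof (rule order_tendstoI)
  fix y assume "y < X m s"
  then show "\<forall>\<^sub>F t in at s within {0..}. y < X m t"
    using assms by (intro quantile_lsc) auto
next
  fix y assume y: "X m s < y"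
  have "\<forall>\<^sub>F t in at s within {0..}. Xu m t < y"
    using assms y by (intro upper_quantile_usc) auto
  then show "\<forall>\<^sub>F t in at s within {0..}. X m t < y" using eventually_nonneg_time
  proof eventually_elim
    case (elim t)
    then obtain R' where "bounded_distribution (\<rho> t) R'" using bounded_dist by blast
    then interpret t: bounded_distribution "\<rho> t" R' .
    show ?case using elim assms t.quantile_le_upper_quantile[of m m] by force
  qed
qed

text \<open>Individual quantiles may jump in time, but at each time almost every label is one of
  continuity, so integrals over labels are continuous by dominated convergence. The parameter set
  \<open>Z\<close> covers both time alone and pairs of time and position.\<close>

lemma continuous_on_quantile_integral:
  fixes Z :: "'z::heine_borel set" and k :: "real \<Rightarrow> 'z \<Rightarrow> real"
  assumes \<tau>: "continuous_on Z \<tau>" "\<tau> ` Z \<subseteq> {0..}"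
    and k: "continuous_on (UNIV \<times> Z) (\<lambda>(x, z). k x z)"
    and g: "g \<in> borel_measurable labels" "\<And>m. \<bar>g m\<bar> \<le> B"
  shows "continuous_on Z (\<lambda>z. \<integral>m. g m * k (X m (\<tau> z)) z \<partial>labels)"
  unfolding continuous_on_sequentially
proof (intro allI ballI impI, elim conjE)
  fix z :: "nat \<Rightarrow> 'z" and a assume a: "a \<in> Z" and z: "\<forall>n. z n \<in> Z" "z \<longlonglongrightarrow> a"
  \<comment> \<open>A sequence together with its limit is compact. This bounds the times, hence the
    supports, hence \<open>k\<close> at all points that occur, and yields the dominating
    constant.\<close>
  define C where "C = insert a (range z)"
  have C: "compact C" "C \<subseteq> Z" "a \<in> C" "\<And>n. z n \<in> C"
    unfolding C_def using compact_sequence_with_limit[of z a] a z by auto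
  have "compact (\<tau> ` C)" using C \<tau> by (intro compact_continuous_image continuous_on_subset[OF \<tau>(1)])
  then obtain T where T: "\<And>c. c \<in> C \<Longrightarrow> \<bar>\<tau> c\<bar> \<le> T"
    using compact_imp_bounded bounded_iff by (metis (no_types, lifting) image_eqI real_norm_def)
  obtain R where R: "0 < R" "\<And>t. t \<in> {0..T} \<Longrightarrow> bounded_distribution (\<rho> t) R"
    using obtain_bound[of T] by blast
  have \<tau>T: "\<tau> c \<in> {0..T}" if "c \<in> C" for c
  proof -
    have "\<tau> c \<in> {0..}" using \<tau>(2) C(2) that by blast
    then show ?thesis using T[OF that] by simp
  qed
  have "compact ({-R..R} \<times> C)" using C by (intro compact_Times) auto
  then have "compact ((\<lambda>(x, z). k x z) ` ({-R..R} \<times> C))"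
    using C by (intro compact_continuous_image continuous_on_subset[OF k]) auto
  then obtain K where K: "\<And>x c. x \<in> {-R..R} \<Longrightarrow> c \<in> C \<Longrightarrow> \<bar>k x c\<bar> \<le> K"
  proof -
    obtain K where "\<forall>y\<in>(\<lambda>(x, z). k x z) ` ({-R..R} \<times> C). norm y \<le> K"
      using compact_imp_bounded[OF \<open>compact ((\<lambda>(x, z). k x z) ` ({-R..R} \<times> C))\<close>] unfolding bounded_iff by blast
    then have "\<bar>k x c\<bar> \<le> K" if "x \<in> {-R..R}" "c \<in> C" for x c using that by force
    with that show thesis by blast
  qed
  have km: "continuous_on UNIV (\<lambda>x. k x c)" if "c \<in> Z" for c
    using continuous_on_compose2[OF k, of UNIV "\<lambda>x. (x, c)"] that by (force intro: continuous_intros)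
  have meas: "(\<lambda>m. g m * k (X m (\<tau> c)) c) \<in> borel_measurable labels" if "c \<in> C" for c
  proof (intro borel_measurable_times g(1))
    interpret c: bounded_distribution "\<rho> (\<tau> c)" R using R \<tau>T that by blast
    have "(\<lambda>x. k x c) \<in> borel_measurable borel"
      using km C that by (intro borel_measurable_continuous_onI) auto
    from measurable_compose[OF c.measurable_quantile this]
    show "(\<lambda>m. k (X m (\<tau> c)) c) \<in> borel_measurable labels" .
  qed
  show "((\<lambda>z. \<integral>m. g m * k (X m (\<tau> z)) z \<partial>labels) \<circ> z) \<longlonglongrightarrow> (\<integral>m. g m * k (X m (\<tau> a)) a \<partial>labels)"
    unfolding o_def
  proof (rule integral_dominated_convergence[where w="\<lambda>_. B * K"])
    show "AE m in labels. (\<lambda>n. g m * k (X m (\<tau> (z n))) (z n)) \<longlonglongrightarrow> g m * k (X m (\<tau> a)) a"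
    proof -
      have ev: "\<tau> a \<ge> 0" using \<tau>T[OF C(3)] by simp
      have m: "AE m in labels. m \<in> {- 1/2<..1/2}" by (rule AE_I2) simp
      from AE_quantile_eq[OF ev] m show ?thesis
      proof eventually_elim
        case (elim m)
        have t: "(\<lambda>n. \<tau> (z n)) \<longlonglongrightarrow> \<tau> a"
          using \<tau>(1) a z unfolding continuous_on_sequentially o_def by blast
        have "((\<lambda>t. X m t) \<longlongrightarrow> X m (\<tau> a)) (at (\<tau> a) within {0..})"
          using ev elim by (intro quantile_tendsto) auto
        then have "continuous (at (\<tau> a) within {0..}) (\<lambda>t. X m t)" by (simp add: continuous_within)
        then have "(\<lambda>n. X m (\<tau> (z n))) \<longlonglongrightarrow> X m (\<tau> a)"
          using t \<tau>T C unfolding continuous_within_sequentially o_def by auto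
        then have "(\<lambda>n. (X m (\<tau> (z n)), z n)) \<longlonglongrightarrow> (X m (\<tau> a), a)"
          using z by (intro tendsto_Pair)
        moreover have "(X m (\<tau> a), a) \<in> UNIV \<times> Z" "\<forall>n. (X m (\<tau> (z n)), z n) \<in> UNIV \<times> Z"
          using a z(1) by auto
        ultimately have "(\<lambda>n. (\<lambda>(x, z). k x z) (X m (\<tau> (z n)), z n)) \<longlonglongrightarrow> (\<lambda>(x, z). k x z) (X m (\<tau> a), a)"
          by (intro k[unfolded continuous_on_sequentially o_def, rule_format] conjI) auto
        then have "(\<lambda>n. k (X m (\<tau> (z n))) (z n)) \<longlonglongrightarrow> k (X m (\<tau> a)) a" by simp
        then show ?case by (intro tendsto_intros)
      qed
    qed
    have b: "\<bar>g m * k (X m (\<tau> c)) c\<bar> \<le> B * K" if "c \<in> C" "m \<in> {- 1/2<..1/2}" for c m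
    proof -
      interpret c: bounded_distribution "\<rho> (\<tau> c)" R using R \<tau>T that by blast
      have "\<bar>k (X m (\<tau> c)) c\<bar> \<le> K" using c.quantile_bounds[OF that(2)] that by (intro K) auto
      moreover have "0 \<le> B" using g(2)[of m] by linarith
      ultimately show ?thesis unfolding abs_mult using g(2) by (intro mult_mono) auto
    qed
    show "AE m in labels. norm (g m * k (X m (\<tau> (z n))) (z n)) \<le> B * K" for n
      by (rule AE_I2) (use b[OF C(4)] in simp)
  qed (use meas C in auto)
qed

lemma
  assumes "0 \<le> t"
  shows potential_conv_eq: "potential_conv \<phi> (\<rho> t) x = (\<integral>m. potential \<phi> (x - X m t) \<partial>labels)"
    and potential_conv_mono: "x \<le> y \<Longrightarrow> potential_conv \<phi> (\<rho> t) x \<le> potential_conv \<phi> (\<rho> t) y"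
    and integrable_potential: "integrable labels (\<lambda>m. potential \<phi> (x - X m t))"
proof -
  obtain R where "bounded_distribution (\<rho> t) R" using bounded_dist assms by blast
  note q = potential_quantile[OF this]
  show "potential_conv \<phi> (\<rho> t) x = (\<integral>m. potential \<phi> (x - X m t) \<partial>labels)" by (rule q(1))
  show "x \<le> y \<Longrightarrow> potential_conv \<phi> (\<rho> t) x \<le> potential_conv \<phi> (\<rho> t) y" by (rule monoD[OF q(5)])
  show "integrable labels (\<lambda>m. potential \<phi> (x - X m t))" by (rule q(4))
qed

lemma continuous_potential_conv:
  "continuous_on ({0..} \<times> UNIV) (\<lambda>(t, x). potential_conv \<phi> (\<rho> t) x)"
proof -
  have "continuous_on ({0..} \<times> UNIV) (\<lambda>z. \<integral>m. 1 * potential \<phi> (snd z - X m (fst z)) \<partial>labels)"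
    by (rule continuous_on_quantile_integral[where B=1])
      (auto intro!: continuous_intros continuous_on_compose2[OF continuous_potential] simp: case_prod_unfold)
  moreover have "(\<integral>m. 1 * potential \<phi> (snd z - X m (fst z)) \<partial>labels) = (\<lambda>(t, x). potential_conv \<phi> (\<rho> t) x) z"
    if "z \<in> {0..} \<times> UNIV" for z using that by (auto simp: potential_conv_eq)
  ultimately show ?thesis by (simp cong: continuous_on_cong)
qed

end

section \<open>The entropy inequality in quantile variables\<close>

lemma integrable_continuous_Icc:
  fixes f :: "real \<Rightarrow> real"
  assumes "continuous_on {a..b} f" "\<And>x. x \<notin> {a..b} \<Longrightarrow> f x = 0"
  shows "integrable lborel f"
proof -
  have "set_integrable lborel {a..b} f"
    using borel_integrable_atLeastAtMost'[OF assms(1)] .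
  moreover have "(\<lambda>x. indicator {a..b} x *\<^sub>R f x) = f" using assms(2) by (auto simp: indicator_def fun_eq_iff)
  ultimately show ?thesis by (simp add: set_integrable_def)
qed

lemma continuous_bounded_Icc:
  fixes f :: "real \<Rightarrow> real"
  assumes "continuous_on UNIV f"
  obtains B where "\<And>x. x \<in> {a..b} \<Longrightarrow> \<bar>f x\<bar> \<le> B"
proof -
  have "compact (f ` {a..b})"
    by (intro compact_continuous_image continuous_on_subset[OF assms]) auto
  from compact_imp_bounded[OF this] obtain B where "\<forall>y\<in>f ` {a..b}. norm y \<le> B"
    unfolding bounded_iff by blast
  then have "\<bar>f x\<bar> \<le> B" if "x \<in> {a..b}" for x using that by simp
  with that show thesis .
qed

context bounded_distribution
begin

text \<open>An increment of \<open>A\<close> is the integral of \<open>\<psi>\<close> over the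
  labels in between; the sign makes it count positively in both orders. Written with an indicator in
  \<open>m\<close> and \<open>x\<close>, it is ready for Fubini.\<close>

lemma layer_representation:
  fixes \<psi> A :: "real \<Rightarrow> real"
  assumes \<psi>: "\<psi> \<in> borel_measurable labels" "\<And>m. \<bar>\<psi> m\<bar> \<le> K"
    and A: "\<And>u. u \<in> {- 1/2..1/2} \<Longrightarrow> A u = (\<integral>m. indicator {..u} m * \<psi> m \<partial>labels)"
    and \<alpha>: "\<alpha> \<in> {- 1/2..1/2}"
  shows "sgn (centered_cdf \<mu> x - \<alpha>) * (A (centered_cdf \<mu> x) - A \<alpha>) =
    (\<integral>m. \<psi> m * of_bool (\<alpha> < m \<and> m \<le> centered_cdf \<mu> x \<or> m \<le> \<alpha> \<and> centered_cdf \<mu> x < m) \<partial>labels)"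
proof -
  let ?u = "centered_cdf \<mu> x"
  have int: "integrable labels (\<lambda>m. indicator {..u} m * \<psi> m)" for u
  proof (rule labels.integrable_bounded[where B=K])
    show "(\<lambda>m. indicator {..u} m * \<psi> m) \<in> borel_measurable labels"
      by (intro borel_measurable_times[OF measurable_labelsI] \<psi>(1)) auto
    show "\<bar>indicator {..u} m * \<psi> m\<bar> \<le> K" for m
      using \<psi>(2)[of m] by (auto simp: indicator_def)
  qed
  have d: "A ?u - A \<alpha> = (\<integral>m. indicator {..?u} m * \<psi> m - indicator {..\<alpha>} m * \<psi> m \<partial>labels)"
    using \<alpha> ccdf_bounds[of x] by (subst A, simp, subst A, simp, subst Bochner_Integration.integral_diff) (auto intro: int)
  consider "\<alpha> < ?u" | "?u < \<alpha>" | "?u = \<alpha>" by linarith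
  then show ?thesis
  proof cases
    case 1
    then show ?thesis unfolding d
      by (auto simp: sgn_if indicator_def intro!: Bochner_Integration.integral_cong)
  next
    case 2
    then show ?thesis unfolding d
      by (auto simp: sgn_if indicator_def integral_minus[symmetric] simp del: integral_minus intro!: Bochner_Integration.integral_cong)
  next
    case 3
    then have "(\<integral>m. \<psi> m * of_bool (\<alpha> < m \<and> m \<le> ?u \<or> m \<le> \<alpha> \<and> ?u < m) \<partial>labels) = (\<integral>m. 0 \<partial>labels)"
      by (intro Bochner_Integration.integral_cong) auto
    then show ?thesis using 3 by simp
  qed
qed

text \<open>Fubini: for a fixed label the relevant points \<open>x\<close> form a half-line ending
  at its quantile, cut off where \<open>g\<close> vanishes. Integrating \<open>g\<close> over it
  gives an increment of \<open>G\<close>, which moves the quantile into the argument of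
  \<open>G\<close>.\<close>

lemma flux_integral:
  fixes \<psi> A g G :: "real \<Rightarrow> real"
  assumes \<psi>: "\<psi> \<in> borel_measurable labels" "\<And>m. \<bar>\<psi> m\<bar> \<le> K"
    and A: "\<And>u. u \<in> {- 1/2..1/2} \<Longrightarrow> A u = (\<integral>m. indicator {..u} m * \<psi> m \<partial>labels)"
    and \<alpha>: "\<alpha> \<in> {- 1/2..1/2}"
    and g: "continuous_on UNIV g" "\<And>x. L \<le> \<bar>x\<bar> \<Longrightarrow> g x = 0" and L: "R \<le> L" "0 \<le> L"
    and G: "\<And>x. (G has_real_derivative g x) (at x)"
  shows "(LBINT x. sgn (centered_cdf \<mu> x - \<alpha>) * (A (centered_cdf \<mu> x) - A \<alpha>) * g x) =
     (\<integral>m. \<psi> m * (if \<alpha> < m then G L - G (quantile \<mu> m) else G (quantile \<mu> m) - G (- L)) \<partial>labels)"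
    and "integrable lborel (\<lambda>x. sgn (centered_cdf \<mu> x - \<alpha>) * (A (centered_cdf \<mu> x) - A \<alpha>) * g x)"
proof -
  define J :: "real \<Rightarrow> real \<Rightarrow> real" where
    "J m x = of_bool (\<alpha> < m \<and> m \<le> centered_cdf \<mu> x \<or> m \<le> \<alpha> \<and> centered_cdf \<mu> x < m)" for m x
  have id [measurable]: "(\<lambda>m. m) \<in> borel_measurable labels" by (intro measurable_labelsI) simp
  note \<psi>(1)[measurable]
  have gm [measurable]: "g \<in> borel_measurable borel" using g(1) by (rule borel_measurable_continuous_onI)
  have [measurable]: "(\<lambda>p. fst p) \<in> borel_measurable (labels \<Otimes>\<^sub>M lborel)"
    by (rule measurable_compose[OF measurable_fst id])
  have [measurable]: "(\<lambda>p. \<psi> (fst p)) \<in> borel_measurable (labels \<Otimes>\<^sub>M lborel)"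
    by (rule measurable_compose[OF measurable_fst \<psi>(1)])
  have [measurable]: "(\<lambda>p. centered_cdf \<mu> (snd p)) \<in> borel_measurable (labels \<Otimes>\<^sub>M lborel)"
    by (rule measurable_compose[OF measurable_snd]) simp
  have [measurable]: "(\<lambda>p. g (snd p)) \<in> borel_measurable (labels \<Otimes>\<^sub>M lborel)"
    by (rule measurable_compose[OF measurable_snd]) simp
  obtain B where B: "\<And>x. x \<in> {-L..L} \<Longrightarrow> \<bar>g x\<bar> \<le> B"
    using continuous_bounded_Icc[OF g(1)] by blast
  have int: "integrable (labels \<Otimes>\<^sub>M lborel) (\<lambda>p. \<psi> (fst p) * J (fst p) (snd p) * g (snd p))"
  proof (rule Bochner_Integration.integrable_bound)
    have "emeasure (labels \<Otimes>\<^sub>M lborel) (space labels \<times> {-L..L}) = emeasure labels (space labels) * emeasure lborel {-L..L}"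
      by (rule lborel.emeasure_pair_measure_Times) (auto simp del: space_labels)
    also have "\<dots> < \<infinity>" using L by (simp del: space_labels add: labels.emeasure_space_1 flip: ennreal_mult)
    finally show "integrable (labels \<Otimes>\<^sub>M lborel) (\<lambda>p. indicator (space labels \<times> {-L..L}) p * (K * B))"
      by (intro integrable_mult_left integrable_real_indicator) (auto simp del: space_labels)
    show "(\<lambda>p. \<psi> (fst p) * J (fst p) (snd p) * g (snd p)) \<in> borel_measurable (labels \<Otimes>\<^sub>M lborel)"
      unfolding J_def by measurable
    show "AE p in labels \<Otimes>\<^sub>M lborel. norm (\<psi> (fst p) * J (fst p) (snd p) * g (snd p)) \<le>
       norm (indicator (space labels \<times> {-L..L}) p * (K * B))"
    proof (rule AE_I2)
      fix p :: "real \<times> real" assume p: "p \<in> space (labels \<Otimes>\<^sub>M lborel)"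
      show "norm (\<psi> (fst p) * J (fst p) (snd p) * g (snd p)) \<le>
       norm (indicator (space labels \<times> {-L..L}) p * (K * B))"
      proof (cases "snd p \<in> {-L..L}")
        case True
        have nn: "0 \<le> K" "0 \<le> B" using \<psi>(2)[of 0] B[OF True] by linarith+
        have "\<bar>\<psi> (fst p) * J (fst p) (snd p)\<bar> * \<bar>g (snd p)\<bar> \<le> K * B"
          using nn \<psi>(2)[of "fst p"] B[OF True] by (intro mult_mono) (auto simp: J_def)
        then show ?thesis using True p nn by (auto simp: indicator_def space_pair_measure abs_mult)
      next
        case False
        then have "g (snd p) = 0" by (intro g(2)) auto
        then show ?thesis by simp
      qed
    qed
  qed
  interpret pair_sigma_finite labels lborel by unfold_locales
  have eq: "sgn (centered_cdf \<mu> x - \<alpha>) * (A (centered_cdf \<mu> x) - A \<alpha>) * g x = (\<integral>m. \<psi> m * J m x * g x \<partial>labels)" for x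
    using layer_representation[OF \<psi> A \<alpha>, of x] by (simp add: J_def)
  have int': "integrable (labels \<Otimes>\<^sub>M lborel) (\<lambda>(m, x). \<psi> m * J m x * g x)"
    using int by (simp add: case_prod_unfold)
  show "integrable lborel (\<lambda>x. sgn (centered_cdf \<mu> x - \<alpha>) * (A (centered_cdf \<mu> x) - A \<alpha>) * g x)"
    unfolding eq using integrable_snd[OF int'] by simp
  have "(LBINT x. sgn (centered_cdf \<mu> x - \<alpha>) * (A (centered_cdf \<mu> x) - A \<alpha>) * g x) =
      (\<integral>m. (LBINT x. \<psi> m * J m x * g x) \<partial>labels)"
    unfolding eq using Fubini_integral[OF int'] by simp
  also have "\<dots> = (\<integral>m. \<psi> m * (if \<alpha> < m then G L - G (quantile \<mu> m) else G (quantile \<mu> m) - G (- L)) \<partial>labels)"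
  proof (rule Bochner_Integration.integral_cong[OF refl])
    fix m assume "m \<in> space labels"
    then have m: "m \<in> {- 1/2<..1/2}" by simp
    have ftc: "a \<le> b \<Longrightarrow> (LBINT x. g x * indicator {a..b} x) = G b - G a" for a b
      using g(1) G by (intro integral_FTC_Icc_real) (auto simp: continuous_on_eq_continuous_at)
    note q = quantile_bounds[OF m]
    have "(LBINT x. J m x * g x) = (if \<alpha> < m then G L - G (quantile \<mu> m) else G (quantile \<mu> m) - G (- L))"
    proof (cases "\<alpha> < m")
      case True
      have "(LBINT x. J m x * g x) = (LBINT x. g x * indicator {quantile \<mu> m..L} x)"
      proof (rule Bochner_Integration.integral_cong[OF refl])
        fix x
        show "J m x * g x = g x * indicator {quantile \<mu> m..L} x"
          using True quantile_le_iff[OF m, of x] g(2)[of x] by (cases "L \<le> \<bar>x\<bar>") (auto simp: J_def indicator_def)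
      qed
      then show ?thesis using True ftc[of "quantile \<mu> m" L] q L by simp
    next
      case False
      have "(LBINT x. J m x * g x) = (LBINT x. g x * indicator {- L..quantile \<mu> m} x)"
      proof (rule integral_cong_AE)
        \<comment> \<open>Here the points are those strictly left of the quantile, so the closed
          interval differs by one point.\<close>
        have "AE x in lborel. x \<noteq> quantile \<mu> m" by (rule AE_lborel_singleton)
        then show "AE x in lborel. J m x * g x = g x * indicator {- L..quantile \<mu> m} x"
        proof eventually_elim
          case (elim x)
          then show ?case
            using False less_quantile_iff[OF m, of x] g(2)[of x] by (cases "L \<le> \<bar>x\<bar>") (auto simp: J_def indicator_def)
        qed
      qed (auto simp: J_def)
      then show ?thesis using False ftc[of "- L" "quantile \<mu> m"] q L by simp
    qed
    then show "(LBINT x. \<psi> m * J m x * g x) = \<psi> m * (if \<alpha> < m then G L - G (quantile \<mu> m) else G (quantile \<mu> m) - G (- L))"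
      by (simp add: mult.assoc)
  qed
  finally show "(LBINT x. sgn (centered_cdf \<mu> x - \<alpha>) * (A (centered_cdf \<mu> x) - A \<alpha>) * g x) =
     (\<integral>m. \<psi> m * (if \<alpha> < m then G L - G (quantile \<mu> m) else G (quantile \<mu> m) - G (- L)) \<partial>labels)" .
qed

lemma integral_indicator_labels:
  fixes u :: real
  shows "u \<in> {- 1/2..1/2} \<Longrightarrow> (\<integral>m. indicator {..u} m * 1 \<partial>labels) = (u + 1/2 :: real)"
proof -
  assume u: "u \<in> {- 1/2..1/2}"
  have "(\<integral>m. indicator {..u} m * 1 \<partial>labels :: real) = (LBINT m. indicator {- 1/2<..1/2} m *\<^sub>R (indicator {..u} m * 1))"
    unfolding integral_labels set_lebesgue_integral_def ..
  also have "\<dots> = (LBINT m. indicator {- 1/2<..u} m)"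
    using u by (intro Bochner_Integration.integral_cong) (auto simp: indicator_def)
  also have "\<dots> = u + 1/2" using u by simp
  finally show ?thesis .
qed

text \<open>The special case of the flux with density 1, for which the sign times the increment is
  the absolute value.\<close>

lemma abs_integral:
  fixes g G :: "real \<Rightarrow> real"
  assumes \<alpha>: "\<alpha> \<in> {- 1/2..1/2}"
    and g: "continuous_on UNIV g" "\<And>x. L \<le> \<bar>x\<bar> \<Longrightarrow> g x = 0" and L: "R \<le> L" "0 \<le> L"
    and G: "\<And>x. (G has_real_derivative g x) (at x)"
  shows "(LBINT x. \<bar>centered_cdf \<mu> x - \<alpha>\<bar> * g x) =
     (\<integral>m. (if \<alpha> < m then G L - G (quantile \<mu> m) else G (quantile \<mu> m) - G (- L)) \<partial>labels)"
    and "integrable lborel (\<lambda>x. \<bar>centered_cdf \<mu> x - \<alpha>\<bar> * g x)"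
proof -
  have A: "u + 1/2 = (\<integral>m. indicator {..u} m * 1 \<partial>labels)" if "u \<in> {- 1/2..1/2}" for u
    using integral_indicator_labels[OF that] by simp
  have "sgn (u - \<alpha>) * ((u + 1/2) - (\<alpha> + 1/2)) = \<bar>u - \<alpha>\<bar>" for u by (simp add: sgn_if)
  with flux_integral[of "\<lambda>_. 1" 1 "\<lambda>u. u + 1/2", OF _ _ A \<alpha> g L G]
  show "(LBINT x. \<bar>centered_cdf \<mu> x - \<alpha>\<bar> * g x) =
     (\<integral>m. (if \<alpha> < m then G L - G (quantile \<mu> m) else G (quantile \<mu> m) - G (- L)) \<partial>labels)"
    "integrable lborel (\<lambda>x. \<bar>centered_cdf \<mu> x - \<alpha>\<bar> * g x)" by simp_all
qed

end

text \<open>\<open>\<psi>\<close> is bounded at every label and not just almost everywhere, which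
  keeps null sets out of the estimates; \<open>flux_density\<close> arranges it by
  truncation.\<close>

locale flow = curve +
  fixes M :: "real \<Rightarrow> real \<Rightarrow> real" and A \<psi> :: "real \<Rightarrow> real" and K :: real
  assumes M_eq: "0 \<le> t \<Longrightarrow> M x t = centered_cdf (\<rho> t) x"
    and \<psi>_measurable: "\<psi> \<in> borel_measurable labels"
    and \<psi>_bounded: "\<bar>\<psi> m\<bar> \<le> K"
    and A_eq: "u \<in> {- 1/2..1/2} \<Longrightarrow> A u = (\<integral>m. indicator {..u} m * \<psi> m \<partial>labels)"
    and entropy: "\<alpha> \<in> {- 1/2..1/2} \<Longrightarrow> entropy_inequality \<phi> A \<rho> M \<alpha>"
begin

abbreviation pc where "pc x t \<equiv> potential_conv \<phi> (\<rho> t) x"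

text \<open>The value at \<alpha> itself is -1 and not 0, so that for levels \<alpha> and 1/2, or
  \<alpha> and -1/2, the sum is exactly -2 or 2 times an indicator on the whole label
  interval.\<close>

definition side :: "real \<Rightarrow> real \<Rightarrow> real" where
  "side \<alpha> m = (if \<alpha> < m then 1 else - 1)"

lemma side_measurable: "side \<alpha> \<in> borel_measurable labels"
  unfolding side_def[abs_def] by (intro measurable_labelsI) measurable

lemma side_abs: "\<bar>side \<alpha> m\<bar> \<le> 1"
  by (simp add: side_def)

lemma integrable_quantile:
  fixes g k :: "real \<Rightarrow> real"
  assumes "0 \<le> t" "g \<in> borel_measurable labels" "\<And>m. \<bar>g m\<bar> \<le> B" "continuous_on UNIV k"
  shows "integrable labels (\<lambda>m. g m * k (X m t))"
proof -
  obtain R where "bounded_distribution (\<rho> t) R" using bounded_dist assms by blast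
  then interpret t: bounded_distribution "\<rho> t" R .
  obtain C where C: "\<And>x. x \<in> {-R..R} \<Longrightarrow> \<bar>k x\<bar> \<le> C"
    using continuous_bounded_Icc[OF assms(4)] by blast
  show ?thesis
  proof (rule labels.integrable_bounded[where B="B * C"])
    show "(\<lambda>m. g m * k (X m t)) \<in> borel_measurable labels"
      by (intro borel_measurable_times assms(2) measurable_compose[OF t.measurable_quantile]
        borel_measurable_continuous_onI assms(4))
    fix m assume "m \<in> space labels"
    then have "m \<in> {- 1/2<..1/2}" by simp
    note q = t.quantile_bounds[OF this]
    have "0 \<le> B" using assms(3)[of m] by linarith
    then show "\<bar>g m * k (X m t)\<bar> \<le> B * C"
      unfolding abs_mult using assms(3)[of m] C[of "X m t"] q by (intro mult_mono) auto
  qed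
qed

lemma continuous_pc: "0 \<le> t \<Longrightarrow> continuous_on UNIV (\<lambda>x. pc x t)"
  using continuous_on_compose2[OF continuous_potential_conv, of UNIV "\<lambda>x. (t, x)"]
  by (simp add: continuous_on_Pair image_subset_iff)

text \<open>The space integrals at one time: \<open>e\<close> and \<open>h\<close> stand for the
  values of the time cutoff and its derivative, \<open>q\<close> for the position of the moving
  frame. The integral without a quantile comes from the constant values of \<Theta> at both ends; it
  does not depend on time.\<close>

lemma entropy_space_integrals:
  assumes t: "0 \<le> t" and \<alpha>: "\<alpha> \<in> {- 1/2..1/2}"
    and \<theta>: "continuous_on UNIV \<theta>" "\<And>z. S \<le> \<bar>z\<bar> \<Longrightarrow> \<theta> z = 0" "\<And>z. S \<le> \<bar>z\<bar> \<Longrightarrow> \<theta>' z = 0" "0 \<le> S"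
    and d: "\<And>x. (\<Theta> has_real_derivative \<theta> x) (at x)" "\<And>x. (\<theta> has_real_derivative \<theta>' x) (at x)" 
      "continuous_on UNIV \<theta>'"
  shows "(LBINT x. \<bar>M x t - \<alpha>\<bar> * (h * \<theta> (x - q) - v * e * \<theta>' (x - q)) +
      sgn (M x t - \<alpha>) * (A (M x t) - A \<alpha>) * (e * \<theta>' (x - q))) =
    h * ((\<integral>m. (if \<alpha> < m then \<Theta> S else - \<Theta> (- S)) \<partial>labels) - (\<integral>m. side \<alpha> m * \<Theta> (X m t - q) \<partial>labels)) +
    e * (\<integral>m. side \<alpha> m * (v - \<psi> m) * \<theta> (X m t - q) \<partial>labels)" (is "?L = ?R")
    and "integral_d_abs (\<lambda>x. M x t) \<alpha> (\<lambda>x. e * \<theta> (x - q) * pc x t) =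
      e * (\<integral>m. side \<alpha> m * (\<theta> (X m t - q) * pc (X m t) t) \<partial>labels)"
proof -
  obtain R where "bounded_distribution (\<rho> t) R" using bounded_dist assms by blast
  then interpret t: bounded_distribution "\<rho> t" R .
  \<comment> \<open>Large enough for [-L, L] to contain the support of \<open>\<rho> t\<close> and
    that of the shifted test function.\<close>
  define L where "L = max \<bar>R\<bar> (\<bar>q\<bar> + S)"
  have L: "R \<le> L" "0 \<le> L" by (auto simp: L_def)
  have far: "S \<le> \<bar>x - q\<bar>" if "L \<le> \<bar>x\<bar>" for x using that by (auto simp: L_def)
  have M: "M x t = centered_cdf (\<rho> t) x" for x using M_eq t .
  have c: "continuous_on UNIV (\<lambda>x. f (x - q))" if "continuous_on UNIV f" for f :: "real \<Rightarrow> real"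
    by (intro continuous_on_compose2[OF that] continuous_intros) auto
  have dd: "((\<lambda>x. f (x - q)) has_real_derivative f' (x - q)) (at x)"
    if "\<And>x. (f has_real_derivative f' x) (at x)" for f f' x
    using DERIV_chain2[OF that DERIV_diff[OF DERIV_ident DERIV_const], of q x] by simp
  have \<Theta>c: "\<Theta> z = \<Theta> S" if "S \<le> z" for z
  proof (cases "S < z")
    case True
    show ?thesis
    proof (rule DERIV_isconst_end[OF True])
      show "continuous_on {S..z} \<Theta>" using d(1) by (intro continuous_at_imp_continuous_on ballI DERIV_isCont)
      show "(\<Theta> has_real_derivative 0) (at x)" if "S < x" "x < z" for x using d(1)[of x] \<theta>(2)[of x] that by simp
    qed
  qed (use that in auto)
  have \<Theta>c': "\<Theta> z = \<Theta> (- S)" if "z \<le> - S" for z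
  proof (cases "z < - S")
    case True
    have "\<Theta> (- S) = \<Theta> z"
    proof (rule DERIV_isconst_end[OF True])
      show "continuous_on {z..- S} \<Theta>" using d(1) by (intro continuous_at_imp_continuous_on ballI DERIV_isCont)
      show "(\<Theta> has_real_derivative 0) (at x)" if "z < x" "x < - S" for x using d(1)[of x] \<theta>(2)[of x] that by simp
    qed
    then show ?thesis by simp
  qed (use that in auto)
  have ends: "\<Theta> (L - q) = \<Theta> S" "\<Theta> (- L - q) = \<Theta> (- S)" "\<theta> (L - q) = 0" "\<theta> (- L - q) = 0"
    by (intro \<Theta>c \<Theta>c' \<theta>(2); auto simp: L_def)+
  have \<Theta>cont: "continuous_on UNIV \<Theta>" using d(1) by (intro continuous_at_imp_continuous_on ballI DERIV_isCont)
  note 1 = t.abs_integral[OF \<alpha> c[OF \<theta>(1)] \<theta>(2)[OF far] L dd[OF d(1)]]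
  note 2 = t.abs_integral[OF \<alpha> c[OF d(3)] \<theta>(3)[OF far] L dd[OF d(2)]]
  note 3 = t.flux_integral[OF \<psi>_measurable \<psi>_bounded A_eq \<alpha> c[OF d(3)] \<theta>(3)[OF far] L dd[OF d(2)]]
  note int = integrable_quantile[OF t]
  have e1: "(LBINT x. \<bar>M x t - \<alpha>\<bar> * \<theta> (x - q)) =
     (\<integral>m. (if \<alpha> < m then \<Theta> (L - q) - \<Theta> (X m t - q) else \<Theta> (X m t - q) - \<Theta> (- L - q)) \<partial>labels)"
    unfolding M by (rule 1(1))
  have e2: "(LBINT x. \<bar>M x t - \<alpha>\<bar> * \<theta>' (x - q)) =
     (\<integral>m. (if \<alpha> < m then \<theta> (L - q) - \<theta> (X m t - q) else \<theta> (X m t - q) - \<theta> (- L - q)) \<partial>labels)"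
    unfolding M by (rule 2(1))
  have e3: "(LBINT x. sgn (M x t - \<alpha>) * (A (M x t) - A \<alpha>) * \<theta>' (x - q)) =
     (\<integral>m. \<psi> m * (if \<alpha> < m then \<theta> (L - q) - \<theta> (X m t - q) else \<theta> (X m t - q) - \<theta> (- L - q)) \<partial>labels)"
    unfolding M by (rule 3(1))
  have "?L = (LBINT x. h * (\<bar>M x t - \<alpha>\<bar> * \<theta> (x - q)) - v * e * (\<bar>M x t - \<alpha>\<bar> * \<theta>' (x - q)) +
      e * (sgn (M x t - \<alpha>) * (A (M x t) - A \<alpha>) * \<theta>' (x - q)))"
    by (intro Bochner_Integration.integral_cong) (auto simp: algebra_simps)
  also have "\<dots> = h * (LBINT x. \<bar>M x t - \<alpha>\<bar> * \<theta> (x - q)) - v * e * (LBINT x. \<bar>M x t - \<alpha>\<bar> * \<theta>' (x - q)) +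
      e * (LBINT x. sgn (M x t - \<alpha>) * (A (M x t) - A \<alpha>) * \<theta>' (x - q))"
    unfolding M using 1(2) 2(2) 3(2) by simp
  also have "(LBINT x. \<bar>M x t - \<alpha>\<bar> * \<theta> (x - q)) =
      (\<integral>m. (if \<alpha> < m then \<Theta> S else - \<Theta> (- S)) - side \<alpha> m * \<Theta> (X m t - q) \<partial>labels)"
    unfolding e1 ends by (intro Bochner_Integration.integral_cong) (auto simp: side_def)
  also have "\<dots> = (\<integral>m. (if \<alpha> < m then \<Theta> S else - \<Theta> (- S)) \<partial>labels) - (\<integral>m. side \<alpha> m * \<Theta> (X m t - q) \<partial>labels)"
  proof (rule Bochner_Integration.integral_diff)
    show "integrable labels (\<lambda>m. if \<alpha> < m then \<Theta> S else - \<Theta> (- S))"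
      by (intro labels.integrable_bounded[where B="\<bar>\<Theta> S\<bar> + \<bar>\<Theta> (- S)\<bar>"] measurable_labelsI) auto
    show "integrable labels (\<lambda>m. side \<alpha> m * \<Theta> (X m t - q))"
      by (rule int[OF side_measurable side_abs c[OF \<Theta>cont]])
  qed
  also have "(LBINT x. \<bar>M x t - \<alpha>\<bar> * \<theta>' (x - q)) = (\<integral>m. - (side \<alpha> m * \<theta> (X m t - q)) \<partial>labels)"
    unfolding e2 ends by (intro Bochner_Integration.integral_cong) (auto simp: side_def)
  also have "(LBINT x. sgn (M x t - \<alpha>) * (A (M x t) - A \<alpha>) * \<theta>' (x - q)) =
      (\<integral>m. - (side \<alpha> m * \<psi> m * \<theta> (X m t - q)) \<partial>labels)"
    unfolding e3 ends by (intro Bochner_Integration.integral_cong) (auto simp: side_def)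
  also have "h * ((\<integral>m. (if \<alpha> < m then \<Theta> S else - \<Theta> (- S)) \<partial>labels) - (\<integral>m. side \<alpha> m * \<Theta> (X m t - q) \<partial>labels)) -
      v * e * (\<integral>m. - (side \<alpha> m * \<theta> (X m t - q)) \<partial>labels) + e * (\<integral>m. - (side \<alpha> m * \<psi> m * \<theta> (X m t - q)) \<partial>labels) = ?R"
  proof -
    have i1: "integrable labels (\<lambda>m. side \<alpha> m * \<theta> (X m t - q))"
      by (rule int[OF side_measurable side_abs c[OF \<theta>(1)]])
    have i2: "integrable labels (\<lambda>m. side \<alpha> m * \<psi> m * \<theta> (X m t - q))"
    proof (rule int[OF _ _ c[OF \<theta>(1)]])
      show "(\<lambda>m. side \<alpha> m * \<psi> m) \<in> borel_measurable labels"
        by (intro borel_measurable_times side_measurable \<psi>_measurable)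
      show "\<bar>side \<alpha> m * \<psi> m\<bar> \<le> K" for m using \<psi>_bounded[of m] by (simp add: side_def)
    qed
    have "(\<integral>m. side \<alpha> m * (v - \<psi> m) * \<theta> (X m t - q) \<partial>labels) =
        (\<integral>m. v * (side \<alpha> m * \<theta> (X m t - q)) - side \<alpha> m * \<psi> m * \<theta> (X m t - q) \<partial>labels)"
      by (intro Bochner_Integration.integral_cong) (auto simp: algebra_simps)
    also have "\<dots> = v * (\<integral>m. side \<alpha> m * \<theta> (X m t - q) \<partial>labels) - (\<integral>m. side \<alpha> m * \<psi> m * \<theta> (X m t - q) \<partial>labels)"
      using i1 i2 by simp
    finally show ?thesis by (simp add: right_diff_distrib)
  qed
  finally show "?L = ?R" .

  have "continuous_on UNIV (\<lambda>x. e * \<theta> (x - q) * pc x t)"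
    by (intro continuous_intros c[OF \<theta>(1)] continuous_pc[OF t])
  from continuous_bounded_Icc[OF this]
  obtain C where C: "\<And>x. x \<in> {-L..L} \<Longrightarrow> \<bar>e * \<theta> (x - q) * pc x t\<bar> \<le> C" by blast
  have C': "\<bar>e * \<theta> (x - q) * pc x t\<bar> \<le> C" for x
  proof (cases "x \<in> {-L..L}")
    case False
    then have "\<theta> (x - q) = 0" by (intro \<theta>(2) far) auto
    then show ?thesis using C[of 0] L by simp
  qed (rule C)
  have "(\<lambda>x. e * \<theta> (x - q) * pc x t) \<in> borel_measurable borel"
    by (intro borel_measurable_continuous_onI continuous_intros c[OF \<theta>(1)] continuous_pc[OF t])
  from t.integral_d_abs_quantile[OF this C' \<alpha>]
  have "integral_d_abs (\<lambda>x. M x t) \<alpha> (\<lambda>x. e * \<theta> (x - q) * pc x t) =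
    (\<integral>m. side \<alpha> m * (e * \<theta> (X m t - q) * pc (X m t) t) \<partial>labels)"
    unfolding M side_def by simp
  also have "\<dots> = (\<integral>m. e * (side \<alpha> m * (\<theta> (X m t - q) * pc (X m t) t)) \<partial>labels)"
    by (intro Bochner_Integration.integral_cong) auto
  finally show "integral_d_abs (\<lambda>x. M x t) \<alpha> (\<lambda>x. e * \<theta> (x - q) * pc x t) =
      e * (\<integral>m. side \<alpha> m * (\<theta> (X m t - q) * pc (X m t) t) \<partial>labels)" by simp
qed

end

section \<open>Monotonicity of label integrals in time\<close>

context flow
begin

text \<open>The sum of the sign functions of two levels, one of them \<open>\<plusminus> 1/2\<close>, is supported on the labels above or below
  the other level.\<close>

lemma evolution_mono_pos:
  fixes \<theta> \<Theta> :: "real \<Rightarrow> real"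
  assumes \<alpha>: "\<alpha> \<in> {- 1/2..1/2}" and \<beta>: "\<beta> \<in> {- 1/2..1/2}"
    and \<theta>: "smooth \<theta>" "\<And>z. 0 \<le> \<theta> z" "\<And>z. S \<le> \<bar>z\<bar> \<Longrightarrow> \<theta> z = 0"
    and \<Theta>: "\<And>x. (\<Theta> has_real_derivative \<theta> x) (at x)"
    and t: "0 < t0" "t0 < t1"
    and D: "\<And>t. t \<in> {t0..t1} \<Longrightarrow>
      0 \<le> (\<integral>m. (side \<alpha> m + side \<beta> m) * (\<psi> m - v - pc (X m t) t) * \<theta> (X m t - (v * t + w)) \<partial>labels)"
  shows "(\<integral>m. (side \<alpha> m + side \<beta> m) * \<Theta> (X m t0 - (v * t0 + w)) \<partial>labels) \<le>
         (\<integral>m. (side \<alpha> m + side \<beta> m) * \<Theta> (X m t1 - (v * t1 + w)) \<partial>labels)"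
proof -
  define q where "q t = v * t + w" for t
  have qq: "x - v * t - w = x - q t" for x t by (simp add: q_def)
  define F where "F \<gamma> t = (\<integral>m. side \<gamma> m * \<Theta> (X m t - q t) \<partial>labels)" for \<gamma> t
  define P where "P \<gamma> t = (\<integral>m. side \<gamma> m * (v - \<psi> m) * \<theta> (X m t - q t) \<partial>labels)" for \<gamma> t
  define Q where "Q \<gamma> t = (\<integral>m. side \<gamma> m * (\<theta> (X m t - q t) * pc (X m t) t) \<partial>labels)" for \<gamma> t
  \<comment> \<open>One unit of room beyond \<open>S\<close> makes \<theta> vanish near every point
    with |z| at least \<open>S'\<close>, so that its derivative vanishes there as well.\<close>
  define S' where "S' = \<bar>S\<bar> + 1"
  define C where "C \<gamma> = (\<integral>m. (if \<gamma> < m then \<Theta> S' else - \<Theta> (- S')) \<partial>labels)" for \<gamma>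
  obtain \<theta>' where \<theta>': "\<And>x. (\<theta> has_real_derivative \<theta>' x) (at x)" "smooth \<theta>'"
    using smooth_has_derivative[OF \<theta>(1)] by blast
  have \<theta>0: "\<theta> z = 0" if "S' \<le> \<bar>z\<bar>" for z using that by (intro \<theta>(3)) (simp add: S'_def)
  have \<theta>'0: "\<theta>' z = 0" if "S' \<le> \<bar>z\<bar>" for z
  proof -
    have "\<forall>\<^sub>F y in nhds z. \<theta> y = 0"
      unfolding eventually_nhds_metric using that
      by (intro exI[of _ 1]) (auto simp: S'_def dist_real_def intro!: \<theta>(3))
    then have "(\<theta> has_real_derivative 0) (at z)"
      using DERIV_cong_ev[OF refl, of \<theta> "\<lambda>_. 0" z 0 0] by simp
    then show ?thesis using \<theta>'(1) DERIV_unique by blast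
  qed
  have c\<theta>: "continuous_on UNIV \<theta>" "continuous_on UNIV \<theta>'" using \<theta>(1) \<theta>'(2) smooth_continuous by blast+
  have c\<Theta>: "continuous_on UNIV \<Theta>" using \<Theta> by (intro continuous_at_imp_continuous_on ballI DERIV_isCont)
  have cF: "continuous_on {0..} (F \<gamma>)" for \<gamma>
    unfolding F_def[abs_def]
    by (rule continuous_on_quantile_integral[OF _ _ _ side_measurable side_abs])
      (auto intro!: continuous_intros continuous_on_compose2[OF c\<Theta>] simp: case_prod_unfold q_def)
  have m\<psi>: "(\<lambda>m. side \<gamma> m * (v - \<psi> m)) \<in> borel_measurable labels" for \<gamma>
    by (intro borel_measurable_times borel_measurable_diff side_measurable \<psi>_measurable) simp
  have b\<psi>: "\<bar>side \<gamma> m * (v - \<psi> m)\<bar> \<le> \<bar>v\<bar> + K" for \<gamma> m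
    using \<psi>_bounded[of m] abs_triangle_ineq4[of v "\<psi> m"] by (simp add: side_def abs_minus_commute)
  have cP: "continuous_on {0..} (P \<gamma>)" for \<gamma>
    unfolding P_def[abs_def]
    by (rule continuous_on_quantile_integral[OF _ _ _ m\<psi> b\<psi>])
      (auto intro!: continuous_intros continuous_on_compose2[OF c\<theta>(1)] simp: case_prod_unfold q_def)
  have cpc: "continuous_on (UNIV \<times> {0..}) (\<lambda>z. pc (fst z) (snd z))"
    using continuous_on_compose2[OF continuous_potential_conv, of "UNIV \<times> {0..}" "\<lambda>z. (snd z, fst z)"]
    by (force intro: continuous_intros)
  have cQ: "continuous_on {0..} (Q \<gamma>)" for \<gamma>
    unfolding Q_def[abs_def]
    by (rule continuous_on_quantile_integral[OF _ _ _ side_measurable side_abs])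
      (auto intro!: continuous_intros cpc continuous_on_compose2[OF c\<theta>(1)] simp: case_prod_unfold q_def)
  have sub: "{t0..t1} \<subseteq> {0..}" using t by auto
  \<comment> \<open>The entropy inequality at one level, tested with \<eta>(t) \<theta>(x - q(t))
    and rewritten over labels. The motion of the frame enters only through \<open>v\<close> in
    \<open>P\<close>.\<close>
  have key: "0 \<le> (LBINT t. \<eta>' t * (C \<gamma> - F \<gamma> t) + \<eta> t * (P \<gamma> t + Q \<gamma> t))"
      "integrable lborel (\<lambda>t. \<eta>' t * (C \<gamma> - F \<gamma> t) + \<eta> t * (P \<gamma> t + Q \<gamma> t))"
    if \<gamma>: "\<gamma> \<in> {- 1/2..1/2}" and \<eta>: "smooth \<eta>" "\<And>t. 0 \<le> \<eta> t" "\<And>t. \<eta> t \<noteq> 0 \<Longrightarrow> t \<in> {t0..t1}"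
      "\<And>t. (\<eta> has_real_derivative \<eta>' t) (at t)" and \<eta>'0: "\<And>t. t \<notin> {t0..t1} \<Longrightarrow> \<eta>' t = 0"
    for \<gamma> \<eta> \<eta>'
  proof -
    have c\<eta>: "continuous_on Y \<eta>" "continuous_on Y \<eta>'" for Y
      using smooth_derivative[OF \<eta>(1,4)] \<eta>(1) smooth_continuous by blast+
    have i1: "integrable lborel (\<lambda>t. \<eta>' t * (C \<gamma> - F \<gamma> t) + \<eta> t * P \<gamma> t)"
      using \<eta>'0 \<eta>(3)
      by (intro integrable_continuous_Icc[of t0 t1] continuous_intros c\<eta> continuous_on_subset[OF cF sub] continuous_on_subset[OF cP sub]) auto
    have i2: "integrable lborel (\<lambda>t. \<eta> t * Q \<gamma> t)"
      using \<eta>(3)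
      by (intro integrable_continuous_Icc[of t0 t1] continuous_intros c\<eta> continuous_on_subset[OF cQ sub]) auto
    have \<theta>S: "\<bar>z\<bar> \<le> S'" if "\<theta> z \<noteq> 0" for z using \<theta>0[of z] that by linarith
    define \<zeta> where "\<zeta> = (\<lambda>p. \<eta> (snd p) * \<theta> (fst p - v * snd p - w))"
    note tf = test_function_product[where v=v and w=w, OF \<eta>(1-3) t(1) \<theta>(1,2) \<theta>S \<eta>(4) \<theta>'(1), folded \<zeta>_def]
    have px: "partial_x \<zeta> (x, s) = \<eta> s * \<theta>' (x - q s)" for x s using tf(2) unfolding qq .
    have pt: "partial_t \<zeta> (x, s) = \<eta>' s * \<theta> (x - q s) - v * \<eta> s * \<theta>' (x - q s)" for x s
      using tf(3) unfolding qq .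
    have S'0: "0 \<le> S'" by (simp add: S'_def)
    have sp: "(LBINT x. \<bar>M x t - \<gamma>\<bar> * partial_t \<zeta> (x, t) + sgn (M x t - \<gamma>) * (A (M x t) - A \<gamma>) * partial_x \<zeta> (x, t)) =
        \<eta>' t * (C \<gamma> - F \<gamma> t) + \<eta> t * P \<gamma> t" (is ?A)
      "integral_d_abs (\<lambda>x. M x t) \<gamma> (\<lambda>x. \<zeta> (x, t) * pc x t) = \<eta> t * Q \<gamma> t" (is ?B) if "0 < t" for t
    proof -
      have "0 \<le> t" using that by simp
      note e = entropy_space_integrals[OF this \<gamma> c\<theta>(1) \<theta>0 \<theta>'0 S'0 \<Theta> \<theta>'(1) c\<theta>(2)]
      show ?A unfolding px pt F_def P_def C_def by (rule e(1))
      show ?B unfolding \<zeta>_def Q_def fst_conv snd_conv qq by (rule e(2))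
    qed
    have "0 \<le> (LBINT t:{0<..}. LBINT x. \<bar>M x t - \<gamma>\<bar> * partial_t \<zeta> (x, t) +
           sgn (M x t - \<gamma>) * (A (M x t) - A \<gamma>) * partial_x \<zeta> (x, t)) +
        (LBINT t:{0<..}. integral_d_abs (\<lambda>x. M x t) \<gamma> (\<lambda>x. \<zeta> (x, t) * pc x t))"
      using entropy[OF \<gamma>] tf(1) unfolding entropy_inequality_def by blast
    also have "(LBINT t:{0<..}. LBINT x. \<bar>M x t - \<gamma>\<bar> * partial_t \<zeta> (x, t) +
           sgn (M x t - \<gamma>) * (A (M x t) - A \<gamma>) * partial_x \<zeta> (x, t)) = (LBINT t. \<eta>' t * (C \<gamma> - F \<gamma> t) + \<eta> t * P \<gamma> t)"
      unfolding set_lebesgue_integral_def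
    proof (rule Bochner_Integration.integral_cong[OF refl])
      fix s
      show "indicat_real {0<..} s *\<^sub>R (LBINT x. \<bar>M x s - \<gamma>\<bar> * partial_t \<zeta> (x, s) +
           sgn (M x s - \<gamma>) * (A (M x s) - A \<gamma>) * partial_x \<zeta> (x, s)) = \<eta>' s * (C \<gamma> - F \<gamma> s) + \<eta> s * P \<gamma> s"
      proof (cases "0 < s")
        case False
        then have "\<eta> s = 0" "\<eta>' s = 0" using \<eta>(3)[of s] \<eta>'0[of s] t by auto
        with False show ?thesis by simp
      qed (simp add: sp)
    qed
    also have "(LBINT t:{0<..}. integral_d_abs (\<lambda>x. M x t) \<gamma> (\<lambda>x. \<zeta> (x, t) * pc x t)) = (LBINT t. \<eta> t * Q \<gamma> t)"
      unfolding set_lebesgue_integral_def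
    proof (rule Bochner_Integration.integral_cong[OF refl])
      fix s
      show "indicat_real {0<..} s *\<^sub>R integral_d_abs (\<lambda>x. M x s) \<gamma> (\<lambda>x. \<zeta> (x, s) * pc x s) = \<eta> s * Q \<gamma> s"
      proof (cases "0 < s")
        case False
        then have "\<eta> s = 0" using \<eta>(3)[of s] t by auto
        with False show ?thesis by simp
      qed (simp add: sp)
    qed
    also have "(LBINT t. \<eta>' t * (C \<gamma> - F \<gamma> t) + \<eta> t * P \<gamma> t) + (LBINT t. \<eta> t * Q \<gamma> t) =
        (LBINT t. \<eta>' t * (C \<gamma> - F \<gamma> t) + \<eta> t * P \<gamma> t + \<eta> t * Q \<gamma> t)"
      by (rule Bochner_Integration.integral_add[OF i1 i2, symmetric])
    finally show "0 \<le> (LBINT t. \<eta>' t * (C \<gamma> - F \<gamma> t) + \<eta> t * (P \<gamma> t + Q \<gamma> t))" by (simp add: algebra_simps)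
    show "integrable lborel (\<lambda>t. \<eta>' t * (C \<gamma> - F \<gamma> t) + \<eta> t * (P \<gamma> t + Q \<gamma> t))"
      using Bochner_Integration.integrable_add[OF i1 i2] by (simp add: algebra_simps)
  qed
  define H where "H t = C \<alpha> - F \<alpha> t + (C \<beta> - F \<beta> t)" for t
  have cH: "continuous_on {t0..t1} H"
    unfolding H_def[abs_def] by (intro continuous_intros continuous_on_subset[OF cF sub])
  have PQ: "P \<alpha> s + Q \<alpha> s + (P \<beta> s + Q \<beta> s) \<le> 0" if s: "s \<in> {t0..t1}" for s
  proof -
    have s0: "0 \<le> s" using s t by simp
    have c: "continuous_on UNIV (\<lambda>x. \<theta> (x - q s))"
      by (intro continuous_on_compose2[OF c\<theta>(1)] continuous_intros) auto
    have iP: "integrable labels (\<lambda>m. side \<gamma> m * (v - \<psi> m) * \<theta> (X m s - q s))" for \<gamma>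
      by (rule integrable_quantile[OF s0 m\<psi> b\<psi> c])
    have iQ: "integrable labels (\<lambda>m. side \<gamma> m * (\<theta> (X m s - q s) * pc (X m s) s))" for \<gamma>
      by (rule integrable_quantile[OF s0 side_measurable side_abs, of "\<lambda>x. \<theta> (x - q s) * pc x s"])
        (intro continuous_intros c continuous_pc s0)
    have "P \<alpha> s + Q \<alpha> s + (P \<beta> s + Q \<beta> s) =
        (\<integral>m. side \<alpha> m * (v - \<psi> m) * \<theta> (X m s - q s) + side \<alpha> m * (\<theta> (X m s - q s) * pc (X m s) s) +
          (side \<beta> m * (v - \<psi> m) * \<theta> (X m s - q s) + side \<beta> m * (\<theta> (X m s - q s) * pc (X m s) s)) \<partial>labels)"
      unfolding P_def Q_def using iP iQ by simp
    also have "\<dots> = (\<integral>m. - ((side \<alpha> m + side \<beta> m) * (\<psi> m - v - pc (X m s) s) * \<theta> (X m s - (v * s + w))) \<partial>labels)"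
      by (intro Bochner_Integration.integral_cong) (auto simp: algebra_simps q_def)
    also have "\<dots> \<le> 0" using D[OF s] by simp
    finally show ?thesis .
  qed
  \<comment> \<open>This says that \<open>H\<close> is nonincreasing in the sense of distributions.
    As \<open>H\<close> is a constant minus the label integrals, the claim follows once continuity
    makes it pointwise.\<close>
  have main: "0 \<le> (LBINT t. \<eta>' t * H t)"
    if \<eta>: "smooth \<eta>" "\<And>t. 0 \<le> \<eta> t" "\<And>t. \<eta> t \<noteq> 0 \<Longrightarrow> t \<in> {t0..t1}"
      "\<And>t. (\<eta> has_real_derivative \<eta>' t) (at t)" and \<eta>'0: "\<And>t. t \<notin> {t0..t1} \<Longrightarrow> \<eta>' t = 0"
    for \<eta> \<eta>'
  proof -
    note k1 = key[OF \<alpha> \<eta> \<eta>'0] and k2 = key[OF \<beta> \<eta> \<eta>'0]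
    have c\<eta>': "continuous_on {t0..t1} \<eta>'"
      using smooth_derivative[OF \<eta>(1,4)] smooth_continuous by blast
    have iH: "integrable lborel (\<lambda>t. \<eta>' t * H t)"
      using \<eta>'0 by (intro integrable_continuous_Icc[of t0 t1] continuous_intros cH c\<eta>') auto
    have "0 \<le> (LBINT t. (\<eta>' t * (C \<alpha> - F \<alpha> t) + \<eta> t * (P \<alpha> t + Q \<alpha> t)) + (\<eta>' t * (C \<beta> - F \<beta> t) + \<eta> t * (P \<beta> t + Q \<beta> t)))"
      using k1 k2 by simp
    also have "\<dots> \<le> (LBINT t. \<eta>' t * H t)"
    proof (rule integral_mono[OF _ iH])
      fix s
      have "\<eta> s * (P \<alpha> s + Q \<alpha> s + (P \<beta> s + Q \<beta> s)) \<le> 0"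
        using PQ[of s] \<eta>(2,3)[of s] by (cases "\<eta> s = 0") (auto simp: mult_nonneg_nonpos)
      then show "(\<eta>' s * (C \<alpha> - F \<alpha> s) + \<eta> s * (P \<alpha> s + Q \<alpha> s)) + (\<eta>' s * (C \<beta> - F \<beta> s) + \<eta> s * (P \<beta> s + Q \<beta> s)) \<le> \<eta>' s * H s"
        by (simp add: H_def algebra_simps)
    qed (use k1 k2 in simp)
    finally show ?thesis .
  qed
  have "H t1 \<le> H t0"
  proof (rule ccontr)
    assume "\<not> H t1 \<le> H t0"
    then obtain h where h: "H t0 < h" "h < H t1" using dense by (metis not_le)
    have in01: "t0 \<in> {t0..t1}" "t1 \<in> {t0..t1}" using t by auto
    obtain d0 where d0: "0 < d0" "\<And>s. s \<in> {t0..t1} \<Longrightarrow> dist s t0 < d0 \<Longrightarrow> dist (H s) (H t0) < h - H t0"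
      using cH[unfolded continuous_on_iff, rule_format, OF in01(1), of "h - H t0"] h by auto
    obtain d1 where d1: "0 < d1" "\<And>s. s \<in> {t0..t1} \<Longrightarrow> dist s t1 < d1 \<Longrightarrow> dist (H s) (H t1) < H t1 - h"
      using cH[unfolded continuous_on_iff, rule_format, OF in01(2), of "H t1 - h"] h by auto
    \<comment> \<open>The cutoff derivative is a positive bump just after \<open>t0\<close> and a
      negative one just before \<open>t1\<close>; \<open>e\<close> is so small that \<open>H\<close>
      is below \<open>h\<close> on the first window and above \<open>h\<close> on the
      second.\<close>
    define e where "e = min (min d0 d1) (t1 - t0) / 4"
    have e: "0 < e" "4 * e \<le> d0" "4 * e \<le> d1" "4 * e \<le> t1 - t0" using d0 d1 t by (auto simp: e_def)
    have lo: "H s < h" if "t0 \<le> s" "s \<le> t0 + 2 * e" for s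
      using d0(2)[of s] that e by (auto simp: dist_real_def)
    have hi: "h < H s" if "t1 - 2 * e \<le> s" "s \<le> t1" for s
      using d1(2)[of s] that e by (auto simp: dist_real_def)
    define \<eta>' where "\<eta>' s = bump e (s - t0) - bump e (s - (t1 - 2 * e))" for s
    obtain \<eta> where \<eta>: "smooth \<eta>" "\<And>t. 0 \<le> \<eta> t" "\<And>t. \<eta> t \<noteq> 0 \<Longrightarrow> t \<in> {t0<..<t1}"
      "\<And>t. (\<eta> has_real_derivative \<eta>' t) (at t)"
      unfolding \<eta>'_def using time_cutoff[of e t0 t1] e by auto
    have \<eta>'0: "\<eta>' s = 0" if "s \<notin> {t0..t1}" for s
    proof -
      have "bump e (s - t0) = 0" "bump e (s - (t1 - 2 * e)) = 0"
        using that e by (intro bump_eq_0; auto)+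
      then show ?thesis by (simp add: \<eta>'_def)
    qed
    have c\<eta>': "continuous_on Y \<eta>'" for Y
      using smooth_derivative[OF \<eta>(1,4)] smooth_continuous by blast
    have nn: "0 \<le> (LBINT t. \<eta>' t * H t)"
      using \<eta>(3) by (intro main[OF \<eta>(1,2) _ \<eta>(4) \<eta>'0]) force+
    have iH: "integrable lborel (\<lambda>t. \<eta>' t * H t)"
      using \<eta>'0 by (intro integrable_continuous_Icc[of t0 t1] continuous_intros cH c\<eta>') auto
    have i1: "integrable lborel \<eta>'"
      using \<eta>'0 by (intro integrable_continuous_Icc[of t0 t1] c\<eta>') auto
    have z: "(LBINT t. \<eta>' t) = 0"
    proof -
      have "(LBINT t. \<eta>' t) = (LBINT t. \<eta>' t * indicator {t0..t1} t)"
        using \<eta>'0 by (intro Bochner_Integration.integral_cong) (auto simp: indicator_def)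
      also have "\<dots> = \<eta> t1 - \<eta> t0"
      proof (rule integral_FTC_Icc_real)
        have "continuous_on UNIV \<eta>'" by (rule c\<eta>')
        then show "isCont \<eta>' x" for x by (simp add: continuous_on_eq_continuous_at)
      qed (use t \<eta>(4) in auto)
      also have "\<eta> t0 = 0" using \<eta>(3)[of t0] by fastforce
      also have "\<eta> t1 = 0" using \<eta>(3)[of t1] by fastforce
      finally show ?thesis by simp
    qed
    \<comment> \<open>Since \<open>\<eta>'\<close> has integral zero, the constant \<open>h\<close>
      does not affect the integral, but it makes the integrand nonnegative.\<close>
    define f where "f s = \<eta>' s * (h - H s)" for s
    have fpos: "0 \<le> f s" if "s \<in> {t0..t1}" for s
    proof -
      consider "s < t0 + 2 * e" | "t1 - 2 * e < s" | "t0 + 2 * e \<le> s" "s \<le> t1 - 2 * e" by linarith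
      then show ?thesis
      proof cases
        case 1
        then have "bump e (s - (t1 - 2 * e)) = 0" using e by (intro bump_eq_0) auto
        then show ?thesis using lo[of s] 1 that bump_nonneg[of e] by (auto simp: f_def \<eta>'_def)
      next
        case 2
        then have "bump e (s - t0) = 0" using e by (intro bump_eq_0) auto
        then show ?thesis using hi[of s] 2 that bump_nonneg[of e] by (auto simp: f_def \<eta>'_def mult_nonneg_nonpos)
      next
        case 3
        then have "bump e (s - t0) = 0" "bump e (s - (t1 - 2 * e)) = 0" by (intro bump_eq_0; auto)+
        then show ?thesis by (simp add: f_def \<eta>'_def)
      qed
    qed
    have cf: "continuous_on {t0..t1} f"
      unfolding f_def[abs_def] by (intro continuous_intros cH c\<eta>')
    have f0: "f s = 0" if "s \<notin> {t0..t1}" for s using \<eta>'0[OF that] by (simp add: f_def)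
    have "(LBINT s:{t0..t1}. f s) = (LBINT s. h * \<eta>' s - \<eta>' s * H s)"
      unfolding set_lebesgue_integral_def using f0
      by (intro Bochner_Integration.integral_cong) (auto simp: indicator_def f_def algebra_simps)
    also have "\<dots> = - (LBINT t. \<eta>' t * H t)" using i1 iH z by simp
    finally have le: "(LBINT s:{t0..t1}. f s) \<le> 0" using nn by simp
    have "set_integrable lborel {t0..t1} f" by (rule borel_integrable_atLeastAtMost'[OF cf])
    from set_borel_integral_eq_integral[OF this]
    have "f integrable_on {t0..t1}" and I: "integral {t0..t1} f \<le> 0" using le by auto
    moreover have "0 \<le> integral {t0..t1} f" using fpos by (intro Henstock_Kurzweil_Integration.integral_nonneg \<open>f integrable_on {t0..t1}\<close>)
    ultimately have "(f has_integral 0) (cbox t0 t1)" by (simp add: has_integral_iff)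
    then have "f (t0 + e) = 0"
      using cf fpos e t by (intro has_integral_0_cbox_imp_0[of t0 t1 f]) auto
    moreover have "bump e (t0 + e - (t1 - 2 * e)) = 0" using e by (intro bump_eq_0) auto
    then have "0 < f (t0 + e)"
      using lo[of "t0 + e"] e bump_pos[of e e] by (simp add: f_def \<eta>'_def)
    ultimately show False by simp
  qed
  moreover have "(\<integral>m. (side \<alpha> m + side \<beta> m) * \<Theta> (X m s - (v * s + w)) \<partial>labels) = F \<alpha> s + F \<beta> s" if "0 \<le> s" for s
  proof -
    have c: "continuous_on UNIV (\<lambda>x. \<Theta> (x - q s))"
      by (intro continuous_on_compose2[OF c\<Theta>] continuous_intros) auto
    have i: "integrable labels (\<lambda>m. side \<gamma> m * \<Theta> (X m s - q s))" for \<gamma>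
      by (rule integrable_quantile[OF that side_measurable side_abs c])
    have "F \<alpha> s + F \<beta> s = (\<integral>m. side \<alpha> m * \<Theta> (X m s - q s) + side \<beta> m * \<Theta> (X m s - q s) \<partial>labels)"
      unfolding F_def using i by simp
    also have "\<dots> = (\<integral>m. (side \<alpha> m + side \<beta> m) * \<Theta> (X m s - (v * s + w)) \<partial>labels)"
      by (intro Bochner_Integration.integral_cong) (auto simp: algebra_simps q_def)
    finally show ?thesis by simp
  qed
  ultimately show ?thesis using t by (simp add: H_def)
qed

text \<open>Test functions are supported in positive times, so a start at time 0 is reached as a
  limit, by continuity of the label integrals.\<close>

lemma evolution_mono:
  fixes \<theta> \<Theta> :: "real \<Rightarrow> real"
  assumes \<alpha>: "\<alpha> \<in> {- 1/2..1/2}" and \<beta>: "\<beta> \<in> {- 1/2..1/2}"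
    and \<theta>: "smooth \<theta>" "\<And>z. 0 \<le> \<theta> z" "\<And>z. S \<le> \<bar>z\<bar> \<Longrightarrow> \<theta> z = 0"
    and \<Theta>: "\<And>x. (\<Theta> has_real_derivative \<theta> x) (at x)"
    and t: "0 \<le> t0" "t0 < t1"
    and D: "\<And>t. t \<in> {t0..t1} \<Longrightarrow>
      0 \<le> (\<integral>m. (side \<alpha> m + side \<beta> m) * (\<psi> m - v - pc (X m t) t) * \<theta> (X m t - (v * t + w)) \<partial>labels)"
  shows "(\<integral>m. (side \<alpha> m + side \<beta> m) * \<Theta> (X m t0 - (v * t0 + w)) \<partial>labels) \<le>
         (\<integral>m. (side \<alpha> m + side \<beta> m) * \<Theta> (X m t1 - (v * t1 + w)) \<partial>labels)" (is "?F t0 \<le> ?F t1")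
proof -
  have c\<Theta>: "continuous_on UNIV \<Theta>" using \<Theta> by (intro continuous_at_imp_continuous_on ballI DERIV_isCont)
  have "continuous_on {0..} ?F"
  proof (rule continuous_on_quantile_integral[where B=2])
    show "(\<lambda>m. side \<alpha> m + side \<beta> m) \<in> borel_measurable labels"
      by (intro borel_measurable_add side_measurable)
    show "\<bar>side \<alpha> m + side \<beta> m\<bar> \<le> 2" for m by (simp add: side_def)
  qed (auto intro!: continuous_intros continuous_on_compose2[OF c\<Theta>] simp: case_prod_unfold)
  then have "(?F \<longlongrightarrow> ?F t0) (at t0 within {0..})"
    using t(1) unfolding continuous_on_def by simp
  then have lim: "(?F \<longlongrightarrow> ?F t0) (at_right t0)"
    by (rule tendsto_within_subset) (use t in auto)
  have ev: "\<forall>\<^sub>F s in at_right t0. ?F s \<le> ?F t1"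
    unfolding eventually_at_right_field
  proof (intro exI[of _ t1] conjI allI impI)
    fix s assume s: "t0 < s" "s < t1"
    show "?F s \<le> ?F t1"
      by (rule evolution_mono_pos[OF \<alpha> \<beta> \<theta> \<Theta>]) (use s t D in auto)
  qed (use t in simp)
  show ?thesis by (rule tendsto_upperbound[OF lim ev]) simp
qed

end

section \<open>Linear barriers\<close>

lemma sum_of_bool_eq_floor:
  assumes "0 \<le> y" "y < real N + 1"
  shows "(\<Sum>k=1..N. of_bool (real k \<le> y)) = real_of_int \<lfloor>y\<rfloor>"
proof -
  have "(\<Sum>k=1..N. of_bool (real k \<le> y)) = real (card {k \<in> {1..N}. real k \<le> y})"
    by (simp add: Int_def)
  also have "{k \<in> {1..N}. real k \<le> y} = {1..nat \<lfloor>y\<rfloor>}"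
    using assms by (auto simp: le_nat_iff le_floor_iff)
  finally show ?thesis using assms by simp
qed

text \<open>A weight is uniformly close to its staircase floor(n w)/n, which is 1/n times the sum of
  the indicators of the superlevel sets at k/n.\<close>

lemma (in prob_space) integral_nonpos_of_superlevels:
  fixes w f :: "'a \<Rightarrow> real"
  assumes [measurable]: "w \<in> borel_measurable M" "f \<in> borel_measurable M" "Measurable.pred M P"
    and w: "\<And>x. x \<in> space M \<Longrightarrow> 0 \<le> w x" "\<And>x. x \<in> space M \<Longrightarrow> w x \<le> B"
    and f: "\<And>x. \<bar>f x\<bar> \<le> K"
    and le: "\<And>l. 0 < l \<Longrightarrow> (\<integral>x. of_bool (P x \<and> l \<le> w x) * f x \<partial>M) \<le> 0"
  shows "(\<integral>x. of_bool (P x) * w x * f x \<partial>M) \<le> 0"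
proof (rule field_le_epsilon)
  fix e :: real assume "0 < e"
  obtain x0 where "x0 \<in> space M" using not_empty by blast
  then have B0: "0 \<le> B" using w[of x0] by linarith
  have K0: "0 \<le> K" using f[of x0] by linarith
  \<comment> \<open>The staircase is within 1/n of the weight, so the error in the integral is at
    most K/n. The summand 1 keeps \<open>n\<close> positive when \<open>K\<close> is 0.\<close>
  obtain n :: nat where n: "(K + 1) / e < real n" using reals_Archimedean2 by blast
  have n0: "0 < real n" using n \<open>0 < e\<close> K0 by (smt (verit) divide_nonneg_pos)
  \<comment> \<open>\<open>N\<close> steps of height 1/n reach above the bound \<open>B\<close> of
    the weight.\<close>
  obtain N :: nat where N: "real n * B < real N" using reals_Archimedean2 by blast
  define g where "g x = (\<Sum>k=1..N. of_bool (P x \<and> real k / real n \<le> w x) * f x) / real n" for x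
  have i: "integrable M (\<lambda>x. of_bool (P x \<and> l \<le> w x) * f x)" for l
    by (rule integrable_bounded[where B=K]) (use f K0 in \<open>auto simp: of_bool_def\<close>)
  have ig: "integrable M g"
    unfolding g_def[abs_def] by (intro integrable_divide_zero Bochner_Integration.integrable_sum i)
  have "(\<integral>x. g x \<partial>M) \<le> 0"
  proof -
    have "(\<integral>x. g x \<partial>M) = (\<Sum>k=1..N. (\<integral>x. of_bool (P x \<and> real k / real n \<le> w x) * f x \<partial>M)) / real n"
      unfolding g_def by (subst integral_divide_zero, subst Bochner_Integration.integral_sum) (auto intro: i)
    also have "\<dots> \<le> 0"
      using n0 by (intro divide_nonpos_pos sum_nonpos le) auto
    finally show ?thesis .
  qed
  have diff: "\<bar>of_bool (P x) * w x * f x - g x\<bar> \<le> e" if "x \<in> space M" for x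
  proof -
    define y where "y = real n * w x"
    have y: "0 \<le> y" "y < real N + 1"
    proof -
      have "real n * w x \<le> real n * B" using w[OF that] n0 by (intro mult_left_mono) auto
      then show "y < real N + 1" using N unfolding y_def by linarith
      show "0 \<le> y" using w[OF that] n0 by (simp add: y_def)
    qed
    have "(\<Sum>k=1..N. of_bool (P x \<and> real k / real n \<le> w x) * f x) = (\<Sum>k=1..N. of_bool (real k \<le> y)) * (of_bool (P x) * f x)"
      unfolding sum_distrib_right using n0
      by (intro sum.cong) (auto simp: y_def divide_simps mult.commute)
    then have g: "g x = real_of_int \<lfloor>y\<rfloor> / real n * (of_bool (P x) * f x)"
      unfolding g_def sum_of_bool_eq_floor[OF y] by simp
    have "of_bool (P x) * w x * f x - g x = (y - real_of_int \<lfloor>y\<rfloor>) / real n * (of_bool (P x) * f x)"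
      unfolding g using n0 by (simp add: y_def field_simps)
    also have "\<bar>\<dots>\<bar> \<le> 1 / real n * K"
    proof -
      have "0 \<le> y - real_of_int \<lfloor>y\<rfloor>" "y - real_of_int \<lfloor>y\<rfloor> \<le> 1" by linarith+
      then have "\<bar>(y - real_of_int \<lfloor>y\<rfloor>) / real n\<bar> \<le> 1 / real n" using n0 by (simp add: divide_right_mono)
      moreover have "\<bar>of_bool (P x) * f x\<bar> \<le> K" using f[of x] K0 by (simp add: of_bool_def)
      ultimately show ?thesis unfolding abs_mult[of "_ / _"] using n0 by (intro mult_mono) auto
    qed
    also have "\<dots> \<le> e" using n n0 \<open>0 < e\<close> by (simp add: field_simps)
    finally show ?thesis .
  qed
  have iw: "integrable M (\<lambda>x. of_bool (P x) * w x * f x)"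
  proof (rule integrable_bounded[where B="B * K"])
    show "\<bar>of_bool (P x) * w x * f x\<bar> \<le> B * K" if "x \<in> space M" for x
      unfolding abs_mult using w[OF that] f[of x] B0 K0 by (intro mult_mono) (auto simp: of_bool_def)
  qed measurable
  have "(\<integral>x. of_bool (P x) * w x * f x \<partial>M) \<le> (\<integral>x. g x + e \<partial>M)"
  proof (rule integral_mono[OF iw])
    show "of_bool (P x) * w x * f x \<le> g x + e" if "x \<in> space M" for x
      using diff[OF that] by linarith
  qed (use ig in simp)
  also have "\<dots> = (\<integral>x. g x \<partial>M) + e" using ig by (simp add: prob_space)
  also have "\<dots> \<le> 0 + e" using \<open>(\<integral>x. g x \<partial>M) \<le> 0\<close> by simp
  finally show "(\<integral>x. of_bool (P x) * w x * f x \<partial>M) \<le> 0 + e" .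
qed

section \<open>Comparison of the density with lines, and moving barriers\<close>

context flow
begin

lemma integral_slope:
  assumes "s \<in> {- 1/2..1/2}" "b \<in> {- 1/2..1/2}" "s \<le> b"
  shows "(\<integral>m. of_bool (s < m \<and> m \<le> b) * (\<psi> m - c) \<partial>labels) = A b - A s - c * (b - s)"
proof -
  have m: "(\<lambda>m. indicator {..u} m * f m) \<in> borel_measurable labels" if "f \<in> borel_measurable labels" for u and f :: "real \<Rightarrow> real"
    by (intro borel_measurable_times[OF measurable_labelsI] that) auto
  have i: "integrable labels (\<lambda>m. indicator {..u} m * \<psi> m)" for u
  proof (rule labels.integrable_bounded[where B=K, OF m[OF \<psi>_measurable]])
    show "\<bar>indicator {..u} m * \<psi> m\<bar> \<le> K" for m using \<psi>_bounded[of m] by (auto simp: indicator_def)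
  qed
  have i1: "integrable labels (\<lambda>m. indicator {..u} m * (1::real))" for u
  proof (rule labels.integrable_bounded[where B=1, OF m])
    show "\<bar>indicator {..u} m * (1::real)\<bar> \<le> 1" for m by (auto simp: indicator_def)
  qed simp
  interpret t: bounded_distribution "\<rho> 0" "SOME R. bounded_distribution (\<rho> 0) R"
    using bounded_dist[of 0] by (simp add: some_eq_ex)
  have "(\<integral>m. of_bool (s < m \<and> m \<le> b) * (\<psi> m - c) \<partial>labels) =
    (\<integral>m. (indicator {..b} m * \<psi> m - indicator {..s} m * \<psi> m) - c * (indicator {..b} m * 1 - indicator {..s} m * 1) \<partial>labels)"
    using assms(3) by (intro Bochner_Integration.integral_cong) (auto simp: indicator_def)
  also have "\<dots> = A b - A s - c * ((b + 1/2) - (s + 1/2))"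
    using i i1 assms t.integral_indicator_labels by (simp add: A_eq)
  finally show ?thesis by simp
qed

text \<open>A smooth substitute for the positive part. It measures how far labels have passed the
  barrier, and a zero integral of it means that almost none has.\<close>

lemma ramp:
  obtains \<Theta> where "\<And>x. (\<Theta> has_real_derivative bump S x) (at x)"
    "\<And>z. z \<le> 0 \<Longrightarrow> \<Theta> z = 0" "\<And>z. 0 \<le> \<Theta> z" "\<And>z. 0 < S \<Longrightarrow> 0 < z \<Longrightarrow> 0 < \<Theta> z"
proof -
  obtain \<Xi> where \<Xi>: "\<And>x. (\<Xi> has_real_derivative bump S x) (at x)"
    using continuous_antiderivative[OF smooth_continuous[OF smooth_bump]] by blast
  define \<Theta> where "\<Theta> z = \<Xi> z - \<Xi> 0" for z
  have d: "(\<Theta> has_real_derivative bump S x) (at x)" for x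
    unfolding \<Theta>_def[abs_def] using DERIV_diff[OF \<Xi> DERIV_const] by simp
  have mono: "\<Theta> x \<le> \<Theta> y" if "x \<le> y" for x y
    using that by (rule DERIV_nonneg_imp_nondecreasing) (use d bump_nonneg in blast)
  have cont: "continuous_on Y \<Theta>" for Y
    using d by (intro continuous_at_imp_continuous_on ballI DERIV_isCont)
  have le0: "\<Theta> z = 0" if "z \<le> 0" for z
  proof (cases "z < 0")
    case True
    have "(\<Theta> has_real_derivative 0) (at x)" if "z < x" "x < 0" for x
      using d[of x] bump_eq_0[of x S] that by simp
    then have "\<Theta> 0 = \<Theta> z" by (intro DERIV_isconst_end[OF True cont])
    then show ?thesis by (simp add: \<Theta>_def)
  qed (use that in \<open>simp add: \<Theta>_def\<close>)
  show thesis
  proof (rule that[of \<Theta>, OF d le0])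
    show "0 \<le> \<Theta> z" for z using mono[of 0 z] le0[of z] le0[of 0] by (cases "0 \<le> z") auto
    show "0 < \<Theta> z" if "0 < S" "0 < z" for z
    proof -
      have "\<Theta> 0 < \<Theta> (min z S)"
      proof (rule DERIV_pos_imp_increasing_open[OF _ _ cont])
        show "\<exists>y. (\<Theta> has_real_derivative y) (at x) \<and> 0 < y" if "0 < x" "x < min z S" for x
          using d[of x] bump_pos[of x S] that by auto
      qed (use that in simp)
      also have "\<dots> \<le> \<Theta> z" by (rule mono) simp
      finally show ?thesis using le0[of 0] by simp
    qed
  qed
qed

text \<open>This lets the velocity be frozen at its initial value along a straight barrier, at the
  price of \<open>e\<close> and for a short time.\<close>

lemma pc_along_line:
  assumes "0 \<le> t0" "0 < e"
  shows "\<exists>h>0. \<forall>t\<in>{t0..t0 + h}. \<bar>pc (x + v * (t - t0)) t - pc x t0\<bar> < e"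
proof -
  have "continuous_on {0..} (\<lambda>t. pc (x + v * (t - t0)) t)"
    using continuous_on_compose2[OF continuous_potential_conv, of "{0..}" "\<lambda>t. (t, x + v * (t - t0))"]
    by (force intro: continuous_intros)
  then obtain d where d: "0 < d" "\<And>t. t \<in> {0..} \<Longrightarrow> dist t t0 < d \<Longrightarrow>
      dist (pc (x + v * (t - t0)) t) (pc (x + v * (t0 - t0)) t0) < e"
    unfolding continuous_on_iff using assms by (metis atLeast_iff)
  show ?thesis
    by (rule exI[of _ "d / 2"]) (use d assms in \<open>auto simp: dist_real_def\<close>)
qed

lemma AE_labels_interval:
  assumes "AE m in labels. P m" "l < r" "{l<..r} \<subseteq> {- 1/2<..1/2}"
  shows "\<exists>m\<in>{l<..r}. P m"
proof (rule ccontr)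
  assume n: "\<not> ?thesis"
  have "AE m in labels. m \<notin> {l<..r}" using assms(1) by eventually_elim (use n in blast)
  then have "AE m in lborel. m \<notin> {l<..r}"
    unfolding AE_labels_iff by eventually_elim (use assms(3) in blast)
  then have "emeasure lborel {m. m \<in> {l<..r}} = 0" by (subst (asm) AE_iff_measurable[OF _ refl]) auto
  then have "emeasure lborel {l<..r} = 0" by (simp only: Collect_mem_eq)
  with assms(2) show False by simp
qed

text \<open>The threshold is an infimum; adding \<open>r\<close> to the set makes it
  \<open>r\<close> when \<open>Q\<close> never holds. Whether \<open>Q\<close> holds at the
  threshold itself is left open, since one label is a null set.\<close>

lemma upward_closed_threshold:
  fixes l r :: real
  assumes lr: "l \<le> r" and up: "\<And>m m'. m \<in> {l<..r} \<Longrightarrow> m' \<in> {l<..r} \<Longrightarrow> m \<le> m' \<Longrightarrow> Q m \<Longrightarrow> Q m'"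
  obtains s where "s \<in> {l..r}" "\<And>m. m \<in> {l<..r} \<Longrightarrow> m \<noteq> s \<Longrightarrow> Q m \<longleftrightarrow> s < m"
proof
  define U where "U = insert r {m \<in> {l<..r}. Q m}"
  have ne: "U \<noteq> {}" and bdd: "bdd_below U"
    using lr by (auto simp: U_def intro!: bdd_belowI[of _ l])
  have "Inf U \<le> r" by (rule cInf_lower[OF _ bdd]) (simp add: U_def)
  moreover have "l \<le> Inf U" using lr by (intro cInf_greatest[OF ne]) (auto simp: U_def)
  ultimately show "Inf U \<in> {l..r}" by simp
  show "Q m \<longleftrightarrow> Inf U < m" if m: "m \<in> {l<..r}" "m \<noteq> Inf U" for m
  proof
    assume "Q m"
    then show "Inf U < m" using cInf_lower[OF _ bdd, of m] m by (auto simp: U_def)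
  next
    assume "Inf U < m"
    from cInf_lessD[OF ne this] obtain u where u: "u \<in> U" "u < m" by (elim bexE)
    then show "Q m" using up[of u m] m by (auto simp: U_def)
  qed
qed

lemma integral_slope_AE:
  assumes "s \<in> {- 1/2..1/2}" "b \<in> {- 1/2..1/2}" "s \<le> b"
    and [measurable]: "Measurable.pred labels Q" and Q: "AE m in labels. Q m \<longleftrightarrow> s < m \<and> m \<le> b"
  shows "(\<integral>m. of_bool (Q m) * (\<psi> m - c) \<partial>labels) = A b - A s - c * (b - s)"
proof -
  note [measurable] = \<psi>_measurable
  have [measurable]: "Measurable.pred labels (\<lambda>m. s < m \<and> m \<le> b)" by (intro measurable_labelsI) measurable
  have "(\<integral>m. of_bool (Q m) * (\<psi> m - c) \<partial>labels) = (\<integral>m. of_bool (s < m \<and> m \<le> b) * (\<psi> m - c) \<partial>labels)"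
  proof (rule integral_cong_AE)
    show "AE m in labels. of_bool (Q m) * (\<psi> m - c) = of_bool (s < m \<and> m \<le> b) * (\<psi> m - c)"
      using Q by eventually_elim simp
  qed measurable
  then show ?thesis using integral_slope[OF assms(1-3)] by simp
qed

lemma AE_labels_neq: "AE m in labels. m \<noteq> s \<and> m \<in> {- 1/2<..1/2}"
proof -
  have "AE m in lborel. m \<noteq> s" by (rule AE_lborel_singleton)
  then have "AE m in labels. m \<noteq> s" unfolding AE_labels_iff by eventually_elim simp
  then show ?thesis by (auto simp: AE_conj_iff)
qed

text \<open>The sign \<open>\<sigma>\<close> is \<open>1\<close> for barriers that bound labels from above and \<open>- 1\<close> for barriers from below.\<close>

lemma barrier:
  assumes \<sigma>: "\<sigma> = 1 \<or> \<sigma> = - 1" and \<alpha>\<beta>: "\<alpha> \<in> {- 1/2..1/2}" "\<beta> \<in> {- 1/2..1/2}"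
    and sides: "\<And>m. m \<in> {- 1/2<..1/2} \<Longrightarrow> side \<alpha> m + side \<beta> m = - 2 * \<sigma> * of_bool (P m)"
    and P: "Measurable.pred labels P" and t0: "0 \<le> t0" and e: "0 < e"
    and init: "\<And>m. m \<in> {- 1/2<..1/2} \<Longrightarrow> P m \<Longrightarrow> \<sigma> * (X m t0 - q0) \<le> 0"
    and superlevel: "\<And>(w :: real \<Rightarrow> real) l. w \<in> borel_measurable labels \<Longrightarrow>
      (\<And>m m'. m \<in> {- 1/2<..1/2} \<Longrightarrow> m' \<in> {- 1/2<..1/2} \<Longrightarrow> \<sigma> * m \<le> \<sigma> * m' \<Longrightarrow> w m \<le> w m') \<Longrightarrow> 0 < l \<Longrightarrow>
      \<sigma> * (\<integral>m. of_bool (P m \<and> l \<le> w m) * (\<psi> m - c) \<partial>labels) \<le> 0"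
  shows "\<exists>h>0. \<forall>t\<in>{t0..t0 + h}. AE m in labels. P m \<longrightarrow>
    \<sigma> * X m t \<le> \<sigma> * (q0 + (t - t0) * (c - pc q0 t0 + \<sigma> * e))"
proof -
  have \<sigma>2: "\<sigma> * \<sigma> = 1" "\<bar>\<sigma>\<bar> = 1" "\<sigma> * (\<sigma> * x) = x" for x using \<sigma> by auto
  \<comment> \<open>The formal characteristic speed at the starting point, changed by
    \<open>e\<close> in the direction in which the barrier must stay ahead of the labels.\<close>
  define v where "v = c - pc q0 t0 + \<sigma> * e"
  define q where "q t = q0 + v * (t - t0)" for t
  have q: "q t = v * t + (q0 - v * t0)" for t by (simp add: q_def algebra_simps)
  obtain h where h: "0 < h" "\<And>t. t \<in> {t0..t0 + h} \<Longrightarrow> \<bar>pc (q t) t - pc q0 t0\<bar> < e"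
    unfolding q_def using pc_along_line[OF t0 e, of q0 v] by blast
  obtain R where R: "0 < R" "\<And>t. t \<in> {0..t0 + h} \<Longrightarrow> bounded_distribution (\<rho> t) R"
    using obtain_bound[of "t0 + h"] by blast
  \<comment> \<open>Bounds every signed distance from the barrier during the time window, so that
    \<open>bump S\<close> acts only where it is increasing.\<close>
  define S where "S = R + \<bar>q0\<bar> + \<bar>v\<bar> * h"
  have S: "0 < S" using R h by (simp add: S_def add_pos_nonneg)
  have XS: "\<sigma> * (X m t - q t) \<le> S" if "m \<in> {- 1/2<..1/2}" "t \<in> {t0..t0 + h}" for m t
  proof -
    interpret t: bounded_distribution "\<rho> t" R using R that t0 by auto
    have "\<bar>v * (t - t0)\<bar> \<le> \<bar>v\<bar> * h" unfolding abs_mult using that by (intro mult_left_mono) auto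
    then show ?thesis using t.quantile_bounds[OF that(1)] \<sigma> by (auto simp: S_def q_def)
  qed
  obtain \<Xi> where \<Xi>: "\<And>x. (\<Xi> has_real_derivative bump S x) (at x)"
    "\<And>z. z \<le> 0 \<Longrightarrow> \<Xi> z = 0" "\<And>z. 0 \<le> \<Xi> z" "\<And>z. 0 < S \<Longrightarrow> 0 < z \<Longrightarrow> 0 < \<Xi> z" using ramp[of S] by blast
  define \<Theta> where "\<Theta> z = \<sigma> * \<Xi> (\<sigma> * z)" for z
  have \<Theta>: "(\<Theta> has_real_derivative bump S (\<sigma> * x)) (at x)" for x
    unfolding \<Theta>_def[abs_def]
    using DERIV_cmult[OF DERIV_chain2[OF \<Xi>(1) DERIV_cmult[OF DERIV_ident]], of \<sigma> \<sigma> x] by (simp add: \<sigma>2 mult_ac)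
  have c\<Xi>: "continuous_on UNIV \<Xi>" using \<Xi>(1) by (intro continuous_at_imp_continuous_on ballI DERIV_isCont)
  have smooth: "smooth (\<lambda>z. bump S (\<sigma> * z))" using smooth_affine[OF smooth_bump, of S \<sigma> 0] by simp
  have mP: "(\<lambda>m. of_bool (P m) :: real) \<in> borel_measurable labels" using P by measurable
  have D: "0 \<le> (\<integral>m. (side \<alpha> m + side \<beta> m) * (\<psi> m - v - pc (X m t) t) * bump S (\<sigma> * (X m t - (v * t + (q0 - v * t0)))) \<partial>labels)"
    if t: "t \<in> {t0..t0 + h}" for t
  proof -
    have t': "0 \<le> t" using t t0 by simp
    interpret t: bounded_distribution "\<rho> t" R using R t t0 by auto
    have cb: "continuous_on UNIV (\<lambda>x. bump S (\<sigma> * (x - q t)))"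
      by (intro continuous_on_compose2[OF smooth_continuous[OF smooth_bump]] continuous_intros) auto
    define w where "w m = bump S (\<sigma> * (X m t - q t))" for m
    have wm: "w \<in> borel_measurable labels"
      unfolding w_def[abs_def] by (intro measurable_compose[OF t.measurable_quantile] borel_measurable_continuous_onI cb)
    obtain B where B: "\<And>x. x \<in> {-R..R} \<Longrightarrow> \<bar>bump S (\<sigma> * (x - q t))\<bar> \<le> B"
      using continuous_bounded_Icc[OF cb] by blast
    have mono: "w m \<le> w m'" if "m \<in> {- 1/2<..1/2}" "m' \<in> {- 1/2<..1/2}" "\<sigma> * m \<le> \<sigma> * m'" for m m'
      unfolding w_def
    proof (rule bump_mono[OF _ XS[OF that(2) t]])
      show "\<sigma> * (X m t - q t) \<le> \<sigma> * (X m' t - q t)"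
        using \<sigma> t.quantile_mono[OF that(1,2)] t.quantile_mono[OF that(2,1)] that(3) by auto
    qed
    \<comment> \<open>The weight is monotone in the label, in the direction of \<sigma>, so
      \<open>superlevel\<close> applies to each of its superlevel sets.\<close>
    have le0: "(\<integral>m. of_bool (P m) * w m * (\<sigma> * (\<psi> m - c)) \<partial>labels) \<le> 0"
    proof (rule labels.integral_nonpos_of_superlevels[OF wm _ P])
      show "0 \<le> w m" for m by (simp add: w_def bump_nonneg)
      show "w m \<le> B" if "m \<in> space labels" for m
      proof -
        have "m \<in> {- 1/2<..1/2}" using that by simp
        then show ?thesis using t.quantile_bounds[of m] B[of "X m t"] by (simp add: w_def)
      qed
      show "\<bar>\<sigma> * (\<psi> m - c)\<bar> \<le> K + \<bar>c\<bar>" for m unfolding abs_mult \<sigma>2 mult_1 using \<psi>_bounded[of m] by linarith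
      show "(\<lambda>m. \<sigma> * (\<psi> m - c)) \<in> borel_measurable labels" using \<psi>_measurable by simp
      fix l :: real assume "0 < l"
      have "\<sigma> * (\<integral>m. of_bool (P m \<and> l \<le> w m) * (\<psi> m - c) \<partial>labels) \<le> 0"
        by (rule superlevel[OF wm _ \<open>0 < l\<close>]) (rule mono)
      then show "(\<integral>m. of_bool (P m \<and> l \<le> w m) * (\<sigma> * (\<psi> m - c)) \<partial>labels) \<le> 0"
        by (simp add: mult.left_commute)
    qed
    have c1: "continuous_on UNIV (\<lambda>x. bump S (\<sigma> * (x - q t)) * pc x t)"
      by (intro continuous_intros cb continuous_pc t')
    have i0: "integrable labels (\<lambda>m. of_bool (P m) * (w m * pc (X m t) t))"
      unfolding w_def by (rule integrable_quantile[OF t' mP _ c1, of 1]) auto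
    have i1: "integrable labels (\<lambda>m. of_bool (P m) * (\<psi> m - k) * w m)" for k
      unfolding w_def
    proof (rule integrable_quantile[OF t' _ _ cb])
      show "(\<lambda>m. of_bool (P m) * (\<psi> m - k)) \<in> borel_measurable labels"
        using mP \<psi>_measurable by measurable
      show "\<bar>of_bool (P m) * (\<psi> m - k)\<bar> \<le> K + \<bar>k\<bar>" for m
        using \<psi>_bounded[of m] by (cases "P m"; simp; linarith)
    qed
    have "0 \<le> - 2 * (\<integral>m. of_bool (P m) * w m * (\<sigma> * (\<psi> m - c)) \<partial>labels)" using le0 by simp
    also have "\<dots> = (\<integral>m. - 2 * (of_bool (P m) * w m * (\<sigma> * (\<psi> m - c))) \<partial>labels)"
      by (rule integral_mult_right_zero[symmetric])
    also have "\<dots> = (\<integral>m. - 2 * \<sigma> * (of_bool (P m) * (\<psi> m - c) * w m) \<partial>labels)"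
      by (intro Bochner_Integration.integral_cong) (auto simp: algebra_simps)
    also have "\<dots> \<le> (\<integral>m. - 2 * \<sigma> * (of_bool (P m) * (\<psi> m - v) * w m - of_bool (P m) * (w m * pc (X m t) t)) \<partial>labels)"
    proof (rule integral_mono)
      fix m
      have "\<sigma> * (c - v - pc (X m t) t) * w m \<le> 0"
      proof (cases "0 < \<sigma> * (X m t - q t)")
        case True
        then have "\<sigma> * pc (q t) t \<le> \<sigma> * pc (X m t) t" using \<sigma> potential_conv_mono[OF t'] by auto
        moreover have "\<sigma> * (pc q0 t0 - pc (q t) t) \<le> e" using h(2)[OF t] \<sigma> by auto
        ultimately have "\<sigma> * (c - v - pc (X m t) t) \<le> 0" by (simp add: v_def \<sigma>2 algebra_simps)
        then show ?thesis unfolding w_def by (rule mult_nonpos_nonneg[OF _ bump_nonneg])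
      next
        case False
        then show ?thesis by (simp add: w_def bump_eq_0)
      qed
      then show "- 2 * \<sigma> * (of_bool (P m) * (\<psi> m - c) * w m) \<le>
        - 2 * \<sigma> * (of_bool (P m) * (\<psi> m - v) * w m - of_bool (P m) * (w m * pc (X m t) t))"
        by (cases "P m") (auto simp: algebra_simps)
    qed (use i0 i1 in simp)+
    also have "\<dots> = (\<integral>m. (side \<alpha> m + side \<beta> m) * (\<psi> m - v - pc (X m t) t) * bump S (\<sigma> * (X m t - (v * t + (q0 - v * t0)))) \<partial>labels)"
      by (intro Bochner_Integration.integral_cong[OF refl], subst sides) (auto simp: q w_def algebra_simps)
    finally show ?thesis .
  qed
  show ?thesis
  proof (intro exI[of _ h] conjI ballI h(1))
    fix t assume t: "t \<in> {t0..t0 + h}"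
    have t': "0 \<le> t" using t t0 by simp
    have F: "(\<integral>m. (side \<alpha> m + side \<beta> m) * \<Theta> (X m r - (v * r + (q0 - v * t0))) \<partial>labels) =
        (\<integral>m. - 2 * (of_bool (P m) * \<Xi> (\<sigma> * (X m r - q r))) \<partial>labels)" for r
      by (intro Bochner_Integration.integral_cong[OF refl], subst sides) (auto simp: q \<Theta>_def \<sigma>2)
    have int: "integrable labels (\<lambda>m. of_bool (P m) * \<Xi> (\<sigma> * (X m t - q t)))"
      by (rule integrable_quantile[OF t' mP, of 1])
        (auto intro!: continuous_on_compose2[OF c\<Xi>] continuous_intros)
    have nn: "AE m in labels. 0 \<le> of_bool (P m) * \<Xi> (\<sigma> * (X m t - q t))"
      using \<Xi>(3) by simp
    \<comment> \<open>Nothing has passed the barrier at \<open>t0\<close>. By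
      \<open>evolution_mono\<close> the integral of \<Xi>, multiplied by -2, does not decrease, so
      this nonnegative integral stays zero.\<close>
    have init0: "(\<integral>m. - 2 * (of_bool (P m) * \<Xi> (\<sigma> * (X m t0 - q t0))) \<partial>labels) = (\<integral>m. 0 \<partial>labels)"
      using init by (intro Bochner_Integration.integral_cong) (auto simp: q_def intro!: \<Xi>(2))
    have "(\<integral>m. of_bool (P m) * \<Xi> (\<sigma> * (X m t - q t)) \<partial>labels) \<le> 0"
    proof (cases "t = t0")
      case True
      then show ?thesis using init0 by simp
    next
      case False
      have "(\<integral>m. (side \<alpha> m + side \<beta> m) * \<Theta> (X m t0 - (v * t0 + (q0 - v * t0))) \<partial>labels) \<le>
            (\<integral>m. (side \<alpha> m + side \<beta> m) * \<Theta> (X m t - (v * t + (q0 - v * t0))) \<partial>labels)"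
      proof (rule evolution_mono[OF \<alpha>\<beta> smooth bump_nonneg _ \<Theta>])
        show "bump S (\<sigma> * z) = 0" if "2 * S \<le> \<bar>z\<bar>" for z using that \<sigma> by (intro bump_eq_0) auto
      qed (use t t0 False D in auto)
      then show ?thesis unfolding F init0 by simp
    qed
    moreover have "0 \<le> (\<integral>m. of_bool (P m) * \<Xi> (\<sigma> * (X m t - q t)) \<partial>labels)" by (rule integral_nonneg_AE[OF nn])
    ultimately have "AE m in labels. of_bool (P m) * \<Xi> (\<sigma> * (X m t - q t)) = 0"
      using integral_nonneg_eq_0_iff_AE[OF int nn] by simp
    then have "AE m in labels. P m \<longrightarrow> \<sigma> * X m t \<le> \<sigma> * q t"
    proof eventually_elim
      case (elim m)
      then show ?case using \<Xi>(4)[OF S, of "\<sigma> * (X m t - q t)"]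
        by (cases "0 < \<sigma> * (X m t - q t)") (auto simp: algebra_simps)
    qed
    then show "AE m in labels. P m \<longrightarrow> \<sigma> * X m t \<le> \<sigma> * (q0 + (t - t0) * (c - pc q0 t0 + \<sigma> * e))"
      by (simp add: q_def v_def mult.commute)
  qed
qed

text \<open>An increasing weight on the labels up to \<open>b\<close> has superlevel sets (s, b], up
  to one label. Over them \<open>\<psi> m - c\<close> integrates to A b - A s - c (b - s), which is
  at most 0 because the line of slope \<open>c\<close> through the graph at \<open>b\<close> lies
  below \<open>A\<close> at \<open>s\<close>.\<close>

lemma upper_barrier:
  assumes b: "b \<in> {- 1/2<..1/2}" and sub: "\<And>s. s \<in> {- 1/2..b} \<Longrightarrow> A b - c * (b - s) \<le> A s"
    and t0: "0 \<le> t0" and e: "0 < e"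
  shows "\<exists>h>0. \<forall>t\<in>{t0..t0 + h}. X b t \<le> X b t0 + (t - t0) * (c - pc (X b t0) t0 + e)"
proof -
  have "\<exists>h>0. \<forall>t\<in>{t0..t0 + h}. AE m in labels. m \<le> b \<longrightarrow>
      1 * X m t \<le> 1 * (X b t0 + (t - t0) * (c - pc (X b t0) t0 + 1 * e))"
  proof (rule barrier[of 1 b "1/2"])
    show "side b m + side (1/2) m = - 2 * 1 * of_bool (m \<le> b)" if "m \<in> {- 1/2<..1/2}" for m
      using that by (auto simp: side_def)
    show P: "Measurable.pred labels (\<lambda>m. m \<le> b)" by (intro measurable_labelsI) simp
    show "1 * (X m t0 - X b t0) \<le> 0" if "m \<in> {- 1/2<..1/2}" "m \<le> b" for m
    proof -
      interpret t: bounded_distribution "\<rho> t0" "SOME R. bounded_distribution (\<rho> t0) R"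
        using bounded_dist[OF t0] by (simp add: some_eq_ex)
      show ?thesis using t.quantile_mono[OF that(1) b that(2)] by simp
    qed
    fix w :: "real \<Rightarrow> real" and l :: real
    assume w [measurable]: "w \<in> borel_measurable labels"
      and mono: "\<And>m m'. m \<in> {- 1/2<..1/2} \<Longrightarrow> m' \<in> {- 1/2<..1/2} \<Longrightarrow> 1 * m \<le> 1 * m' \<Longrightarrow> w m \<le> w m'"
    obtain s where s: "s \<in> {- 1/2..b}" "\<And>m. m \<in> {- 1/2<..b} \<Longrightarrow> m \<noteq> s \<Longrightarrow> l \<le> w m \<longleftrightarrow> s < m"
    proof (rule upward_closed_threshold[of "- 1/2" b "\<lambda>m. l \<le> w m"])
      show "l \<le> w m'" if "m \<in> {- 1/2<..b}" "m' \<in> {- 1/2<..b}" "m \<le> m'" "l \<le> w m" for m m'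
        using mono[of m m'] that b by auto
    qed (use b that in auto)
    have "(\<integral>m. of_bool (m \<le> b \<and> l \<le> w m) * (\<psi> m - c) \<partial>labels) = A b - A s - c * (b - s)"
    proof (rule integral_slope_AE)
      note [measurable] = P
      show "Measurable.pred labels (\<lambda>m. m \<le> b \<and> l \<le> w m)" by measurable
      show "AE m in labels. (m \<le> b \<and> l \<le> w m) \<longleftrightarrow> s < m \<and> m \<le> b"
        using AE_labels_neq[of s]
      proof eventually_elim
        case (elim m)
        then show ?case using s(2)[of m] by auto
      qed
    qed (use s b in auto)
    then show "1 * (\<integral>m. of_bool (m \<le> b \<and> l \<le> w m) * (\<psi> m - c) \<partial>labels) \<le> 0" using sub[OF s(1)] by simp
  qed (use b t0 e in auto)
  then obtain h where h: "0 < h" "\<And>t. t \<in> {t0..t0 + h} \<Longrightarrow> AE m in labels. m \<le> b \<longrightarrow>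
      X m t \<le> X b t0 + (t - t0) * (c - pc (X b t0) t0 + e)" by auto
  show ?thesis
  proof (intro exI[of _ h] conjI ballI h(1))
    fix t assume t: "t \<in> {t0..t0 + h}"
    then obtain R where "bounded_distribution (\<rho> t) R" using bounded_dist[of t] t0 by auto
    then interpret t: bounded_distribution "\<rho> t" R .
    show "X b t \<le> X b t0 + (t - t0) * (c - pc (X b t0) t0 + e)"
    proof (rule ccontr)
      \<comment> \<open>The barrier holds for almost every label up to \<open>b\<close>. If
        \<open>X b\<close> violated it, so would a whole interval of labels below \<open>b\<close>,
        by left continuity of the quantile.\<close>
      assume "\<not> X b t \<le> X b t0 + (t - t0) * (c - pc (X b t0) t0 + e)"
      then obtain m where m: "m < b" "- 1/2 \<le> m"
        "\<And>m'. m' \<in> {m<..b} \<Longrightarrow> X b t0 + (t - t0) * (c - pc (X b t0) t0 + e) < X m' t"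
        using t.quantile_approx[OF b] by (metis not_le)
      have "{m<..b} \<subseteq> {- 1/2<..1/2}" using m(2) b by auto
      from AE_labels_interval[OF h(2)[OF t] m(1) this]
      obtain m' where "m' \<in> {m<..b}" "m' \<le> b \<longrightarrow> X m' t \<le> X b t0 + (t - t0) * (c - pc (X b t0) t0 + e)" by (elim bexE)
      then show False using m(3)[of m'] by simp
    qed
  qed
qed

text \<open>The mirror image: weights decrease in the label and have superlevel sets (a, s], hence
  the threshold is taken for the complement.\<close>

lemma lower_barrier:
  assumes a: "a \<in> {- 1/2..<1/2}" and sub: "\<And>s. s \<in> {a..1/2} \<Longrightarrow> A a + c * (s - a) \<le> A s"
    and t0: "0 \<le> t0" and e: "0 < e"
  shows "\<exists>h>0. \<forall>t\<in>{t0..t0 + h}. Xu a t0 + (t - t0) * (c - pc (Xu a t0) t0 - e) \<le> Xu a t"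
proof -
  have "\<exists>h>0. \<forall>t\<in>{t0..t0 + h}. AE m in labels. a < m \<longrightarrow>
      - 1 * X m t \<le> - 1 * (Xu a t0 + (t - t0) * (c - pc (Xu a t0) t0 + - 1 * e))"
  proof (rule barrier[of "- 1" a "- 1/2"])
    show "side a m + side (- 1/2) m = - 2 * - 1 * of_bool (a < m)" if "m \<in> {- 1/2<..1/2}" for m
      using that by (auto simp: side_def)
    show P: "Measurable.pred labels (\<lambda>m. a < m)" by (intro measurable_labelsI) simp
    show "- 1 * (X m t0 - Xu a t0) \<le> 0" if "m \<in> {- 1/2<..1/2}" "a < m" for m
    proof -
      interpret t: bounded_distribution "\<rho> t0" "SOME R. bounded_distribution (\<rho> t0) R"
        using bounded_dist[OF t0] by (simp add: some_eq_ex)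
      show ?thesis using t.upper_quantile_le_quantile[OF a that] by simp
    qed
    fix w :: "real \<Rightarrow> real" and l :: real
    assume w [measurable]: "w \<in> borel_measurable labels"
      and mono: "\<And>m m'. m \<in> {- 1/2<..1/2} \<Longrightarrow> m' \<in> {- 1/2<..1/2} \<Longrightarrow> - 1 * m \<le> - 1 * m' \<Longrightarrow> w m \<le> w m'"
    obtain s where s: "s \<in> {a..1/2}" "\<And>m. m \<in> {a<..1/2} \<Longrightarrow> m \<noteq> s \<Longrightarrow> \<not> l \<le> w m \<longleftrightarrow> s < m"
    proof (rule upward_closed_threshold[of a "1/2" "\<lambda>m. \<not> l \<le> w m"])
      show "\<not> l \<le> w m'" if "m \<in> {a<..1/2}" "m' \<in> {a<..1/2}" "m \<le> m'" "\<not> l \<le> w m" for m m'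
        using mono[of m' m] that a by auto
    qed (use a that in auto)
    have "(\<integral>m. of_bool (a < m \<and> l \<le> w m) * (\<psi> m - c) \<partial>labels) = A s - A a - c * (s - a)"
    proof (rule integral_slope_AE)
      note [measurable] = P
      show "Measurable.pred labels (\<lambda>m. a < m \<and> l \<le> w m)" by measurable
      show "AE m in labels. (a < m \<and> l \<le> w m) \<longleftrightarrow> a < m \<and> m \<le> s"
        using AE_labels_neq[of s]
      proof eventually_elim
        case (elim m)
        then show ?case using s(2)[of m] by auto
      qed
    qed (use s a in auto)
    then show "- 1 * (\<integral>m. of_bool (a < m \<and> l \<le> w m) * (\<psi> m - c) \<partial>labels) \<le> 0" using sub[OF s(1)] by simp
  qed (use a t0 e in auto)
  then obtain h where h: "0 < h" "\<And>t. t \<in> {t0..t0 + h} \<Longrightarrow> AE m in labels. a < m \<longrightarrow>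
      - 1 * X m t \<le> - 1 * (Xu a t0 + (t - t0) * (c - pc (Xu a t0) t0 + - 1 * e))" by blast
  show ?thesis
  proof (intro exI[of _ h] conjI ballI h(1))
    fix t assume t: "t \<in> {t0..t0 + h}"
    then obtain R where "bounded_distribution (\<rho> t) R" using bounded_dist[of t] t0 by auto
    then interpret t: bounded_distribution "\<rho> t" R .
    show "Xu a t0 + (t - t0) * (c - pc (Xu a t0) t0 - e) \<le> Xu a t"
    proof (rule ccontr)
      assume "\<not> Xu a t0 + (t - t0) * (c - pc (Xu a t0) t0 - e) \<le> Xu a t"
      \<comment> \<open>Labels just above \<open>a\<close> have quantiles at most \<open>y\<close>
        for any \<open>y\<close> beyond \<open>Xu a t\<close>, though perhaps not at most
        \<open>Xu a t\<close> itself.\<close>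
      then obtain y where y: "Xu a t < y" "y < Xu a t0 + (t - t0) * (c - pc (Xu a t0) t0 - e)"
        using dense by (metis not_le)
      obtain m where m: "a < m" "m \<le> 1/2" "\<And>m'. m' \<in> {a<..m} \<Longrightarrow> X m' t \<le> y"
        using t.upper_quantile_approx[OF a y(1)] by blast
      have "{a<..m} \<subseteq> {- 1/2<..1/2}" using m(2) a by auto
      from AE_labels_interval[OF h(2)[OF t] m(1) this]
      obtain m' where "m' \<in> {a<..m}" "a < m' \<longrightarrow> - 1 * X m' t \<le> - 1 * (Xu a t0 + (t - t0) * (c - pc (Xu a t0) t0 + - 1 * e))" by (elim bexE)
      then show False using m(3)[of m'] y(2) by simp
    qed
  qed
qed

end

section \<open>Growth and decay of gaps\<close>

text \<open>Induction along the real line: \<open>step\<close> carries the bound past the supremum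
  of the good times, and the bound holds at the supremum by lower semicontinuity, the half of
  continuity under which upper bounds pass to the limit.\<close>

lemma right_increment_bound:
  fixes f :: "real \<Rightarrow> real"
  assumes T: "0 \<le> T" "T \<le> t"
    and lsc: "\<And>s y. T \<le> s \<Longrightarrow> y < f s \<Longrightarrow> \<forall>\<^sub>F u in at s within {0..}. y < f u"
    and step: "\<And>s. T \<le> s \<Longrightarrow> \<exists>h>0. \<forall>u\<in>{s..s + h}. f u \<le> f s + k * (u - s)"
  shows "f t \<le> f T + k * (t - T)"
proof -
  define S where "S = {s \<in> {T..t}. \<forall>u\<in>{T..s}. f u \<le> f T + k * (u - T)}"
  have TS: "T \<in> S" using T by (auto simp: S_def)
  have bdd: "bdd_above S" by (rule bdd_aboveI[of _ t]) (auto simp: S_def)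
  define s where "s = Sup S"
  have s: "T \<le> s" "s \<le> t"
  proof -
    show "T \<le> s" unfolding s_def by (rule cSup_upper[OF TS bdd])
    have "S \<noteq> {}" using TS by blast
    then show "s \<le> t" unfolding s_def by (rule cSup_least) (simp add: S_def)
  qed
  have below: "f u \<le> f T + k * (u - T)" if "T \<le> u" "u < s" for u
  proof -
    have "S \<noteq> {}" using TS by blast
    from less_cSupD[OF this that(2)[unfolded s_def]] obtain r where "r \<in> S" "u < r" by (elim bexE exE conjE)
    then show ?thesis using that by (auto simp: S_def)
  qed
  have at_s: "f s \<le> f T + k * (s - T)"
  proof (rule ccontr)
    assume n: "\<not> ?thesis"
    then have "T < s" using s by (cases "s = T") auto
    obtain y where y: "f T + k * (s - T) < y" "y < f s" using n dense by (metis not_le)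
    have "\<forall>\<^sub>F u in at s within {0..}. y < f u" using lsc y s by blast
    moreover have "((\<lambda>u. f T + k * (u - T)) \<longlongrightarrow> f T + k * (s - T)) (at s within {0..})"
      by (intro tendsto_intros)
    then have "\<forall>\<^sub>F u in at s within {0..}. f T + k * (u - T) < y"
      using y by (intro order_tendstoD)
    ultimately have "\<forall>\<^sub>F u in at s within {0..}. f T + k * (u - T) < f u"
      by eventually_elim simp
    then obtain d where d: "0 < d" "\<And>u. u \<in> {0..} \<Longrightarrow> u \<noteq> s \<Longrightarrow> dist u s < d \<Longrightarrow> f T + k * (u - T) < f u"
      unfolding eventually_at by blast
    define u where "u = max T (s - d / 2)"
    have "T \<le> u" "u < s" "dist u s < d" "0 \<le> u" using \<open>T < s\<close> d(1) T by (auto simp: u_def dist_real_def)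
    then show False using d(2)[of u] below[of u] by simp
  qed
  have "s = t"
  proof (rule ccontr)
    assume "s \<noteq> t"
    then have "s < t" using s by simp
    obtain h where h: "0 < h" "\<And>u. u \<in> {s..s + h} \<Longrightarrow> f u \<le> f s + k * (u - s)" using step[OF s(1)] by blast
    define r where "r = min t (s + h)"
    have "r \<in> S"
      unfolding S_def
    proof (intro CollectI conjI ballI)
      show "r \<in> {T..t}" using s h by (auto simp: r_def)
      fix u assume u: "u \<in> {T..r}"
      show "f u \<le> f T + k * (u - T)"
      proof (cases "u < s")
        case False
        then have "f u \<le> f s + k * (u - s)" using u by (intro h) (auto simp: r_def)
        also have "\<dots> \<le> f T + k * (u - T)" using at_s by (simp add: algebra_simps)
        finally show ?thesis .
      qed (use below u in auto)
    qed
    then have "r \<le> s" unfolding s_def by (rule cSup_upper[OF _ bdd])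
    then show False using \<open>s < t\<close> h by (simp add: r_def)
  qed
  then show ?thesis using at_s by simp
qed

lemma exponential_decay:
  fixes f :: "real \<Rightarrow> real"
  assumes t: "0 \<le> t" and k: "0 \<le> k" and nonneg: "\<And>s. 0 \<le> s \<Longrightarrow> 0 \<le> f s"
    and lsc: "\<And>s y. 0 \<le> s \<Longrightarrow> y < f s \<Longrightarrow> \<forall>\<^sub>F u in at s within {0..}. y < f u"
    and step: "\<And>s e. 0 \<le> s \<Longrightarrow> 0 < e \<Longrightarrow> \<exists>h>0. \<forall>u\<in>{s..s + h}. f u \<le> f s + (u - s) * (- k * f s + e)"
  shows "f t \<le> f 0 * exp (- k * t)"
proof -
  define g where "g s = exp (k * s) * f s" for s
  have "g t \<le> g 0 + e * (t - 0)" if e: "0 < e" for e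
  proof (rule right_increment_bound)
    fix s y assume s: "0 \<le> s" and y: "y < g s"
    then have "y * exp (- k * s) < f s" by (simp add: g_def exp_minus field_simps)
    then obtain z where z: "y * exp (- k * s) < z" "z < f s" using dense by blast
    have "((\<lambda>u. y * exp (- k * u)) \<longlongrightarrow> y * exp (- k * s)) (at s within {0..})" by (intro tendsto_intros)
    then have "\<forall>\<^sub>F u in at s within {0..}. y * exp (- k * u) < z" using z by (intro order_tendstoD)
    with lsc[OF s z(2)] show "\<forall>\<^sub>F u in at s within {0..}. y < g u"
    proof eventually_elim
      case (elim u)
      then have "y * exp (- k * u) < f u" by simp
      then show ?case by (simp add: g_def exp_minus field_simps)
    qed
  next
    fix s :: real assume s: "0 \<le> s"
    \<comment> \<open>Absorbs the factor exp (k u) during the next unit of time, so that the error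
      of \<open>g\<close> is \<open>e\<close> at every \<open>s\<close>. The step is cut to length 1
      accordingly.\<close>
    define e' where "e' = e * exp (- k * (s + 1))"
    have "0 < e'" using e by (simp add: e'_def)
    then obtain h where h: "0 < h" "\<And>u. u \<in> {s..s + h} \<Longrightarrow> f u \<le> f s + (u - s) * (- k * f s + e')"
      using step[OF s] by blast
    show "\<exists>h>0. \<forall>u\<in>{s..s + h}. g u \<le> g s + e * (u - s)"
    proof (intro exI[of _ "min h 1"] conjI ballI)
      fix u assume u: "u \<in> {s..s + min h 1}"
      have "f u \<le> f s * (1 - k * (u - s)) + (u - s) * e'"
      proof -
        have "u \<in> {s..s + h}" using u by (auto simp: min_def split: if_splits)
        from h(2)[OF this] show ?thesis by (simp add: algebra_simps)
      qed
      also have "\<dots> \<le> f s * exp (- (k * (u - s))) + (u - s) * e'"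
        using exp_ge_add_one_self[of "- (k * (u - s))"] nonneg[OF s] by (intro add_right_mono mult_left_mono) auto
      finally have "g u \<le> exp (k * u) * (f s * exp (- (k * (u - s))) + (u - s) * e')"
        unfolding g_def by (intro mult_left_mono) auto
      also have "\<dots> = f s * (exp (k * u) * exp (- (k * (u - s)))) + (u - s) * e * (exp (k * u) * exp (- k * (s + 1)))"
        by (simp add: e'_def algebra_simps)
      also have "exp (k * u) * exp (- (k * (u - s))) = exp (k * s)"
        by (simp flip: exp_add add: algebra_simps)
      also have "exp (k * u) * exp (- k * (s + 1)) = exp (k * (u - (s + 1)))"
        by (simp flip: exp_add add: algebra_simps)
      also have "f s * exp (k * s) + (u - s) * e * exp (k * (u - (s + 1))) \<le> f s * exp (k * s) + (u - s) * e * 1"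
        using u e k by (intro add_left_mono mult_left_mono) (auto simp: mult_nonneg_nonpos)
      finally show "g u \<le> g s + e * (u - s)" by (simp add: g_def mult_ac)
    qed (use h in simp)
  qed (use t in auto)
  then have "g t \<le> g 0 + e" if "0 < e" for e
  proof -
    have "g t \<le> g 0 + e / (t + 1) * t" using \<open>\<And>e. 0 < e \<Longrightarrow> g t \<le> g 0 + e * (t - 0)\<close>[of "e / (t + 1)"] that t by simp
    also have "e / (t + 1) * t \<le> e" using that t by (simp add: field_simps)
    finally show ?thesis by simp
  qed
  then have "g t \<le> g 0" by (rule field_le_epsilon)
  then show ?thesis by (simp add: g_def exp_minus field_simps)
qed

text \<open>A modulus of continuity at every point from the behaviour at 0 alone. On one side of the
  origin it is subadditivity; an increment across 0 splits into two parts, each at most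
  \<open>potential \<phi> d\<close>, whence the factor 2.\<close>

lemma (in kernel) potential_increment:
  assumes "0 \<le> d" shows "potential \<phi> (z + d) - potential \<phi> z \<le> 2 * potential \<phi> d"
proof -
  have d0: "0 \<le> potential \<phi> d" using potential_nonneg[OF assms] .
  consider "0 \<le> z" | "z + d \<le> 0" | "z < 0" "0 < z + d" by linarith
  then show ?thesis
  proof cases
    case 1
    then show ?thesis using potential_subadditive[OF 1 assms] d0 by simp
  next
    case 2
    then show ?thesis
      using potential_subadditive[of "- (z + d)" d] potential_minus[of z] potential_minus[of "z + d"] assms d0 by simp
  next
    case 3
    then show ?thesis
      using potential_mono[of "z + d" d] potential_mono[of "- z" d] potential_minus[of z] by simp
  qed
qed

section \<open>Gaps between two quantiles\<close>

context flow
begin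

lemma obtain_dist:
  assumes "0 \<le> t" obtains R where "bounded_distribution (\<rho> t) R"
  using bounded_dist[OF assms] by blast

text \<open>Two barriers with error e/2 each. The order of \<open>a\<close> and \<open>b\<close> is
  left open: for a < b the difference is a width to be shown to shrink, for b at most a it is minus
  a gap to be shown to grow.\<close>

lemma gap_step:
  assumes b: "b \<in> {- 1/2<..1/2}" "\<And>s. s \<in> {- 1/2..b} \<Longrightarrow> A b - c * (b - s) \<le> A s"
    and a: "a \<in> {- 1/2..<1/2}" "\<And>s. s \<in> {a..1/2} \<Longrightarrow> A a + c' * (s - a) \<le> A s"
    and t0: "0 \<le> t0" and e: "0 < e"
  shows "\<exists>h>0. \<forall>t\<in>{t0..t0 + h}. X b t - Xu a t \<le>
    X b t0 - Xu a t0 + (t - t0) * (c - c' - (pc (X b t0) t0 - pc (Xu a t0) t0) + e)"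
proof -
  have e2: "0 < e / 2" using e by simp
  obtain h1 where h1: "0 < h1" "\<And>t. t \<in> {t0..t0 + h1} \<Longrightarrow> X b t \<le> X b t0 + (t - t0) * (c - pc (X b t0) t0 + e / 2)"
    using upper_barrier[OF b t0 e2] by blast
  obtain h2 where h2: "0 < h2" "\<And>t. t \<in> {t0..t0 + h2} \<Longrightarrow> Xu a t0 + (t - t0) * (c' - pc (Xu a t0) t0 - e / 2) \<le> Xu a t"
    using lower_barrier[OF a t0 e2] by blast
  show ?thesis
  proof (intro exI[of _ "min h1 h2"] conjI ballI)
    fix t assume "t \<in> {t0..t0 + min h1 h2}"
    then have "X b t \<le> X b t0 + (t - t0) * (c - pc (X b t0) t0 + e / 2)"
      "Xu a t0 + (t - t0) * (c' - pc (Xu a t0) t0 - e / 2) \<le> Xu a t"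
      by (intro h1 h2; auto)+
    then show "X b t - Xu a t \<le> X b t0 - Xu a t0 + (t - t0) * (c - c' - (pc (X b t0) t0 - pc (Xu a t0) t0) + e)"
      by (simp add: field_simps)
  qed (use h1 h2 in simp)
qed

lemma gap_lsc:
  assumes "0 \<le> s" "b \<in> {- 1/2<..1/2}" "a \<in> {- 1/2..<1/2}" "y < X b s - Xu a s"
  shows "\<forall>\<^sub>F t in at s within {0..}. y < X b t - Xu a t"
proof -
  define d where "d = (X b s - Xu a s - y) / 2"
  have "\<forall>\<^sub>F t in at s within {0..}. X b s - d < X b t"
    using assms by (intro quantile_lsc) (auto simp: d_def)
  moreover have "\<forall>\<^sub>F t in at s within {0..}. Xu a t < Xu a s + d"
    using assms by (intro upper_quantile_usc) (auto simp: d_def)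
  ultimately show ?thesis by eventually_elim (simp add: d_def field_simps)
qed

lemma pc_diff:
  assumes "0 \<le> t"
  shows "pc x t - pc y t = (\<integral>m. potential \<phi> (x - X m t) - potential \<phi> (y - X m t) \<partial>labels)"
  unfolding potential_conv_eq[OF assms] using integrable_potential[OF assms] by simp

lemma pc_diff_le:
  assumes "0 \<le> t" "\<And>m. m \<in> {- 1/2<..1/2} \<Longrightarrow> potential \<phi> (x - X m t) - potential \<phi> (y - X m t) \<le> B"
  shows "pc x t - pc y t \<le> B"
  unfolding pc_diff[OF assms(1)]
  using assms(2) integrable_potential[OF assms(1)] by (intro labels.integral_le_const) (auto intro!: AE_I2)

lemma pc_diff_ge:
  assumes "0 \<le> t" "\<And>m. m \<in> {- 1/2<..1/2} \<Longrightarrow> B \<le> potential \<phi> (x - X m t) - potential \<phi> (y - X m t)"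
  shows "B \<le> pc x t - pc y t"
  unfolding pc_diff[OF assms(1)]
  using assms(2) integrable_potential[OF assms(1)] by (intro labels.integral_ge_const) (auto intro!: AE_I2)

lemma msupport_sub_Icc:
  assumes "0 \<le> t" shows "msupport (\<rho> t) \<subseteq> {Xu (- 1/2) t..X (1/2) t}"
proof
  fix x assume x: "x \<in> msupport (\<rho> t)"
  obtain R where "bounded_distribution (\<rho> t) R" using obtain_dist[OF assms] .
  then interpret t: bounded_distribution "\<rho> t" R .
  let ?I = "{Xu (- 1/2) t..X (1/2) t}"
  have "AE y in distr labels borel (quantile (\<rho> t)). y \<in> ?I"
  proof (subst AE_distr_iff[OF t.measurable_quantile])
    show "AE m in labels. X m t \<in> ?I"
    proof (rule AE_I2)
      fix m assume "m \<in> space labels"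
      then have "m \<in> {- 1/2<..1/2}" by simp
      then show "X m t \<in> ?I" using t.quantile_mono[of m "1/2"] t.upper_quantile_le_quantile[of "- 1/2" m] by auto
    qed
  qed simp
  then have AE: "AE y in \<rho> t. y \<in> ?I" unfolding t.distr_quantile .
  show "x \<in> ?I"
  proof (rule ccontr)
    assume "x \<notin> ?I"
    then have "x \<in> - ?I" "open (- ?I)" by auto
    then obtain e where e: "0 < e" "ball x e \<subseteq> - ?I" unfolding open_contains_ball by blast
    have "AE y in \<rho> t. y \<notin> ball x e" using AE by eventually_elim (use e in blast)
    then have "emeasure (\<rho> t) (ball x e) = 0"
      by (subst (asm) AE_iff_measurable[of "ball x e"]) auto
    then show False using x e by (auto simp: msupport_def)
  qed
qed

lemma slope_bound:
  assumes "s \<in> {- 1/2..1/2}" "b \<in> {- 1/2..1/2}" "s \<le> b"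
  shows "A b - K * (b - s) \<le> A s" "A s + (- K) * (b - s) \<le> A b"
proof -
  have "0 \<le> (\<integral>m. of_bool (s < m \<and> m \<le> b) * (K - \<psi> m) \<partial>labels)"
  proof (intro integral_nonneg_AE AE_I2 mult_nonneg_nonneg)
    show "0 \<le> K - \<psi> m" for m using \<psi>_bounded[of m] by linarith
  qed auto
  also have "\<dots> = (\<integral>m. - (of_bool (s < m \<and> m \<le> b) * (\<psi> m - K)) \<partial>labels)"
    by (intro Bochner_Integration.integral_cong) (auto simp: algebra_simps)
  finally have "(\<integral>m. of_bool (s < m \<and> m \<le> b) * (\<psi> m - K) \<partial>labels) \<le> 0" by simp
  then show "A b - K * (b - s) \<le> A s" unfolding integral_slope[OF assms] by simp
  have "0 \<le> (\<integral>m. of_bool (s < m \<and> m \<le> b) * (\<psi> m - (- K)) \<partial>labels)"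
  proof (intro integral_nonneg_AE AE_I2 mult_nonneg_nonneg)
    show "0 \<le> \<psi> m - - K" for m using \<psi>_bounded[of m] by linarith
  qed auto
  then show "A s + (- K) * (b - s) \<le> A b" unfolding integral_slope[OF assms] by simp
qed

lemma diameter_bounded:
  assumes "heavy_tailed \<phi>"
  shows "\<exists>D. uniform_diameter_bound \<rho> D"
proof -
  define \<Delta> where "\<Delta> t = X (1/2) t - Xu (- 1/2) t" for t
  \<comment> \<open>At width \<open>R0\<close> the attraction outweighs 2K, the largest relative
    speed of the two ends, whose supporting lines have slopes K and -K.\<close>
  obtain R0 where R0: "max 1 (\<Delta> 0) \<le> R0" "2 * K < potential \<phi> R0"
    using heavy_tailed_unbounded[OF assms] by blast
  have gap: "\<exists>h>0. \<forall>t\<in>{t0..t0 + h}. \<Delta> t \<le>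
    \<Delta> t0 + (t - t0) * (K - (- K) - (pc (X (1/2) t0) t0 - pc (Xu (- 1/2) t0) t0) + e)"
    if "0 \<le> t0" "0 < e" for t0 e
    unfolding \<Delta>_def
  proof (rule gap_step[OF _ _ _ _ that])
    show "A (1/2) - K * (1/2 - s) \<le> A s" if "s \<in> {- 1/2..1/2}" for s
      using slope_bound(1)[of s "1/2"] that by simp
    show "A (- 1/2) + - K * (s - - 1/2) \<le> A s" if "s \<in> {- 1/2..1/2}" for s
      using slope_bound(2)[of "- 1/2" s] that by simp
  qed auto
  \<comment> \<open>The maximum with \<open>R0\<close> is constant while the width is smaller, so
    only widths of at least \<open>R0\<close> have to be kept from growing.\<close>
  have "max (\<Delta> t) R0 \<le> max (\<Delta> 0) R0 + 0 * (t - 0)" if "0 \<le> t" for t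
  proof (rule right_increment_bound)
    fix s y assume s: "0 \<le> s" and y: "y < max (\<Delta> s) R0"
    show "\<forall>\<^sub>F u in at s within {0..}. y < max (\<Delta> u) R0"
    proof (cases "y < R0")
      case False
      then have "y < \<Delta> s" using y by simp
      then have "\<forall>\<^sub>F u in at s within {0..}. y < \<Delta> u"
        unfolding \<Delta>_def using s by (intro gap_lsc) auto
      then show ?thesis by eventually_elim simp
    qed (simp add: less_max_iff_disj)
  next
    fix s :: real assume s: "0 \<le> s"
    show "\<exists>h>0. \<forall>u\<in>{s..s + h}. max (\<Delta> u) R0 \<le> max (\<Delta> s) R0 + 0 * (u - s)"
    proof (cases "\<Delta> s < R0")
      case True
      define B where "B = K - (- K) - (pc (X (1/2) s) s - pc (Xu (- 1/2) s) s) + 1"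
      obtain h where h: "0 < h" "\<And>u. u \<in> {s..s + h} \<Longrightarrow> \<Delta> u \<le> \<Delta> s + (u - s) * B"
        using gap[OF s, of 1] unfolding B_def by auto
      \<comment> \<open>Even at speed |B| + 1 the width needs this long to reach
        \<open>R0\<close>.\<close>
      define d where "d = (R0 - \<Delta> s) / (\<bar>B\<bar> + 1)"
      have d: "0 < d" using True by (simp add: d_def)
      show ?thesis
      proof (intro exI[of _ "min h d"] conjI ballI)
        fix u assume u: "u \<in> {s..s + min h d}"
        have "(u - s) * B \<le> d * (\<bar>B\<bar> + 1)"
          using u d by (intro order_trans[OF mult_left_mono[of B "\<bar>B\<bar> + 1"] mult_right_mono]) auto
        also have "\<dots> = R0 - \<Delta> s" by (simp add: d_def)
        finally have "(u - s) * B \<le> R0 - \<Delta> s" .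
        moreover have "u \<in> {s..s + h}" using u by (auto simp: min_def split: if_splits)
        note h(2)[OF this]
        ultimately have "\<Delta> u \<le> R0" by simp
        then show "max (\<Delta> u) R0 \<le> max (\<Delta> s) R0 + 0 * (u - s)" by simp
      qed (use h d in simp)
    next
      case False
      obtain R where "bounded_distribution (\<rho> s) R" using obtain_dist[OF s] .
      then interpret s: bounded_distribution "\<rho> s" R .
      have "potential \<phi> R0 \<le> potential \<phi> (\<Delta> s)" using False by (intro potential_mono) simp
      \<comment> \<open>Every label lies between the two ends and attracts both; by subadditivity
        the sum of the two attractions is at least the potential of the whole width.\<close>
      also have "\<dots> \<le> pc (X (1/2) s) s - pc (Xu (- 1/2) s) s"
      proof (rule pc_diff_ge[OF s])
        fix m :: real assume m: "m \<in> {- 1/2<..1/2}"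
        have "potential \<phi> ((X (1/2) s - X m s) + (X m s - Xu (- 1/2) s)) \<le>
            potential \<phi> (X (1/2) s - X m s) + potential \<phi> (X m s - Xu (- 1/2) s)"
          using s.quantile_mono[OF m, of "1/2"] s.upper_quantile_le_quantile[OF _ m, of "- 1/2"] m
          by (intro potential_subadditive) auto
        then show "potential \<phi> (\<Delta> s) \<le> potential \<phi> (X (1/2) s - X m s) - potential \<phi> (Xu (- 1/2) s - X m s)"
          using potential_minus[of "X m s - Xu (- 1/2) s"] by (simp add: \<Delta>_def)
      qed
      finally have le: "potential \<phi> R0 \<le> pc (X (1/2) s) s - pc (Xu (- 1/2) s) s" .
      \<comment> \<open>The excess of \<open>potential \<phi> R0\<close> over 2K is spent as the
        error, which leaves a nonpositive rate.\<close>
      obtain h where h: "0 < h" "\<And>u. u \<in> {s..s + h} \<Longrightarrow> \<Delta> u \<le>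
          \<Delta> s + (u - s) * (K - (- K) - (pc (X (1/2) s) s - pc (Xu (- 1/2) s) s) + (potential \<phi> R0 - 2 * K))"
        using gap[OF s, of "potential \<phi> R0 - 2 * K"] R0 by auto
      have "\<Delta> u \<le> \<Delta> s" if "u \<in> {s..s + h}" for u
      proof -
        have "(u - s) * (K - (- K) - (pc (X (1/2) s) s - pc (Xu (- 1/2) s) s) + (potential \<phi> R0 - 2 * K)) \<le> 0"
          using that le by (intro mult_nonneg_nonpos) auto
        then show ?thesis using h(2)[OF that] by linarith
      qed
      then show ?thesis using h(1) by (intro exI[of _ h]) fastforce
    qed
  qed (use that in auto)
  then have \<Delta>: "\<Delta> t \<le> R0" if "0 \<le> t" for t using that R0 by fastforce
  have "uniform_diameter_bound \<rho> R0"
    unfolding uniform_diameter_bound_def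
  proof (intro conjI allI impI)
    show "0 < R0" using R0 by simp
    fix t :: real assume t: "0 \<le> t"
    show "diameter (msupport (\<rho> t)) \<le> R0"
    proof (rule diameter_le)
      show "msupport (\<rho> t) \<noteq> {} \<or> 0 \<le> R0" using R0 by simp
      fix x y assume "x \<in> msupport (\<rho> t)" "y \<in> msupport (\<rho> t)"
      then have "x \<in> {Xu (- 1/2) t..X (1/2) t}" "y \<in> {Xu (- 1/2) t..X (1/2) t}"
        using msupport_sub_Icc[OF t] by blast+
      then show "norm (x - y) \<le> R0" using \<Delta>[OF t] by (auto simp: \<Delta>_def)
    qed
  qed
  then show ?thesis ..
qed

lemma gap_le_diameter:
  assumes "0 \<le> t" "x \<in> msupport (\<rho> t)" "y \<in> msupport (\<rho> t)"
  shows "\<bar>x - y\<bar> \<le> diameter (msupport (\<rho> t))"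
proof -
  obtain R where "bounded_distribution (\<rho> t) R" using obtain_dist[OF assms(1)] .
  then interpret t: bounded_distribution "\<rho> t" R .
  have "bounded (msupport (\<rho> t))" using t.msupport_sub bounded_subset bounded_closed_interval by blast
  from diameter_bounded_bound[OF this assms(2,3)] show ?thesis by (simp add: dist_real_def)
qed

lemma gap_decay:
  assumes b: "b \<in> {- 1/2<..1/2}" "\<And>s. s \<in> {- 1/2..b} \<Longrightarrow> A b - c * (b - s) \<le> A s"
    and a: "a \<in> {- 1/2..<1/2}" "\<And>s. s \<in> {a..1/2} \<Longrightarrow> A a + c * (s - a) \<le> A s"
    and "a < b" and D: "uniform_diameter_bound \<rho> D" and t: "0 \<le> t"
  shows "X b t - Xu a t \<le> diameter (msupport (\<rho> 0)) * exp (- \<phi> D * t)"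
proof -
  have supp: "X m s \<in> msupport (\<rho> s)" "Xu a s \<in> msupport (\<rho> s)" if s: "0 \<le> s" and m: "m \<in> {- 1/2<..1/2}" for m s
  proof -
    obtain R where "bounded_distribution (\<rho> s) R" using obtain_dist[OF s] .
    then interpret s: bounded_distribution "\<rho> s" R .
    show "X m s \<in> msupport (\<rho> s)" using s.quantile_in_msupport[OF m] .
    show "Xu a s \<in> msupport (\<rho> s)" using s.upper_quantile_in_msupport[OF a(1)] .
  qed
  have "X b t - Xu a t \<le> (X b 0 - Xu a 0) * exp (- \<phi> D * t)"
  proof (rule exponential_decay[OF t nonneg])
    show nn: "0 \<le> X b s - Xu a s" if s: "0 \<le> s" for s
    proof -
      obtain R where "bounded_distribution (\<rho> s) R" using obtain_dist[OF s] .
      then interpret s: bounded_distribution "\<rho> s" R .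
      show ?thesis using s.upper_quantile_le_quantile[OF a(1) b(1) \<open>a < b\<close>] by simp
    qed
    show "\<forall>\<^sub>F u in at s within {0..}. y < X b u - Xu a u" if "0 \<le> s" "y < X b s - Xu a s" for s y
      using gap_lsc[OF that(1) b(1) a(1) that(2)] .
    fix s e :: real assume s: "0 \<le> s" and e: "0 < e"
    \<comment> \<open>Differences of support points lie in [-D, D], where \<open>\<phi> D\<close>
      bounds the slope of the potential from below, for each label and hence on average.\<close>
    have le: "\<phi> D * (X b s - Xu a s) \<le> pc (X b s) s - pc (Xu a s) s"
    proof (rule pc_diff_ge[OF s])
      fix m :: real assume m: "m \<in> {- 1/2<..1/2}"
      have "\<bar>X b s - X m s\<bar> \<le> D" "\<bar>Xu a s - X m s\<bar> \<le> D"
        using gap_le_diameter[OF s supp(1)[OF s b(1)] supp(1)[OF s m]] gap_le_diameter[OF s supp(2)[OF s b(1)] supp(1)[OF s m]] D s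
        unfolding uniform_diameter_bound_def by force+
      then have "\<phi> D * ((X b s - X m s) - (Xu a s - X m s)) \<le> potential \<phi> (X b s - X m s) - potential \<phi> (Xu a s - X m s)"
        using D nn[OF s] unfolding uniform_diameter_bound_def by (intro potential_diff_ge) auto
      then show "\<phi> D * (X b s - Xu a s) \<le> potential \<phi> (X b s - X m s) - potential \<phi> (Xu a s - X m s)" by simp
    qed
    obtain h where h: "0 < h" "\<And>u. u \<in> {s..s + h} \<Longrightarrow> X b u - Xu a u \<le>
        X b s - Xu a s + (u - s) * (c - c - (pc (X b s) s - pc (Xu a s) s) + e)"
      using gap_step[OF b a s e] by blast
    show "\<exists>h>0. \<forall>u\<in>{s..s + h}. X b u - Xu a u \<le> X b s - Xu a s + (u - s) * (- \<phi> D * (X b s - Xu a s) + e)"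
    proof (intro exI[of _ h] conjI ballI h(1))
      fix u assume u: "u \<in> {s..s + h}"
      have "(u - s) * (c - c - (pc (X b s) s - pc (Xu a s) s) + e) \<le> (u - s) * (- \<phi> D * (X b s - Xu a s) + e)"
        using u le by (intro mult_left_mono) auto
      then show "X b u - Xu a u \<le> X b s - Xu a s + (u - s) * (- \<phi> D * (X b s - Xu a s) + e)"
        using h(2)[OF u] by linarith
    qed
  qed
  also have "\<dots> \<le> diameter (msupport (\<rho> 0)) * exp (- \<phi> D * t)"
    using gap_le_diameter[OF order_refl supp(1)[OF order_refl b(1)] supp(2)[OF order_refl b(1)]]
    by (intro mult_right_mono) auto
  finally show ?thesis .
qed

text \<open>The lines pull the two quantiles apart at relative speed c' - c, while their attraction
  vanishes as the gap closes.\<close>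

lemma gap_not_tendsto_0:
  assumes b: "b \<in> {- 1/2<..1/2}" "\<And>s. s \<in> {- 1/2..b} \<Longrightarrow> A b - c * (b - s) \<le> A s"
    and a: "a \<in> {- 1/2..<1/2}" "\<And>s. s \<in> {a..1/2} \<Longrightarrow> A a + c' * (s - a) \<le> A s"
    and "b \<le> a" "c < c'"
  shows "\<not> ((\<lambda>t. Xu a t - X b t) \<longlongrightarrow> 0) at_top"
proof
  assume lim: "((\<lambda>t. Xu a t - X b t) \<longlongrightarrow> 0) at_top"
  \<comment> \<open>Of the relative speed \<delta>, the attraction uses at most half, being bounded
    by twice a potential below \<delta>/4, and the barrier error a quarter, so growth at rate
    \<delta>/4 remains.\<close>
  define \<delta> where "\<delta> = c' - c"
  have \<delta>: "0 < \<delta>" using assms by (simp add: \<delta>_def)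
  have "isCont (potential \<phi>) 0" using continuous_potential by (simp add: continuous_on_eq_continuous_at)
  then have "((\<lambda>t. potential \<phi> (Xu a t - X b t)) \<longlongrightarrow> potential \<phi> 0) at_top"
    using lim by (rule isCont_tendsto_compose)
  then have "\<forall>\<^sub>F t in at_top. potential \<phi> (Xu a t - X b t) < \<delta> / 4"
    using \<delta> by (intro order_tendstoD(2)) auto
  then have "\<forall>\<^sub>F t in at_top. 0 \<le> t \<and> potential \<phi> (Xu a t - X b t) < \<delta> / 4"
    using eventually_ge_at_top[of 0] by eventually_elim simp
  then obtain T where T: "\<And>t. T \<le> t \<Longrightarrow> 0 \<le> t \<and> potential \<phi> (Xu a t - X b t) < \<delta> / 4"
    unfolding eventually_at_top_linorder by blast
  have T0: "0 \<le> T" using T[of T] by simp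
  have bound: "X b t - Xu a t \<le> X b T - Xu a T + (- \<delta> / 4) * (t - T)" if "T \<le> t" for t
  proof (rule right_increment_bound[OF T0 that])
    fix s y assume "T \<le> s" "y < X b s - Xu a s"
    then show "\<forall>\<^sub>F u in at s within {0..}. y < X b u - Xu a u"
      using T0 by (intro gap_lsc b(1) a(1)) auto
  next
    fix s assume "T \<le> s"
    then have s: "0 \<le> s" and sT: "potential \<phi> (Xu a s - X b s) < \<delta> / 4" using T by auto
    obtain R where "bounded_distribution (\<rho> s) R" using obtain_dist[OF s] .
    then interpret s: bounded_distribution "\<rho> s" R .
    have d: "0 \<le> Xu a s - X b s" using s.quantile_le_upper_quantile[OF a(1) b(1) \<open>b \<le> a\<close>] by simp
    have "pc (Xu a s) s - pc (X b s) s \<le> 2 * potential \<phi> (Xu a s - X b s)"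
    proof (rule pc_diff_le[OF s])
      show "potential \<phi> (Xu a s - X m s) - potential \<phi> (X b s - X m s) \<le> 2 * potential \<phi> (Xu a s - X b s)" for m
        using potential_increment[OF d, of "X b s - X m s"] by simp
    qed
    then have le: "c - c' - (pc (X b s) s - pc (Xu a s) s) + \<delta> / 4 \<le> - \<delta> / 4" using sT by (simp add: \<delta>_def field_simps)
    obtain h where h: "0 < h" "\<And>u. u \<in> {s..s + h} \<Longrightarrow> X b u - Xu a u \<le>
        X b s - Xu a s + (u - s) * (c - c' - (pc (X b s) s - pc (Xu a s) s) + \<delta> / 4)"
      using gap_step[OF b a s, of "\<delta> / 4"] \<delta> by auto
    show "\<exists>h>0. \<forall>u\<in>{s..s + h}. X b u - Xu a u \<le> X b s - Xu a s + (- \<delta> / 4) * (u - s)"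
    proof (intro exI[of _ h] conjI ballI h(1))
      fix u assume u: "u \<in> {s..s + h}"
      have "(u - s) * (c - c' - (pc (X b s) s - pc (Xu a s) s) + \<delta> / 4) \<le> (u - s) * (- \<delta> / 4)"
        using u le by (intro mult_left_mono) auto
      then show "X b u - Xu a u \<le> X b s - Xu a s + (- \<delta> / 4) * (u - s)"
        using h(2)[OF u] by (simp add: mult.commute)
    qed
  qed
  have "\<forall>\<^sub>F t in at_top. Xu a t - X b t < 1" using lim by (intro order_tendstoD(2)) auto
  \<comment> \<open>From this time on the linear growth has brought the gap to at least 1.\<close>
  moreover have "\<forall>\<^sub>F t in at_top. T + 4 / \<delta> * (1 + \<bar>X b T - Xu a T\<bar>) \<le> t" "\<forall>\<^sub>F t in at_top. T \<le> t" by (rule eventually_ge_at_top)+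
  ultimately have "\<forall>\<^sub>F t in at_top::real filter. False"
  proof eventually_elim
    case (elim t)
    have "\<delta> / 4 * (4 / \<delta> * (1 + \<bar>X b T - Xu a T\<bar>)) \<le> \<delta> / 4 * (t - T)"
      using elim \<delta> by (intro mult_left_mono) auto
    then have "1 + \<bar>X b T - Xu a T\<bar> \<le> \<delta> / 4 * (t - T)" using \<delta> by simp
    moreover have "X b T - Xu a T \<le> \<bar>X b T - Xu a T\<bar>" by (rule abs_ge_self)
    moreover have "X b t - Xu a t \<le> X b T - Xu a T - \<delta> / 4 * (t - T)" using bound[OF elim(3)] by simp
    ultimately show ?case using elim(1) by linarith
  qed
  then show False by simp
qed

end

section \<open>The lower convex envelope\<close>

text \<open>Convexity with denominators cleared, which also covers coinciding points.\<close>

lemma convex_on_three_points: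
  fixes f :: "real \<Rightarrow> real"
  assumes f: "convex_on S f" and S: "x \<in> S" "z \<in> S" and xyz: "x \<le> y" "y \<le> z"
  shows "(z - x) * f y \<le> (z - y) * f x + (y - x) * f z"
proof (cases "x = z")
  case True
  then show ?thesis using xyz by simp
next
  case False
  then have xz: "x < z" using xyz by simp
  define t where "t = (y - x) / (z - x)"
  have t: "0 \<le> t" "t \<le> 1" using xyz xz by (auto simp: t_def)
  have tz: "(z - x) * t = y - x" using xz by (simp add: t_def)
  then have y: "(1 - t) *\<^sub>R x + t *\<^sub>R z = y" by (simp add: algebra_simps)
  have "f y \<le> (1 - t) * f x + t * f z"
    using convex_onD[OF f t S] unfolding y .
  then have "(z - x) * f y \<le> (z - x) * ((1 - t) * f x + t * f z)"
    using xz by (intro mult_left_mono) auto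
  also have "\<dots> = (z - x - (z - x) * t) * f x + (z - x) * t * f z" by (simp add: algebra_simps)
  finally show ?thesis unfolding tz by simp
qed

locale lipschitz_flux =
  fixes A :: "real \<Rightarrow> real" and K :: real
  assumes lip: "s \<in> {- 1/2..1/2} \<Longrightarrow> b \<in> {- 1/2..1/2} \<Longrightarrow> s \<le> b \<Longrightarrow> \<bar>A b - A s\<bar> \<le> K * (b - s)"
begin

abbreviation E where "E \<equiv> convex_envelope A"

lemma lip_lines:
  assumes "s \<in> {- 1/2..1/2}" "b \<in> {- 1/2..1/2}" "s \<le> b"
  shows "A s + (- K) * (b - s) \<le> A b" "A b + K * (s - b) \<le> A s"
proof -
  have "A b - A s \<le> K * (b - s)" "A s - A b \<le> K * (b - s)" using lip[OF assms] by (simp_all add: abs_le_iff)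
  then show "A s + (- K) * (b - s) \<le> A b" "A b + K * (s - b) \<le> A s" by (simp_all add: algebra_simps)
qed

lemma K_nonneg: "0 \<le> K"
  using lip[of "- 1/2" "1/2"] by simp

lemma minorant_le_envelope:
  assumes "convex_on {- 1/2..1/2} g" "\<And>y. y \<in> {- 1/2..1/2} \<Longrightarrow> g y \<le> A y" "m \<in> {- 1/2..1/2}"
  shows "g m \<le> E m"
  unfolding convex_envelope_def
proof (rule cSup_upper)
  show "bdd_above {g m |g. convex_on {- 1/2..1/2} g \<and> (\<forall>y\<in>{- 1/2..1/2}. g y \<le> A y)}"
    using assms(3) by (intro bdd_aboveI[of _ "A m"]) auto
qed (use assms(1,2) in blast)

lemma line_le_envelope:
  assumes "\<And>y. y \<in> {- 1/2..1/2} \<Longrightarrow> p + c * (y - x) \<le> A y" "m \<in> {- 1/2..1/2}"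
  shows "p + c * (m - x) \<le> E m"
proof (rule minorant_le_envelope[where g="\<lambda>y. p + c * (y - x)", OF _ assms])
  show "convex_on {- 1/2..1/2} (\<lambda>y. p + c * (y - x))"
    by (rule convex_onI) (auto simp: algebra_simps)
qed

lemma envelope_least:
  assumes "m \<in> {- 1/2..1/2}"
    and "\<And>g. convex_on {- 1/2..1/2} g \<Longrightarrow> (\<And>y. y \<in> {- 1/2..1/2} \<Longrightarrow> g y \<le> A y) \<Longrightarrow> g m \<le> B"
  shows "E m \<le> B"
  unfolding convex_envelope_def
proof (rule cSup_least)
  have "convex_on {- 1/2..1/2} (\<lambda>y::real. A (- 1/2) - K)" by (rule convex_onI) (auto simp: algebra_simps)
  moreover have "A (- 1/2) - K \<le> A y" if "y \<in> {- 1/2..1/2}" for y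
  proof -
    have "K * (y - - 1/2) \<le> K * 1" using that K_nonneg by (intro mult_left_mono) auto
    then show ?thesis using lip[of "- 1/2" y] that by (auto simp: abs_le_iff)
  qed
  ultimately show "{g m |g. convex_on {- 1/2..1/2} g \<and> (\<forall>y\<in>{- 1/2..1/2}. g y \<le> A y)} \<noteq> {}" by blast
qed (use assms(2) in blast)

lemma envelope_le: "m \<in> {- 1/2..1/2} \<Longrightarrow> E m \<le> A m"
  by (rule envelope_least)

lemma envelope_convex: "convex_on {- 1/2..1/2} E"
proof (rule convex_onI)
  fix t x y :: real assume t: "0 < t" "t < 1" and xy: "x \<in> {- 1/2..1/2}" "y \<in> {- 1/2..1/2}"
  have z: "(1 - t) *\<^sub>R x + t *\<^sub>R y \<in> {- 1/2..1/2}"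
    using convexD_alt[OF convex_real_interval(5) xy, of t] t by simp
  show "E ((1 - t) *\<^sub>R x + t *\<^sub>R y) \<le> (1 - t) * E x + t * E y"
  proof (rule envelope_least[OF z])
    fix g assume g: "convex_on {- 1/2..1/2} g" "\<And>y. y \<in> {- 1/2..1/2} \<Longrightarrow> g y \<le> A y"
    have "g ((1 - t) *\<^sub>R x + t *\<^sub>R y) \<le> (1 - t) * g x + t * g y"
      using convex_onD[OF g(1) _ _ xy, of t] t by simp
    also have "\<dots> \<le> (1 - t) * E x + t * E y"
      using t by (intro add_mono mult_left_mono minorant_le_envelope[OF g] xy) auto
    finally show "g ((1 - t) *\<^sub>R x + t *\<^sub>R y) \<le> (1 - t) * E x + t * E y" .
  qed
qed simp

lemmas envelope_three_points = convex_on_three_points[OF envelope_convex]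

text \<open>By the Lipschitz bound the line of slope -K from the left end, or K from the right end,
  lies below \<open>A\<close> on the whole interval.\<close>

lemma envelope_endpoints: "E (- 1/2) = A (- 1/2)" "E (1/2) = A (1/2)"
proof -
  have "A (- 1/2) + (- K) * (- 1/2 - - 1/2) \<le> E (- 1/2)"
  proof (rule line_le_envelope)
    show "A (- 1/2) + (- K) * (y - - 1/2) \<le> A y" if "y \<in> {- 1/2..1/2}" for y
      using lip_lines(1)[of "- 1/2" y] that by simp
  qed auto
  then show "E (- 1/2) = A (- 1/2)" using envelope_le[of "- 1/2"] by simp
  have "A (1/2) + K * (1/2 - 1/2) \<le> E (1/2)"
  proof (rule line_le_envelope)
    show "A (1/2) + K * (y - 1/2) \<le> A y" if "y \<in> {- 1/2..1/2}" for y
      using lip_lines(2)[of y "1/2"] that by simp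
  qed auto
  then show "E (1/2) = A (1/2)" using envelope_le[of "1/2"] by simp
qed

text \<open>The slopes of a convex function are extreme at the ends of the interval, where the
  envelope agrees with \<open>A\<close> and lies above the lines of slope -K and K. The three-point
  inequality transports this to any pair of points.\<close>

lemma envelope_lipschitz:
  assumes sb: "s \<in> {- 1/2..1/2}" "b \<in> {- 1/2..1/2}" "s \<le> b"
  shows "\<bar>E b - E s\<bar> \<le> K * (b - s)"
proof (cases "s = b")
  case False
  then have "s < b" using sb by simp
  have left: "E (- 1/2) + (- K) * (m - - 1/2) \<le> E m" if "m \<in> {- 1/2..1/2}" for m
  proof (rule line_le_envelope[OF _ that])
    show "E (- 1/2) + (- K) * (y - - 1/2) \<le> A y" if "y \<in> {- 1/2..1/2}" for y
      unfolding envelope_endpoints using lip_lines(1)[of "- 1/2" y] that by simp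
  qed
  have right: "E (1/2) + K * (m - 1/2) \<le> E m" if "m \<in> {- 1/2..1/2}" for m
  proof (rule line_le_envelope[OF _ that])
    show "E (1/2) + K * (y - 1/2) \<le> A y" if "y \<in> {- 1/2..1/2}" for y
      unfolding envelope_endpoints using lip_lines(2)[of y "1/2"] that by simp
  qed
  have "E s - E b \<le> K * (b - s)"
  proof (cases "s = - 1/2")
    case True
    then show ?thesis using left[of b] sb by (simp add: algebra_simps)
  next
    case False
    then have d: "0 < s - - 1/2" using sb by auto
    have "(b - - 1/2) * E s \<le> (b - s) * E (- 1/2) + (s - - 1/2) * E b"
      using sb by (intro envelope_three_points) auto
    moreover have "(b - s) * E (- 1/2) \<le> (b - s) * (E s + K * (s - - 1/2))"
      using left[OF sb(1)] sb by (intro mult_left_mono) auto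
    moreover have "(s - - 1/2) * (E s - E b) = (b - - 1/2) * E s - (b - s) * E s - (s - - 1/2) * E b"
      "(b - s) * (E s + K * (s - - 1/2)) = (b - s) * E s + (s - - 1/2) * (K * (b - s))"
      by (simp_all add: field_simps)
    ultimately have "(s - - 1/2) * (E s - E b) \<le> (s - - 1/2) * (K * (b - s))" by linarith
    then show ?thesis using d by simp
  qed
  moreover have "E b - E s \<le> K * (b - s)"
  proof (cases "b = 1/2")
    case True
    show ?thesis using right[OF sb(1)] unfolding True by (simp add: algebra_simps)
  next
    case False
    then have d: "0 < 1/2 - b" using sb by auto
    have "(1/2 - s) * E b \<le> (1/2 - b) * E s + (b - s) * E (1/2)"
      using sb by (intro envelope_three_points) auto
    moreover have "(b - s) * E (1/2) \<le> (b - s) * (E b + K * (1/2 - b))"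
      using right[OF sb(2)] sb by (intro mult_left_mono) (auto simp: algebra_simps)
    moreover have "(1/2 - b) * (E b - E s) = (1/2 - s) * E b - (b - s) * E b - (1/2 - b) * E s"
      "(b - s) * (E b + K * (1/2 - b)) = (b - s) * E b + (1/2 - b) * (K * (b - s))"
      by (simp_all add: field_simps)
    ultimately have "(1/2 - b) * (E b - E s) \<le> (1/2 - b) * (K * (b - s))" by linarith
    then show ?thesis using d by simp
  qed
  ultimately show ?thesis by (simp add: abs_le_iff)
qed simp

lemma lipschitz_continuous:
  fixes f :: "real \<Rightarrow> real"
  assumes "\<And>s b. s \<in> {- 1/2..1/2} \<Longrightarrow> b \<in> {- 1/2..1/2} \<Longrightarrow> s \<le> b \<Longrightarrow> \<bar>f b - f s\<bar> \<le> K * (b - s)"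
  shows "continuous_on {- 1/2..1/2} f"
proof (rule lipschitz_on_continuous_on)
  show "K-lipschitz_on {- 1/2..1/2} f"
  proof (rule lipschitz_onI)
    fix x y :: real assume xy: "x \<in> {- 1/2..1/2}" "y \<in> {- 1/2..1/2}"
    show "dist (f x) (f y) \<le> K * dist x y"
      using assms[OF xy] assms[OF xy(2,1)] by (cases "x \<le> y") (auto simp: dist_real_def abs_minus_commute)
  qed (rule K_nonneg)
qed

text \<open>A minimizer of A x - c x is a contact point of \<open>A\<close> with a supporting line
  of slope \<open>c\<close>, and this line is below the envelope as well.\<close>

lemma argmin_line:
  obtains x where "x \<in> {- 1/2..1/2}" "E x = A x"
    "\<And>y. y \<in> {- 1/2..1/2} \<Longrightarrow> A x + c * (y - x) \<le> A y" "\<And>y. y \<in> {- 1/2..1/2} \<Longrightarrow> E x + c * (y - x) \<le> E y"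
proof -
  have "continuous_on {- 1/2..1/2} (\<lambda>x. A x - c * x)"
    by (intro continuous_intros lipschitz_continuous lip)
  from continuous_attains_inf[OF compact_Icc _ this]
  obtain x where x: "x \<in> {- 1/2..1/2}" "\<And>y. y \<in> {- 1/2..1/2} \<Longrightarrow> A x - c * x \<le> A y - c * y" by auto
  have line: "A x + c * (y - x) \<le> A y" if "y \<in> {- 1/2..1/2}" for y
    using x(2)[OF that] by (simp add: algebra_simps)
  have lineE: "A x + c * (y - x) \<le> E y" if "y \<in> {- 1/2..1/2}" for y
    by (rule line_le_envelope[OF line that])
  have "E x = A x" using lineE[OF x(1)] envelope_le[OF x(1)] by simp
  with x(1) line lineE that show thesis by simp
qed

end

text \<open>The line of slope \<open>c\<close> supports the envelope and coincides with it on [a, b]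
  and nowhere else, which encodes both linearity and maximality.\<close>

locale affine_piece = lipschitz_flux +
  fixes a b c d :: real
  assumes ab: "- 1/2 \<le> a" "a < b" "b \<le> 1/2"
    and above: "x \<in> {- 1/2..1/2} \<Longrightarrow> c * x + d \<le> E x"
    and eq_iff: "x \<in> {- 1/2..1/2} \<Longrightarrow> E x = c * x + d \<longleftrightarrow> x \<in> {a..b}"
begin

text \<open>A slope \<open>c'\<close> strictly between \<open>c\<close> and the secant slope of the
  envelope from \<open>b\<close> to \<open>m1\<close> traps the minimizer: E x - c' x still
  decreases up to \<open>b\<close> and already increases from \<open>m1\<close> on.\<close>

lemma right_contact:
  assumes m1: "b < m1" "m1 \<le> 1/2"
  obtains x c' where "x \<in> {b..<m1}" "c < c'" "E x = A x"
    "\<And>y. y \<in> {- 1/2..1/2} \<Longrightarrow> A x + c' * (y - x) \<le> A y"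
proof -
  have Eb: "E b = c * b + d" using eq_iff[of b] ab by auto
  have Em1: "c * m1 + d < E m1" using eq_iff[of m1] above[of m1] ab m1 by force
  define c2 where "c2 = (E m1 - E b) / (m1 - b)"
  have c2: "E m1 = E b + c2 * (m1 - b)" using m1 by (simp add: c2_def)
  have "c * (m1 - b) < c2 * (m1 - b)" using c2 Em1 Eb by (simp add: algebra_simps)
  then have cc: "c < c2" using m1 by simp
  define c' where "c' = (c + c2) / 2"
  have c': "c < c'" "c' < c2" using cc by (auto simp: c'_def)
  obtain x where x: "x \<in> {- 1/2..1/2}" "E x = A x"
    "\<And>y. y \<in> {- 1/2..1/2} \<Longrightarrow> A x + c' * (y - x) \<le> A y" "\<And>y. y \<in> {- 1/2..1/2} \<Longrightarrow> E x + c' * (y - x) \<le> E y"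
    using argmin_line[of c'] by blast
  have xb: "E x + c' * (b - x) \<le> E b" using x(4)[of b] ab by auto
  have "b \<le> x"
  proof (rule ccontr)
    assume "\<not> b \<le> x"
    then have "c * (b - x) < c' * (b - x)" using c' by simp
    moreover have "c * x + d \<le> E x" using above x(1) .
    ultimately show False using xb Eb by (simp add: algebra_simps)
  qed
  moreover have "x < m1"
  proof (rule ccontr)
    assume "\<not> x < m1"
    then have "(x - b) * E m1 \<le> (x - m1) * E b + (m1 - b) * E x"
      using x(1) m1 ab by (intro envelope_three_points) auto
    then have "(m1 - b) * (E b + c2 * (x - b)) \<le> (m1 - b) * E x"
      unfolding c2 by (simp add: algebra_simps)
    then have "E b + c2 * (x - b) \<le> E x" using m1 by simp
    moreover have "c' * (x - b) < c2 * (x - b)" using c' \<open>\<not> x < m1\<close> m1 by simp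
    ultimately show False using xb by (simp add: algebra_simps)
  qed
  ultimately show thesis using that[of x c'] x c' by auto
qed

lemma left_contact:
  assumes m1: "- 1/2 \<le> m1" "m1 < a"
  obtains x c' where "x \<in> {m1<..a}" "c' < c" "E x = A x"
    "\<And>y. y \<in> {- 1/2..1/2} \<Longrightarrow> A x + c' * (y - x) \<le> A y"
proof -
  have Ea: "E a = c * a + d" using eq_iff[of a] ab by auto
  have Em1: "c * m1 + d < E m1" using eq_iff[of m1] above[of m1] ab m1 by force
  define c2 where "c2 = (E a - E m1) / (a - m1)"
  have c2: "E m1 = E a - c2 * (a - m1)" using m1 by (simp add: c2_def)
  have "c2 * (a - m1) < c * (a - m1)" using c2 Em1 Ea by (simp add: algebra_simps)
  then have cc: "c2 < c" using m1 by simp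
  define c' where "c' = (c + c2) / 2"
  have c': "c' < c" "c2 < c'" using cc by (auto simp: c'_def)
  obtain x where x: "x \<in> {- 1/2..1/2}" "E x = A x"
    "\<And>y. y \<in> {- 1/2..1/2} \<Longrightarrow> A x + c' * (y - x) \<le> A y" "\<And>y. y \<in> {- 1/2..1/2} \<Longrightarrow> E x + c' * (y - x) \<le> E y"
    using argmin_line[of c'] by blast
  have xa: "E x + c' * (a - x) \<le> E a" using x(4)[of a] ab by auto
  have "x \<le> a"
  proof (rule ccontr)
    assume "\<not> x \<le> a"
    then have "c' * (x - a) < c * (x - a)" using c' by simp
    moreover have "c * x + d \<le> E x" using above x(1) .
    ultimately show False using xa Ea by (simp add: algebra_simps)
  qed
  moreover have "m1 < x"
  proof (rule ccontr)
    assume "\<not> m1 < x"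
    then have "(a - x) * E m1 \<le> (a - m1) * E x + (m1 - x) * E a"
      using x(1) m1 ab by (intro envelope_three_points) auto
    then have "(a - m1) * (E a - c2 * (a - x)) \<le> (a - m1) * E x"
      unfolding c2 by (simp add: algebra_simps)
    then have "E a - c2 * (a - x) \<le> E x" using m1 by simp
    moreover have "c2 * (a - x) < c' * (a - x)" using c' \<open>\<not> m1 < x\<close> m1 by simp
    ultimately show False using xa by (simp add: algebra_simps)
  qed
  ultimately show thesis using that[of x c'] x c' by auto
qed

text \<open>An end of the piece is either an end of the label interval or a limit of the contact
  points found just outside the piece; A - E vanishes at those and has Lipschitz constant
  2K.\<close>

lemma contact:
  shows "A a = c * a + d" "A b = c * b + d"
proof -
  have ends: "E a = c * a + d" "E b = c * b + d" using eq_iff[of a] eq_iff[of b] ab by auto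
  have near: "A y - E y \<le> 2 * K * \<bar>x - y\<bar>" if "x \<in> {- 1/2..1/2}" "y \<in> {- 1/2..1/2}" "E x = A x" for x y
  proof (cases "x \<le> y")
    case True
    then show ?thesis using lip[OF that(1,2)] envelope_lipschitz[OF that(1,2)] that(3) by (auto simp: abs_le_iff)
  next
    case False
    then show ?thesis using lip[OF that(2,1)] envelope_lipschitz[OF that(2,1)] that(3) by (auto simp: abs_le_iff)
  qed
  have "A b \<le> E b"
  proof (rule ccontr)
    assume "\<not> A b \<le> E b"
    then have pos: "0 < A b - E b" by simp
    then have "b < 1/2" using envelope_endpoints ab by (cases "b = 1/2") auto
    \<comment> \<open>Within distance \<open>e\<close> of a contact point A - E is at most 2K e,
      which is less than its assumed value at \<open>b\<close>.\<close>
    define e where "e = (A b - E b) / (2 * K + 1)"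
    have e: "0 < e" "(2 * K + 1) * e = A b - E b" using pos K_nonneg by (auto simp: e_def)
    obtain x c' where x: "x \<in> {b..<min (1/2) (b + e)}" "E x = A x"
      using right_contact[of "min (1/2) (b + e)"] e \<open>b < 1/2\<close> by (metis min.cobounded1 min_less_iff_conj less_add_same_cancel1)
    have "A b - E b \<le> 2 * K * \<bar>x - b\<bar>" using near[of x b] x ab by auto
    also have "\<dots> \<le> 2 * K * e" using x K_nonneg by (intro mult_left_mono) auto
    also have "\<dots> < A b - E b" using e by (simp add: algebra_simps)
    finally show False by simp
  qed
  then show "A b = c * b + d" using envelope_le[of b] ends ab by auto
  have "A a \<le> E a"
  proof (rule ccontr)
    assume "\<not> A a \<le> E a"
    then have pos: "0 < A a - E a" by simp
    then have "- 1/2 < a" using envelope_endpoints ab by (cases "a = - 1/2") auto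
    define e where "e = (A a - E a) / (2 * K + 1)"
    have e: "0 < e" "(2 * K + 1) * e = A a - E a" using pos K_nonneg by (auto simp: e_def)
    have "- 1/2 \<le> max (- 1/2) (a - e)" "max (- 1/2) (a - e) < a" using e \<open>- 1/2 < a\<close> by auto
    from left_contact[OF this]
    obtain x where x: "x \<in> {max (- 1/2) (a - e)<..a}" "E x = A x" by blast
    have "A a - E a \<le> 2 * K * \<bar>x - a\<bar>" using near[of x a] x ab by auto
    also have "\<dots> \<le> 2 * K * e" using x K_nonneg by (intro mult_left_mono) auto
    also have "\<dots> < A a - E a" using e by (simp add: algebra_simps)
    finally show False by simp
  qed
  then show "A a = c * a + d" using envelope_le[of a] ends ab by auto
qed

lemma support_line:
  assumes "s \<in> {- 1/2..1/2}"
  shows "A b - c * (b - s) \<le> A s" "A a + c * (s - a) \<le> A s"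
  using above[OF assms] envelope_le[OF assms] contact by (auto simp: algebra_simps)

end

text \<open>By convexity, an affine function that agrees with the envelope on an interval lies below
  it everywhere, and the set where they agree is a closed interval. Dropping its left end gives the
  greatest admissible interval (a, b].\<close>

lemma (in lipschitz_flux) linear_region_cases:
  assumes m: "m \<in> {- 1/2<..1/2}" "m \<notin> Sigma_plus A"
  obtains a b c d where "affine_piece A K a b c d" "linear_region A m = {a<..b}" "m \<in> {a<..b}"
proof -
  obtain m0 where m0: "- 1/2 \<le> m0" "m0 < m" "affine_function_on {m0<..m} E"
    using m unfolding Sigma_plus_def by blast
  then obtain c d where cd: "\<And>y. y \<in> {m0<..m} \<Longrightarrow> E y = c * y + d" unfolding affine_function_on_def by blast
  \<comment> \<open>A second point of the interval; together with \<open>m\<close> it determines the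
    line.\<close>
  define u where "u = (m0 + m) / 2"
  have u: "m0 < u" "u < m" using m0 by (auto simp: u_def)
  have Eu: "E u = c * u + d" "E m = c * m + d" using cd u m0 by auto
  have I: "u \<in> {- 1/2..1/2}" "m \<in> {- 1/2..1/2}" using u m m0 by auto
  have above: "c * x + d \<le> E x" if x: "x \<in> {- 1/2..1/2}" for x
  proof -
    consider "m \<le> x" | "x \<le> u" | "u < x" "x < m" by linarith
    then show ?thesis
    proof cases
      case 1
      have "(x - u) * E m \<le> (x - m) * E u + (m - u) * E x"
        using 1 u I x by (intro envelope_three_points) auto
      then have "(m - u) * (c * x + d) \<le> (m - u) * E x" unfolding Eu by (simp add: algebra_simps)
      then show ?thesis using u by simp
    next
      case 2
      have "(m - x) * E u \<le> (m - u) * E x + (u - x) * E m"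
        using 2 u I x by (intro envelope_three_points) auto
      then have "(m - u) * (c * x + d) \<le> (m - u) * E x" unfolding Eu by (simp add: algebra_simps)
      then show ?thesis using u by simp
    next
      case 3
      then show ?thesis using cd[of x] u by simp
    qed
  qed
  define Z where "Z = {x \<in> {- 1/2..1/2}. E x = c * x + d}"
  have "closed Z"
  proof -
    have "continuous_on {- 1/2..1/2} (\<lambda>x. E x - (c * x + d))"
      by (intro continuous_intros lipschitz_continuous envelope_lipschitz)
    then have "closed ({- 1/2..1/2} \<inter> (\<lambda>x. E x - (c * x + d)) -` {0})"
      by (intro continuous_closed_preimage) auto
    also have "{- 1/2..1/2} \<inter> (\<lambda>x. E x - (c * x + d)) -` {0} = Z" by (auto simp: Z_def)
    finally show ?thesis .
  qed
  have Z: "u \<in> Z" "m \<in> Z" using I Eu by (auto simp: Z_def)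
  then have ne: "Z \<noteq> {}" by blast
  have bdd: "bdd_below Z" "bdd_above Z"
    by (rule bdd_belowI[of _ "- 1/2"], simp add: Z_def) (rule bdd_aboveI[of _ "1/2"], simp add: Z_def)
  define a b where "a = Inf Z" and "b = Sup Z"
  have aZ: "a \<in> Z" unfolding a_def by (rule closed_contains_Inf[OF ne bdd(1) \<open>closed Z\<close>])
  have bZ: "b \<in> Z" unfolding b_def by (rule closed_contains_Sup[OF ne bdd(2) \<open>closed Z\<close>])
  have a_le: "a \<le> x" and le_b: "x \<le> b" if "x \<in> Z" for x
    using cInf_lower[OF that bdd(1)] cSup_upper[OF that bdd(2)] by (auto simp: a_def b_def)
  have ab: "a < b" using a_le[OF Z(1)] le_b[OF Z(2)] u by simp
  have inZ: "x \<in> Z" if x: "x \<in> {a..b}" for x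
  proof -
    have ab': "a \<in> {- 1/2..1/2}" "b \<in> {- 1/2..1/2}" "E a = c * a + d" "E b = c * b + d"
      using aZ bZ by (auto simp: Z_def)
    have "(b - a) * E x \<le> (b - x) * E a + (x - a) * E b"
      using x ab' by (intro envelope_three_points) auto
    then have "(b - a) * E x \<le> (b - a) * (c * x + d)" unfolding ab' by (simp add: algebra_simps)
    then have "E x \<le> c * x + d" using ab by simp
    then show ?thesis using above[of x] x ab' by (auto simp: Z_def)
  qed
  have piece: "affine_piece A K a b c d"
  proof
    show "- 1/2 \<le> a" "b \<le> 1/2" using aZ bZ by (auto simp: Z_def)
    show "E x = c * x + d \<longleftrightarrow> x \<in> {a..b}" if "x \<in> {- 1/2..1/2}" for x
    proof -
      have "x \<in> Z \<longleftrightarrow> x \<in> {a..b}" using inZ[of x] a_le[of x] le_b[of x] by fastforce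
      then show ?thesis using that unfolding Z_def by blast
    qed
  qed (use ab above in auto)
  have mab: "m \<in> {a<..b}" using a_le[OF Z(1)] le_b[OF Z(2)] u by auto
  let ?P = "\<lambda>I. \<exists>a b. - 1/2 \<le> a \<and> b \<le> 1/2 \<and> I = {a<..b} \<and> m \<in> I \<and> affine_function_on I E"
  have "(GREATEST I. ?P I) = {a<..b}"
  proof (rule Greatest_equality)
    show "?P {a<..b}"
    proof (intro exI conjI)
      show "affine_function_on {a<..b} E"
        unfolding affine_function_on_def using inZ by (intro exI[of _ c] exI[of _ d]) (auto simp: Z_def)
    qed (use aZ bZ mab in \<open>auto simp: Z_def\<close>)
    fix J assume "?P J"
    then obtain a' b' where J: "- 1/2 \<le> a'" "b' \<le> 1/2" "J = {a'<..b'}" "m \<in> J" "affine_function_on J E" by blast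
    then obtain c' d' where cd': "\<And>y. y \<in> J \<Longrightarrow> E y = c' * y + d'" unfolding affine_function_on_def by blast
    \<comment> \<open>A point other than \<open>m\<close> common to \<open>J\<close> and the given
      interval, so the two lines agree at two points and coincide.\<close>
    define w where "w = (max a' m0 + m) / 2"
    have w: "a' < w" "m0 < w" "w < m" using J m0 by (auto simp: w_def)
    have "w \<in> J" using w J by auto
    have "w \<in> {m0<..m}" "m \<in> {m0<..m}" using w m0 by auto
    then have eqs: "c' * w + d' = c * w + d" "c' * m + d' = c * m + d"
      using cd' cd \<open>w \<in> J\<close> \<open>m \<in> J\<close> by metis+
    then have "(c' - c) * (m - w) = 0" by (simp add: algebra_simps)
    then have "c' = c" using w by simp
    then have "d' = d" using eqs by simp
    have JZ: "y \<in> Z" if "y \<in> J" for y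
      using cd'[OF that] that J unfolding \<open>c' = c\<close> \<open>d' = d\<close> Z_def by auto
    show "J \<le> {a<..b}"
    proof
      fix y assume y: "y \<in> J"
      then have "y \<le> b" using le_b JZ by blast
      \<comment> \<open>A point of \<open>J\<close> strictly left of \<open>y\<close>, which turns
        the weak bound by \<open>a\<close> into the strict one that the half-open interval asks
        for.\<close>
      have "(a' + y) / 2 \<in> J" using y J by auto
      then have "a \<le> (a' + y) / 2" using a_le JZ by blast
      then show "y \<in> {a<..b}" using y J \<open>y \<le> b\<close> by auto
    qed
  qed
  then have "linear_region A m = {a<..b}" using m(2) by (simp add: linear_region_def)
  with piece mab that show thesis by blast
qed

lemma (in lipschitz_flux) linear_region_self:
  assumes "m \<in> {- 1/2<..1/2}" shows "m \<in> linear_region A m"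
proof (cases "m \<in> Sigma_plus A")
  case True
  then show ?thesis by (simp add: linear_region_def)
next
  case False
  from linear_region_cases[OF assms this] show ?thesis by metis
qed

section \<open>Infinite-time clusters\<close>

context flow
begin

lemma lipschitz_flux: "lipschitz_flux A K"
proof
  fix s b :: real assume "s \<in> {- 1/2..1/2}" "b \<in> {- 1/2..1/2}" "s \<le> b"
  from slope_bound[OF this] show "\<bar>A b - A s\<bar> \<le> K * (b - s)" by (auto simp: abs_le_iff)
qed

lemma diameter_quantile_image:
  assumes "0 \<le> t" "J \<subseteq> {- 1/2<..1/2}" "x \<in> J" "y \<in> J"
  shows "X x t - X y t \<le> diameter ((\<lambda>s. X s t) ` J)"
proof -
  obtain R where "bounded_distribution (\<rho> t) R" using obtain_dist[OF assms(1)] .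
  then interpret t: bounded_distribution "\<rho> t" R .
  have "(\<lambda>s. X s t) ` J \<subseteq> {-R..R}" using assms(2) t.quantile_bounds by auto
  then have "bounded ((\<lambda>s. X s t) ` J)" by (rule bounded_subset[OF bounded_closed_interval])
  from diameter_bounded_bound[OF this, of "X x t" "X y t"] assms(3,4) show ?thesis by (auto simp: dist_real_def)
qed

lemma collapsing_interval_squeeze:
  assumes "collapsing_interval X m J" "x \<in> J" "y \<in> J"
    and f: "\<And>t. 0 \<le> t \<Longrightarrow> 0 \<le> f t" "\<And>t. 0 \<le> t \<Longrightarrow> f t \<le> X x t - X y t"
  shows "(f \<longlongrightarrow> 0) at_top"
proof (rule tendsto_sandwich[where f="\<lambda>_. 0" and h="\<lambda>t. diameter ((\<lambda>s. X s t) ` J)"])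
  have J: "J \<subseteq> {- 1/2<..1/2}" and lim: "((\<lambda>t. diameter ((\<lambda>s. X s t) ` J)) \<longlongrightarrow> 0) at_top"
    using assms(1) by (auto simp: collapsing_interval_def)
  show "((\<lambda>t. diameter ((\<lambda>s. X s t) ` J)) \<longlongrightarrow> 0) at_top" by (rule lim)
  show "((\<lambda>t. 0) \<longlongrightarrow> (0::real)) at_top" by simp
  show "\<forall>\<^sub>F t in at_top. 0 \<le> f t"
    using eventually_ge_at_top[of 0]
  proof eventually_elim
    case (elim t)
    then show ?case by (rule f)
  qed
  show "\<forall>\<^sub>F t in at_top. f t \<le> diameter ((\<lambda>s. X s t) ` J)"
    using eventually_ge_at_top[of 0]
  proof eventually_elim
    case (elim t)
    then show ?case using f(2)[of t] diameter_quantile_image[OF elim J assms(2,3)] by linarith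
  qed
qed

lemma collapsing_interval_subset:
  assumes piece: "affine_piece A K a b c d" and m: "m \<in> {a<..b}" and J: "collapsing_interval X m J"
  shows "J \<subseteq> {a<..b}"
proof
  interpret affine_piece A K a b c d by fact
  fix x assume x: "x \<in> J"
  have JI: "J \<subseteq> {- 1/2<..1/2}" "m \<in> J" using J by (auto simp: collapsing_interval_def)
  obtain l r where lr: "J = {l<..r} \<or> J = {l<..<r}" using J by (auto simp: collapsing_interval_def)
  have conv: "z \<in> J" if "y \<in> J" "w \<in> J" "y \<le> z" "z \<le> w" for y z w using lr that by auto
  have xI: "x \<in> {- 1/2<..1/2}" using JI x by blast
  show "x \<in> {a<..b}"
  proof (rule ccontr)
    assume "x \<notin> {a<..b}"
    then consider "b < x" | "x \<le> a" by force
    then show False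
    proof cases
      case 1
      have x_le: "x \<le> 1/2" using xI by simp
      \<comment> \<open>The contact point may be \<open>b\<close> itself. In any case
        \<open>X b\<close> and \<open>Xu p\<close> lie between the quantiles of the labels
        \<open>b\<close> and \<open>x\<close> of \<open>J\<close>, which forces their gap to
        close.\<close>
      obtain p c' where p: "p \<in> {b..<x}" "c < c'" "E p = A p" "\<And>y. y \<in> {- 1/2..1/2} \<Longrightarrow> A p + c' * (y - p) \<le> A y"
        by (rule right_contact[OF 1 x_le]) (rule that)
      have bI: "b \<in> {- 1/2<..1/2}" and pI: "p \<in> {- 1/2..<1/2}" using ab p xI by auto
      have bJ: "b \<in> J" using conv[OF JI(2) x] m 1 by simp
      have "((\<lambda>t. Xu p t - X b t) \<longlongrightarrow> 0) at_top"
      proof (rule collapsing_interval_squeeze[OF J x bJ])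
        fix t :: real assume "0 \<le> t"
        then obtain R where "bounded_distribution (\<rho> t) R" using obtain_dist by blast
        then interpret t: bounded_distribution "\<rho> t" R .
        show "0 \<le> Xu p t - X b t" using t.quantile_le_upper_quantile[OF pI bI] p by simp
        show "Xu p t - X b t \<le> X x t - X b t" using t.upper_quantile_le_quantile[OF pI xI] p by simp
      qed
      moreover have "\<not> ((\<lambda>t. Xu p t - X b t) \<longlongrightarrow> 0) at_top"
      proof (rule gap_not_tendsto_0[OF bI _ pI])
        show "A b - c * (b - s) \<le> A s" if "s \<in> {- 1/2..b}" for s using support_line(1)[of s] that ab by simp
        show "A p + c' * (s - p) \<le> A s" if "s \<in> {p..1/2}" for s using p(4)[of s] that pI by simp
      qed (use p in auto)
      ultimately show False by simp
    next
      case 2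
      \<comment> \<open>A collapsing interval is open on the left, so even for x = a it contains a
        label strictly left of \<open>a\<close>.\<close>
      obtain y where y: "y \<in> J" "y < x"
      proof
        have "l < x" using lr x by auto
        then show "(l + x) / 2 \<in> J" "(l + x) / 2 < x" using lr x by auto
      qed
      have yI: "y \<in> {- 1/2<..1/2}" using JI y by blast
      have ya: "- 1/2 \<le> y" "y < a" using yI y 2 by auto
      obtain p c' where p: "p \<in> {y<..a}" "c' < c" "E p = A p" "\<And>z. z \<in> {- 1/2..1/2} \<Longrightarrow> A p + c' * (z - p) \<le> A z"
        by (rule left_contact[OF ya]) (rule that)
      have pI: "p \<in> {- 1/2<..1/2}" and aI: "a \<in> {- 1/2..<1/2}" using ab p yI by auto
      have mI: "m \<in> {- 1/2<..1/2}" using JI by blast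
      have "((\<lambda>t. Xu a t - X p t) \<longlongrightarrow> 0) at_top"
      proof (rule collapsing_interval_squeeze[OF J JI(2) y(1)])
        fix t :: real assume "0 \<le> t"
        then obtain R where "bounded_distribution (\<rho> t) R" using obtain_dist by blast
        then interpret t: bounded_distribution "\<rho> t" R .
        show "0 \<le> Xu a t - X p t" using t.quantile_le_upper_quantile[OF aI pI] p by simp
        have "Xu a t \<le> X m t" using t.upper_quantile_le_quantile[OF aI mI] m by simp
        moreover have "X y t \<le> X p t" using t.quantile_mono[OF yI pI] p by simp
        ultimately show "Xu a t - X p t \<le> X m t - X y t" by simp
      qed
      moreover have "\<not> ((\<lambda>t. Xu a t - X p t) \<longlongrightarrow> 0) at_top"
      proof (rule gap_not_tendsto_0[OF pI _ aI])
        show "A p - c' * (p - s) \<le> A s" if "s \<in> {- 1/2..p}" for s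
          using p(4)[of s] that pI by (simp add: algebra_simps)
        show "A a + c * (s - a) \<le> A s" if "s \<in> {a..1/2}" for s using support_line(2)[of s] that ab by simp
      qed (use p in auto)
      ultimately show False by simp
    qed
  qed
qed

lemma affine_piece_decay:
  assumes piece: "affine_piece A K a b c d" and D: "uniform_diameter_bound \<rho> D" and t: "0 \<le> t"
    and x: "x \<in> {a<..b}" and y: "y \<in> {a<..b}"
  shows "X x t - X y t \<le> diameter (msupport (\<rho> 0)) * exp (- \<phi> D * t)"
proof -
  interpret affine_piece A K a b c d by fact
  obtain R where "bounded_distribution (\<rho> t) R" using obtain_dist[OF t] .
  then interpret t: bounded_distribution "\<rho> t" R .
  have "X x t \<le> X b t" using x ab by (intro t.quantile_mono) auto
  moreover have "Xu a t \<le> X y t" using y ab by (intro t.upper_quantile_le_quantile) auto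
  moreover have "X b t - Xu a t \<le> diameter (msupport (\<rho> 0)) * exp (- \<phi> D * t)"
    using ab support_line by (intro gap_decay[where c=c] D t) auto
  ultimately show ?thesis by linarith
qed

lemma affine_piece_cluster:
  assumes heavy: "heavy_tailed \<phi>" and piece: "affine_piece A K a b c d" and m: "m \<in> {a<..b}"
  shows "infinite_time_cluster_at X m {a<..b}"
proof -
  interpret affine_piece A K a b c d by fact
  obtain D where D: "uniform_diameter_bound \<rho> D" using diameter_bounded[OF heavy] by blast
  then have "0 < \<phi> D" using heavy_tailed_pos[OF heavy] by (auto simp: uniform_diameter_bound_def)
  define B where "B t = diameter (msupport (\<rho> 0)) * exp (- \<phi> D * t)" for t
  have B: "(B \<longlongrightarrow> 0) at_top"
  proof -
    have "filterlim (\<lambda>t. \<phi> D * t) at_top at_top"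
      using \<open>0 < \<phi> D\<close> by (intro filterlim_tendsto_pos_mult_at_top[OF tendsto_const _ filterlim_ident])
    then have "((\<lambda>t. exp (- (\<phi> D * t))) \<longlongrightarrow> 0) at_top"
      by (intro filterlim_compose[OF exp_at_bot]) (simp add: filterlim_uminus_at_bot)
    from tendsto_mult_right_zero[OF this] show ?thesis by (simp add: B_def[abs_def])
  qed
  have le: "X x t - X y t \<le> B t" if "0 \<le> t" "x \<in> {a<..b}" "y \<in> {a<..b}" for x y t
    unfolding B_def by (rule affine_piece_decay[OF piece D that])
  have sub: "{a<..b} \<subseteq> {- 1/2<..1/2}" using ab by auto
  define m1 where "m1 = (a + m) / 2"
  have m1: "m1 \<in> {a<..b}" "m1 < m" using m by (auto simp: m1_def)
  have "((\<lambda>t. X m t - X m1 t) \<longlongrightarrow> 0) at_top"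
  proof (rule tendsto_sandwich[OF _ _ tendsto_const B])
    show "\<forall>\<^sub>F t in at_top. 0 \<le> X m t - X m1 t" using eventually_ge_at_top[of 0]
    proof eventually_elim
      case (elim t)
      then obtain R where "bounded_distribution (\<rho> t) R" using obtain_dist by blast
      then interpret t: bounded_distribution "\<rho> t" R .
      have "X m1 t \<le> X m t" using m m1 ab by (intro t.quantile_mono) auto
      then show ?case by simp
    qed
    show "\<forall>\<^sub>F t in at_top. X m t - X m1 t \<le> B t"
      using eventually_ge_at_top[of 0]
    proof eventually_elim
      case (elim t)
      then show ?case by (rule le[OF _ m m1(1)])
    qed
  qed
  moreover have "((\<lambda>t. diameter ((\<lambda>s. X s t) ` {a<..b})) \<longlongrightarrow> 0) at_top"
  proof (rule tendsto_sandwich[OF _ _ tendsto_const B])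
    show "\<forall>\<^sub>F t in at_top. 0 \<le> diameter ((\<lambda>s. X s t) ` {a<..b})" using eventually_ge_at_top[of 0]
    proof eventually_elim
      case (elim t)
      show ?case using diameter_quantile_image[OF elim sub m m] by simp
    qed
    show "\<forall>\<^sub>F t in at_top. diameter ((\<lambda>s. X s t) ` {a<..b}) \<le> B t" using eventually_ge_at_top[of 0]
    proof eventually_elim
      case (elim t)
      show ?case
      proof (rule diameter_le)
        show "(\<lambda>s. X s t) ` {a<..b} \<noteq> {} \<or> 0 \<le> B t" using m by blast
        fix u w assume "u \<in> (\<lambda>s. X s t) ` {a<..b}" "w \<in> (\<lambda>s. X s t) ` {a<..b}"
        then obtain x y where "u = X x t" "w = X y t" "x \<in> {a<..b}" "y \<in> {a<..b}" by blast
        then show "norm (u - w) \<le> B t" using le[OF elim, of x y] le[OF elim, of y x] by (auto simp: abs_le_iff)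
      qed
    qed
  qed
  ultimately show ?thesis
    unfolding infinite_time_cluster_at_def
  proof (intro conjI allI impI bexI[of _ m1])
    assume "((\<lambda>t. diameter ((\<lambda>s. X s t) ` {a<..b})) \<longlongrightarrow> 0) at_top"
    then show "collapsing_interval X m {a<..b}" using m sub unfolding collapsing_interval_def by blast
    show "J \<subseteq> {a<..b}" if "collapsing_interval X m J" for J
      using collapsing_interval_subset[OF piece m that] .
  qed (use m1 sub in auto)
qed

end

section \<open>From the given data to a flow\<close>

lemma infinite_time_cluster_at_cong:
  assumes "\<And>m t. 0 \<le> t \<Longrightarrow> X m t = Y m t"
  shows "infinite_time_cluster_at X = infinite_time_cluster_at Y"
proof -
  \<comment> \<open>Only large times matter here, and \<open>M\<close> is tied to the measures at
    nonnegative times only.\<close>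
  have ev: "\<forall>\<^sub>F t::real in at_top. 0 \<le> t" by (rule eventually_ge_at_top)
  have "((\<lambda>t. X m t - X m1 t) \<longlongrightarrow> 0) at_top \<longleftrightarrow> ((\<lambda>t. Y m t - Y m1 t) \<longlongrightarrow> 0) at_top" for m m1
    by (rule tendsto_cong) (use ev in eventually_elim, simp add: assms)
  moreover have "collapsing_interval X = collapsing_interval Y"
  proof (intro ext)
    fix m I
    have "((\<lambda>t. diameter ((\<lambda>s. X s t) ` I)) \<longlongrightarrow> 0) at_top \<longleftrightarrow> ((\<lambda>t. diameter ((\<lambda>s. Y s t) ` I)) \<longlongrightarrow> 0) at_top"
      by (rule tendsto_cong) (use ev in eventually_elim, simp add: assms)
    then show "collapsing_interval X m I = collapsing_interval Y m I" by (simp add: collapsing_interval_def)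
  qed
  ultimately show ?thesis by (intro ext) (simp add: infinite_time_cluster_at_def)
qed

text \<open>The initial velocity is bounded almost everywhere and the convolution is evaluated at
  support points, so \<open>\<psi>0\<close> is bounded at almost every label. Truncation extends the
  bound to all labels and leaves the integrals unchanged.\<close>

lemma flux_density:
  assumes kernel: "communication_kernel \<phi>" and \<rho>0: "real_distribution \<rho>0" "compact (msupport \<rho>0)"
    and u0: "u0 \<in> borel_measurable \<rho>0" "\<exists>C. AE x in \<rho>0. \<bar>u0 x\<bar> \<le> C"
  obtains \<psi> K where "\<psi> \<in> borel_measurable labels" "\<And>m. \<bar>\<psi> m\<bar> \<le> K"
    "\<And>u. u \<in> {- 1/2..1/2} \<Longrightarrow> flux \<phi> \<rho>0 u0 u = (\<integral>m. indicator {..u} m * \<psi> m \<partial>labels)"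
proof -
  interpret kernel \<phi> by unfold_locales (rule kernel)
  interpret real_distribution \<rho>0 by fact
  obtain R where R: "\<And>x. x \<in> msupport \<rho>0 \<Longrightarrow> norm x \<le> R"
    using compact_imp_bounded[OF \<rho>0(2)] unfolding bounded_iff by blast
  interpret bounded_distribution \<rho>0 R
    by unfold_locales (use R in \<open>force simp: abs_le_iff\<close>)
  obtain C where C: "AE x in \<rho>0. \<bar>u0 x\<bar> \<le> C" using u0(2) by blast
  define \<psi>0 where "\<psi>0 m = u0 (quantile \<rho>0 m) + potential_conv \<phi> \<rho>0 (quantile \<rho>0 m)" for m
  \<comment> \<open>Two quantiles of \<open>\<rho>0\<close> are at most 2|R| apart.\<close>
  define B where "B = potential \<phi> (2 * \<bar>R\<bar>)"
  note q = potential_quantile[OF bounded_distribution_axioms]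
  from q(5) have pcm: "potential_conv \<phi> \<rho>0 \<in> borel_measurable borel" by (rule borel_measurable_mono)
  have "u0 \<in> borel_measurable borel" using u0(1) by simp
  then have m\<psi>0: "\<psi>0 \<in> borel_measurable labels"
    unfolding \<psi>0_def[abs_def]
    by (intro borel_measurable_add measurable_compose[OF measurable_quantile] pcm)
  have pcb: "\<bar>potential_conv \<phi> \<rho>0 (quantile \<rho>0 m)\<bar> \<le> B" if m: "m \<in> {- 1/2<..1/2}" for m
    unfolding q(1)
  proof (rule labels.integral_abs_bound[OF q(2)])
    fix m' assume "m' \<in> space labels"
    then have "\<bar>potential \<phi> (quantile \<rho>0 m - quantile \<rho>0 m')\<bar> \<le> potential \<phi> (\<bar>quantile \<rho>0 m\<bar> + \<bar>R\<bar>)"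
      by (intro q(3)) simp
    also have "\<dots> \<le> B" unfolding B_def using quantile_bounds[OF m] by (intro potential_mono) linarith
    finally show "\<bar>potential \<phi> (quantile \<rho>0 m - quantile \<rho>0 m')\<bar> \<le> B" .
  qed
  define K where "K = \<bar>C\<bar> + \<bar>B\<bar>"
  define \<psi> where "\<psi> m = max (- K) (min K (\<psi>0 m))" for m
  have AE: "AE m in labels. \<psi> m = \<psi>0 m"
  proof -
    have "AE m in labels. m \<in> {- 1/2<..1/2}" by (rule AE_I2) simp
    with AE_quantile[OF C] show ?thesis
    proof eventually_elim
      case (elim m)
      then have "\<bar>\<psi>0 m\<bar> \<le> K" using pcb[OF elim(2)] unfolding \<psi>0_def K_def by linarith
      then show ?case by (auto simp: \<psi>_def)
    qed
  qed
  show thesis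
  proof
    show m\<psi>: "\<psi> \<in> borel_measurable labels" unfolding \<psi>_def[abs_def] using m\<psi>0 by measurable
    show "\<bar>\<psi> m\<bar> \<le> K" for m by (auto simp: \<psi>_def max_def min_def K_def)
    fix u :: real assume u: "u \<in> {- 1/2..1/2}"
    have "flux \<phi> \<rho>0 u0 u = (LBINT s. indicator {- 1/2..u} s *\<^sub>R \<psi>0 s)"
      by (simp add: flux_def Let_def \<psi>0_def set_lebesgue_integral_def)
    \<comment> \<open>The flux integrates from the closed end -1/2, a single point outside the label
      interval.\<close>
    also have "\<dots> = (LBINT s. indicator {- 1/2<..1/2} s *\<^sub>R (indicator {..u} s * \<psi>0 s))"
      using u by (intro integral_discrete_difference[where X="{- 1/2}"]) (auto simp: indicator_def)
    also have "\<dots> = (\<integral>m. indicator {..u} m * \<psi>0 m \<partial>labels)"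
      unfolding integral_labels set_lebesgue_integral_def ..
    also have "\<dots> = (\<integral>m. indicator {..u} m * \<psi> m \<partial>labels)"
    proof (rule integral_cong_AE)
      show "(\<lambda>m. indicator {..u} m * \<psi>0 m) \<in> borel_measurable labels" "(\<lambda>m. indicator {..u} m * \<psi> m) \<in> borel_measurable labels"
        by (intro borel_measurable_times[OF measurable_labelsI] m\<psi> m\<psi>0; simp)+
      show "AE m in labels. indicator {..u} m * \<psi>0 m = indicator {..u} m * \<psi> m" using AE by eventually_elim simp
    qed
    finally show "flux \<phi> \<rho>0 u0 u = (\<integral>m. indicator {..u} m * \<psi> m \<partial>labels)" .
  qed
qed

theorem theorem5p4:
  fixes \<phi> u0 A :: "real \<Rightarrow> real"
    and \<rho>0 :: "real measure"
    and \<rho> :: "real \<Rightarrow> real measure"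
    and M X :: "real \<Rightarrow> real \<Rightarrow> real"
    and m' m'' :: real
  assumes "communication_kernel \<phi>"
    and "heavy_tailed \<phi>"
    and "real_distribution \<rho>0" and "compact (msupport \<rho>0)"
    and "u0 \<in> borel_measurable \<rho>0" and "\<exists>C. AE x in \<rho>0. \<bar>u0 x\<bar> \<le> C"
    and "A = flux \<phi> \<rho>0 u0"
    and "\<forall>p\<in>frontier (Sigma_minus A). \<exists>\<epsilon>>0. convex_on (ball p \<epsilon> \<inter> {- 1/2..1/2}) A"
    and "entropy_solution \<phi> A (centered_cdf \<rho>0) \<rho> M"
    and "X = (\<lambda>m t. gen_inverse (\<lambda>x. M x t) m)"
    and "m' \<in> {- 1/2<..1/2}" and "m'' \<in> {- 1/2<..1/2}"
    and "linear_region A m' = linear_region A m''" and "m' < m''"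
  shows "(\<exists>D. uniform_diameter_bound \<rho> D) \<and>
    (\<forall>D. uniform_diameter_bound \<rho> D \<longrightarrow>
       0 < \<phi> D \<and>
       (\<forall>t\<ge>0. X m'' t - X m' t \<le> diameter (msupport \<rho>0) * exp (- \<phi> D * t))) \<and>
    (\<forall>m\<in>linear_region A m'. infinite_time_cluster_at X m (linear_region A m'))"
proof -
  note sol = assms(9)[unfolded entropy_solution_def]
  have dist: "\<And>t. 0 \<le> t \<Longrightarrow> real_distribution (\<rho> t)" and M: "\<And>x t. 0 \<le> t \<Longrightarrow> M x t = centered_cdf (\<rho> t) x"
    and bounded: "\<And>T. \<exists>R. \<forall>t\<in>{0..T}. msupport (\<rho> t) \<subseteq> {-R..R}"
    and L1: "\<And>s. 0 \<le> s \<Longrightarrow>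
      ((\<lambda>t. LBINT x. \<bar>(M x t - centered_cdf \<rho>0 x) - (M x s - centered_cdf \<rho>0 x)\<bar>) \<longlongrightarrow> 0) (at s within {0..})"
    and init: "\<And>x. M x 0 = centered_cdf \<rho>0 x"
    and entropy: "\<And>\<alpha>. \<alpha> \<in> {- 1/2..1/2} \<Longrightarrow> entropy_inequality \<phi> A \<rho> M \<alpha>"
    using sol by blast+
  obtain \<psi> K where \<psi>: "\<psi> \<in> borel_measurable labels" "\<And>m. \<bar>\<psi> m\<bar> \<le> K"
    "\<And>u. u \<in> {- 1/2..1/2} \<Longrightarrow> A u = (\<integral>m. indicator {..u} m * \<psi> m \<partial>labels)"
    using flux_density[OF assms(1,3-6)] unfolding assms(7) by blast
  interpret flow \<phi> \<rho> M A \<psi> K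
  proof (intro flow.intro curve.intro kernel.intro curve_axioms.intro flow_axioms.intro)
    fix s :: real assume s: "0 \<le> s"
    show "((\<lambda>t. LBINT x. \<bar>centered_cdf (\<rho> t) x - centered_cdf (\<rho> s) x\<bar>) \<longlongrightarrow> 0) (at s within {0..})"
    proof (rule Lim_transform_eventually[OF L1[OF s]])
      have "\<forall>\<^sub>F t in at s within {0..}. 0 \<le> t" by (simp add: eventually_at_filter)
      then show "\<forall>\<^sub>F t in at s within {0..}. (LBINT x. \<bar>(M x t - centered_cdf \<rho>0 x) - (M x s - centered_cdf \<rho>0 x)\<bar>) =
          (LBINT x. \<bar>centered_cdf (\<rho> t) x - centered_cdf (\<rho> s) x\<bar>)"
        by eventually_elim (simp add: M s)
    qed
  qed (fact assms(1) dist bounded M \<psi> entropy)+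
  have X: "X m t = quantile (\<rho> t) m" if "0 \<le> t" for m t
    using M[OF that] by (simp add: assms(10))
  \<comment> \<open>The decay estimate for a flow involves the support at time 0; the distribution
    function identifies this measure with the initial one.\<close>
  have \<rho>0: "\<rho> 0 = \<rho>0"
  proof (rule cdf_unique)
    have "centered_cdf (\<rho> 0) x = centered_cdf \<rho>0 x" for x using M[of 0 x] init[of x] by simp
    then show "cdf (\<rho> 0) = cdf \<rho>0" by (simp add: centered_cdf_def fun_eq_iff)
  qed (use dist assms(3) in auto)
  interpret lipschitz_flux A K by (rule lipschitz_flux)
  have "m'' \<in> linear_region A m'" using linear_region_self[OF assms(12)] assms(13) by simp
  \<comment> \<open>Otherwise the region of \<open>m'\<close> would be a singleton, but it contains
    the larger label \<open>m''\<close>.\<close>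
  then have "m' \<notin> Sigma_plus A" using assms(14) by (auto simp: linear_region_def)
  then obtain a b c d where piece: "affine_piece A K a b c d" and L: "linear_region A m' = {a<..b}" "m' \<in> {a<..b}"
    using linear_region_cases[OF assms(11)] by metis
  have m'': "m'' \<in> {a<..b}" using \<open>m'' \<in> linear_region A m'\<close> L by simp
  show ?thesis
  proof (intro conjI allI impI ballI)
    show "\<exists>D. uniform_diameter_bound \<rho> D" by (rule diameter_bounded[OF assms(2)])
    fix D assume D: "uniform_diameter_bound \<rho> D"
    then show "0 < \<phi> D" using heavy_tailed_pos[OF assms(2)] by (simp add: uniform_diameter_bound_def)
    fix t :: real assume "0 \<le> t"
    then show "X m'' t - X m' t \<le> diameter (msupport \<rho>0) * exp (- \<phi> D * t)"
      using affine_piece_decay[OF piece D _ m'' L(2)] by (simp add: X \<rho>0)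
  next
    fix m assume "m \<in> linear_region A m'"
    then show "infinite_time_cluster_at X m (linear_region A m')"
      using affine_piece_cluster[OF assms(2) piece] infinite_time_cluster_at_cong[of X "\<lambda>m t. quantile (\<rho> t) m", OF X] L
      by simp
  qed
qed

end
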